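(* Consider a $k$-Median instance with $2\le k\le n/3$ in which every customer $j\in W$ has a center $i\in U$ with $c_{ij}=0$. A set $C\subseteq U$ of size at most $T$ with $\tilde c(\lambda^*,C)<1$ can be computed in polynomial time.
   Context: A $k$-Median instance is a bipartite graph $G=(U,W,E)$ (centers $U$, customers $W$), costs $c_{ij}\ge0$ for $(i,j)\in E$, $c_{ij}=\infty$ for $(i,j)\notin E$, and a positive integer $k$; $n=|W|$, $m=|E|$. $T=\lceil k\ln(n^2/(2k(2k+1)))\rceil$. $\lambda^*\in\mathbb{R}_{\ge0}\cup\{\infty\}$ is the optimum value of the LP: minimize $\sum_{(i,j)\in E}c_{ij}y_{ij}$ subject to $x_i\ge y_{ij}\ge0$ for all $(i,j)\in E$, $\sum_{i:(i,j)\in E}y_{ij}=1$ for all $j\in W$, $\sum_{i\in U}x_i=k$ ($\lambda^*=\infty$ if infeasible). For $\lambda\in\mathbb{R}_{\ge0}\cup\{\infty\}$ and $C\subseteq U$, the capped cost of customer $j$ is $\tilde c_j(\lambda,C)=\min\big(1/(2k+1),\,(1-2k/n)\min_{i\in C}c_{ij}/\lambda\big)$, where $0/0$ and $\infty/\infty$ are interpreted as $0$ (and the minimum over the empty set is $\infty$), and $\tilde c(\lambda,C)=\sum_{j\in W}\tilde c_j(\lambda,C)$.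
   Formalization: The LP also requires x_i ≥ 0 for every center i (relevant only for centers without edges; otherwise x_i is free, λ* drops to 0 and the claim fails). Polynomial time is for instances with rational costs, measured in bit length; existence of C is shown for all real costs. *)

theory Defs
  imports
    "HOL-Analysis.Analysis"
    "HOL-Library.Log_Nat"
    "HOL-Computational_Algebra.Polynomial"
begin

section \<open>\<open>k\<close>-Median instances\<close>

record ('u, 'w) kmedian =
  centers :: "'u set"
  customers :: "'w set"
  edges :: "('u \<times> 'w) set"
  cost :: "'u \<Rightarrow> 'w \<Rightarrow> real"
  budget :: nat

definition kmedian_instance :: "('u, 'w) kmedian \<Rightarrow> bool" where
  "kmedian_instance I \<longleftrightarrow>
     finite (centers I) \<and> finite (customers I) \<and>
     edges I \<subseteq> centers I \<times> customers I \<and>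
     (\<forall>(i, j) \<in> edges I. 0 \<le> cost I i j) \<and>
     0 < budget I"

definition ecost :: "('u, 'w) kmedian \<Rightarrow> 'u \<Rightarrow> 'w \<Rightarrow> ereal" where
  "ecost I i j = (if (i, j) \<in> edges I then ereal (cost I i j) else \<infinity>)"

definition size_bound :: "('u, 'w) kmedian \<Rightarrow> int" where
  "size_bound I =
     (let k = real (budget I); n = real (card (customers I))
      in \<lceil>k * ln (n\<^sup>2 / (2 * k * (2 * k + 1)))\<rceil>)"

text \<open>
  The first conjunct follows from the second for every center that has an incident edge. It only
  matters for isolated centers, whose variable would otherwise be unrestricted in sign, so that
  the constraint on the sum of the \<open>x i\<close> would be void.
\<close>
definition lp_feasible :: "('u, 'w) kmedian \<Rightarrow> ('u \<Rightarrow> real) \<Rightarrow> ('u \<Rightarrow> 'w \<Rightarrow> real) \<Rightarrow> bool" where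
  "lp_feasible I x y \<longleftrightarrow>
     (\<forall>i \<in> centers I. 0 \<le> x i) \<and>
     (\<forall>(i, j) \<in> edges I. y i j \<le> x i \<and> 0 \<le> y i j) \<and>
     (\<forall>j \<in> customers I. (\<Sum>i | (i, j) \<in> edges I. y i j) = 1) \<and>
     (\<Sum>i \<in> centers I. x i) = real (budget I)"

text \<open>The infimum of the empty set is \<open>\<infinity>\<close> in \<^typ>\<open>ereal\<close>.\<close>
definition lp_opt :: "('u, 'w) kmedian \<Rightarrow> ereal" where
  "lp_opt I =
     Inf {ereal (\<Sum>(i, j) \<in> edges I. cost I i j * y i j) | x y. lp_feasible I x y}"

text \<open>
  Division in \<^typ>\<open>ereal\<close> satisfies \<open>0 / 0 = 0\<close>, \<open>\<infinity> / \<infinity> = 0\<close>, and \<open>a / 0 = \<infinity>\<close> for \<open>a > 0\<close>.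
\<close>
definition capped_cost :: "('u, 'w) kmedian \<Rightarrow> ereal \<Rightarrow> 'u set \<Rightarrow> 'w \<Rightarrow> ereal" where
  "capped_cost I l C j =
     (let k = real (budget I); n = real (card (customers I))
      in min (ereal (1 / (2 * k + 1)))
             (ereal (1 - 2 * k / n) * ((INF i \<in> C. ecost I i j) / l)))"

definition total_capped_cost :: "('u, 'w) kmedian \<Rightarrow> ereal \<Rightarrow> 'u set \<Rightarrow> ereal" where
  "total_capped_cost I l C = (\<Sum>j \<in> customers I. capped_cost I l C j)"

lemma ereal_division_conventions:
  "(0 :: ereal) / 0 = 0"
  "(\<infinity> :: ereal) / \<infinity> = 0"
  "0 < a \<Longrightarrow> (a :: ereal) / 0 = \<infinity>"
  "0 < r \<Longrightarrow> (\<infinity> :: ereal) / ereal r = \<infinity>"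
  by (simp_all add: divide_ereal_def)


section \<open>Polynomial time\<close>

text \<open>
  The machine model is a structured random access machine over the integers with the logarithmic
  cost criterion: every operation is charged the bit lengths of the integers it handles, addresses
  included. A program addresses finitely many arrays by name; a scalar variable is an array
  used at one index only. Memory is \<open>0\<close> wherever it has not been written.
\<close>

type_synonym memory = "nat \<Rightarrow> int \<Rightarrow> int"

definition bits :: "int \<Rightarrow> nat" where
  "bits z = nat (bitlen \<bar>z\<bar>) + 1"

datatype aexp =
    Num int
  | Read nat aexp
  | Add aexp aexp
  | Sub aexp aexp
  | Mul aexp aexp
  | Div aexp aexp

fun aval :: "aexp \<Rightarrow> memory \<Rightarrow> int" where
  "aval (Num z) s = z"
| "aval (Read a e) s = s a (aval e s)"
| "aval (Add e f) s = aval e s + aval f s"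
| "aval (Sub e f) s = aval e s - aval f s"
| "aval (Mul e f) s = aval e s * aval f s"
| "aval (Div e f) s = aval e s div aval f s"

fun atime :: "aexp \<Rightarrow> memory \<Rightarrow> nat" where
  "atime (Num z) s = bits z"
| "atime (Read a e) s = atime e s + bits (aval e s) + bits (s a (aval e s))"
| "atime (Add e f) s = atime e s + atime f s + bits (aval e s) + bits (aval f s)"
| "atime (Sub e f) s = atime e s + atime f s + bits (aval e s) + bits (aval f s)"
| "atime (Mul e f) s = atime e s + atime f s + bits (aval e s) + bits (aval f s)"
| "atime (Div e f) s = atime e s + atime f s + bits (aval e s) + bits (aval f s)"

text \<open>
  \<open>Write a e f\<close> stores the value of \<open>f\<close> in array \<open>a\<close> at the index given by \<open>e\<close>. The conditional
  and the loop test whether an expression is positive.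
\<close>
datatype com =
    Skip
  | Write nat aexp aexp
  | Seq com com
  | If aexp com com
  | While aexp com

inductive exec :: "com \<Rightarrow> memory \<Rightarrow> nat \<Rightarrow> memory \<Rightarrow> bool" where
  Skip: "exec Skip s 1 s"
| Write: "exec (Write a e f) s
    (atime e s + atime f s + bits (aval e s) + bits (aval f s))
    (s(a := (s a)(aval e s := aval f s)))"
| Seq: "exec c s t s' \<Longrightarrow> exec d s' t' s'' \<Longrightarrow> exec (Seq c d) s (t + t') s''"
| IfTrue: "0 < aval e s \<Longrightarrow> exec c s t s' \<Longrightarrow>
    exec (If e c d) s (atime e s + bits (aval e s) + t) s'"
| IfFalse: "\<not> 0 < aval e s \<Longrightarrow> exec d s t s' \<Longrightarrow>
    exec (If e c d) s (atime e s + bits (aval e s) + t) s'"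
| WhileFalse: "\<not> 0 < aval e s \<Longrightarrow>
    exec (While e c) s (atime e s + bits (aval e s)) s"
| WhileTrue: "0 < aval e s \<Longrightarrow> exec c s t s' \<Longrightarrow> exec (While e c) s' t' s'' \<Longrightarrow>
    exec (While e c) s (atime e s + bits (aval e s) + t + t') s''"

lemma exec_deterministic:
  assumes "exec c s t s'" and "exec c s u s''"
  shows "t = u \<and> s' = s''"
  using assms
proof (induction arbitrary: u s'' rule: exec.induct)
  case (Seq c s t s' d t' s'')
  from Seq.prems show ?case by cases (use Seq.IH in blast)
next
  case (IfTrue e s c t s' d)
  from IfTrue.prems show ?case by cases (use IfTrue in blast)+
next
  case (IfFalse e s d t s' c)
  from IfFalse.prems show ?case by cases (use IfFalse in blast)+
next
  case (WhileTrue e s c t s' t' s'')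
  from WhileTrue.prems show ?case by cases (use WhileTrue in blast)+
qed (erule exec.cases; simp)+

text \<open>The input is in array 0, from index 0 on.\<close>
definition input_memory :: "int list \<Rightarrow> memory" where
  "input_memory xs =
     (\<lambda>a i. if a = 0 \<and> 0 \<le> i \<and> i < int (length xs) then xs ! nat i else 0)"

text \<open>The output is in array 1: its length at index 0, its entries from index 1 on.\<close>
definition output_list :: "memory \<Rightarrow> int list" where
  "output_list s = map (\<lambda>i. s 1 (int i)) [1..<Suc (nat (s 1 0))]"

definition input_size :: "int list \<Rightarrow> nat" where
  "input_size xs = (\<Sum>z\<leftarrow>xs. bits z)"

text \<open>
  \<open>R x ys\<close> says that \<open>ys\<close> is an acceptable output for the problem instance \<open>x\<close>; \<open>D\<close> is the set of
  admissible problem instances.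
\<close>
definition polytime_computable ::
    "('i \<Rightarrow> int list) \<Rightarrow> 'i set \<Rightarrow> ('i \<Rightarrow> int list \<Rightarrow> bool) \<Rightarrow> bool" where
  "polytime_computable enc D R \<longleftrightarrow>
     (\<exists>(prog :: com) (q :: nat poly). \<forall>x \<in> D. \<exists>t s.
        exec prog (input_memory (enc x)) t s \<and>
        t \<le> poly q (input_size (enc x)) \<and>
        R x (output_list s))"


section \<open>Instances as inputs\<close>

text \<open>
  As an input, an instance has \<open>p\<close> numbered centers, \<open>n\<close> numbered customers and rational
  costs. The encoding lists, for each pair of a center and a customer, an edge flag and the
  cost as a reduced fraction.
\<close>

type_synonym raw_instance = "nat \<times> nat \<times> (nat \<times> nat) set \<times> (nat \<Rightarrow> nat \<Rightarrow> rat) \<times> nat"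

fun instance_of :: "raw_instance \<Rightarrow> (nat, nat) kmedian" where
  "instance_of (p, n, E, c, k) =
     \<lparr>centers = {..<p}, customers = {..<n}, edges = E,
      cost = (\<lambda>i j. real_of_rat (c i j)), budget = k\<rparr>"

fun encode_instance :: "raw_instance \<Rightarrow> int list" where
  "encode_instance (p, n, E, c, k) =
     [int p, int n, int k] @
     concat (map (\<lambda>(i, j).
         if (i, j) \<in> E
         then [1, fst (quotient_of (c i j)), snd (quotient_of (c i j))]
         else [0, 0, 1])
       (List.product [0..<p] [0..<n]))"


section \<open>The problem\<close>

definition admissible :: "('u, 'w) kmedian \<Rightarrow> bool" where
  "admissible I \<longleftrightarrow>
     kmedian_instance I \<and>
     2 \<le> budget I \<and> real (budget I) \<le> real (card (customers I)) / 3 \<and>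
     (\<forall>j \<in> customers I. \<exists>i \<in> centers I. ecost I i j = 0)"

definition solution :: "('u, 'w) kmedian \<Rightarrow> 'u set \<Rightarrow> bool" where
  "solution I C \<longleftrightarrow>
     C \<subseteq> centers I \<and> int (card C) \<le> size_bound I \<and>
     total_capped_cost I (lp_opt I) C < 1"

end

theory Submission
  imports Defs
begin

text \<open>
  For a guess \<open>l\<close> of the LP optimum, start with the empty set and repeatedly add the center that
  minimises the total capped cost with respect to \<open>l\<close>. If \<open>l\<close> exceeds the optimum, comparing the best
  center with one drawn with probability \<open>x i / k\<close> shows that a step maps a total \<open>c\<close> to at most
  \<open>(1 - 1 / k) c + (1 - 2 k / n) / k\<close>. Stop as soon as \<open>(1 - 1 / k)^t \<le> 2 k (2 k + 1) / n^2\<close>, which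
  happens for some \<open>t \<le> T\<close>; the total is then at most \<open>1 - 1 / n^2\<close>, so it stays below \<open>1\<close> when the guess
  is decreased by a factor of \<open>1 + 1 / n^2\<close>.

  No linear program is solved. The guesses grow geometrically with ratio at most \<open>1 + 1 / n^2\<close>, and a
  greedy run that misses \<open>1 - 1 / n^2\<close> certifies that its guess does not exceed the optimum, so the first
  successful run is good for the optimum itself. The first guess is \<open>1 / D\<close>, where \<open>D\<close> is the product of the
  denominators of the costs: every positive cost is then capped, and success is good for every
  value of the optimum, including \<open>0\<close>. If all guesses up to the sum of all costs fail, the
  optimum is infinite, and then every set of centers has capped cost \<open>0\<close>.
\<close>

section \<open>The greedy step and its potential\<close>

text \<open>The constants fit the recursion. Write \<open>a = 1 - 2 k / n\<close>. The step map has
  the fixed point \<open>a\<close>, and a run starts at \<open>n / (2 k + 1)\<close>, where every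
  customer pays the cap; after \<open>t\<close> steps the total is thus at most
  \<open>a + q (n / (2 k + 1) - a)\<close> with \<open>q = (1 - 1 / k)^t\<close>. The threshold on
  \<open>q\<close> gives \<open>q n / (2 k + 1) <= 2 k / n\<close>, which is exactly what
  \<open>a\<close> lacks to 1. The bound becomes \<open>1 - q a\<close>, and the slack
  \<open>q a\<close> must be bounded from below: at the first crossing, the last factor
  \<open>1 - 1 / k >= 1 / 2\<close> loses at most half of the threshold. This slack pays for not
  knowing the optimum exactly.

  The optimum is an infimum: a guess strictly above it yields a feasible LP solution cheaper than
  the guess, so failure certifies \<open>l <= lp_opt I\<close>.

  The machine has integers only. Capped costs are kept multiplied by a common positive factor, so
  that the greedy comparisons are exact and agree with those over the reals. Existence for arbitrary
  real costs is proved apart, with a guess computed from the optimum.\<close>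

definition capped_edge_cost :: "('u, 'w) kmedian \<Rightarrow> real \<Rightarrow> 'u \<Rightarrow> 'w \<Rightarrow> real" where
  "capped_edge_cost I l i j =
     (if (i, j) \<in> edges I
      then min (1 / (2 * real (budget I) + 1))
        ((1 - 2 * real (budget I) / real (card (customers I))) * cost I i j / l)
      else 1 / (2 * real (budget I) + 1))"

definition rcapped :: "('u, 'w) kmedian \<Rightarrow> real \<Rightarrow> 'u set \<Rightarrow> 'w \<Rightarrow> real" where
  "rcapped I l C j = real_of_ereal (capped_cost I (ereal l) C j)"

definition rtotal :: "('u, 'w) kmedian \<Rightarrow> real \<Rightarrow> 'u set \<Rightarrow> real" where
  "rtotal I l C = (\<Sum>j \<in> customers I. rcapped I l C j)"

lemma admissibleD:
  assumes "admissible I"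
  shows "finite (centers I)" "finite (customers I)" "edges I \<subseteq> centers I \<times> customers I"
    "\<And>i j. (i, j) \<in> edges I \<Longrightarrow> 0 \<le> cost I i j"
    "2 \<le> budget I" "3 * budget I \<le> card (customers I)"
    "1 / 3 \<le> 1 - 2 * real (budget I) / real (card (customers I))"
    "centers I \<noteq> {}"
proof -
  show "finite (centers I)" "finite (customers I)" "edges I \<subseteq> centers I \<times> customers I"
    "\<And>i j. (i, j) \<in> edges I \<Longrightarrow> 0 \<le> cost I i j" "2 \<le> budget I"
    using assms by (auto simp: admissible_def kmedian_instance_def)
  have *: "real (budget I) \<le> real (card (customers I)) / 3" "2 \<le> budget I"
    using assms by (auto simp: admissible_def)
  then show "3 * budget I \<le> card (customers I)" by linarith
  then show "1 / 3 \<le> 1 - 2 * real (budget I) / real (card (customers I))"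
    using * by (simp add: field_simps)
  have "customers I \<noteq> {}" using * by auto
  then show "centers I \<noteq> {}" using assms by (auto simp: admissible_def)
qed

text \<open>Dividing by \<open>l\<close> and multiplying by \<open>1 - 2 k / n > 0\<close> is
  monotone on the extended reals, so it commutes with the binary minimum inside the infimum. The
  values 0 and infinity of \<open>l\<close> are included because the optimum may take them.\<close>

lemma capped_cost_insert:
  assumes "admissible I" "0 \<le> l"
  shows "capped_cost I l (insert i C) j = min (capped_cost I l {i} j) (capped_cost I l C j)"
proof -
  define a where "a = 1 - 2 * real (budget I) / real (card (customers I))"
  have a: "0 \<le> a" using admissibleD(7)[OF assms(1)] by (simp add: a_def)
  define f where "f x = ereal a * (x / l)" for x
  have "mono f"
    unfolding f_def divide_ereal_def
    using a assms(2) by (intro monoI ereal_mult_left_mono ereal_mult_right_mono ereal_inverse_nonneg_iff[THEN iffD2]) auto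
  then have f: "f (min x y) = min (f x) (f y)" for x y
    by (simp add: min_of_mono)
  have cc: "capped_cost I l C j = min (ereal (1 / (2 * real (budget I) + 1))) (f (INF i\<in>C. ecost I i j))" for C
    by (simp add: capped_cost_def Let_def a_def f_def)
  show ?thesis unfolding cc by (simp add: inf_min f min.assoc min.left_commute)
qed

lemma capped_cost_singleton:
  assumes "admissible I" "0 < l"
  shows "capped_cost I (ereal l) {i} j = ereal (capped_edge_cost I l i j)"
proof -
  define a where "a = 1 - 2 * real (budget I) / real (card (customers I))"
  have "0 < a" using admissibleD(7)[OF assms(1)] by (simp add: a_def)
  with assms(2) show ?thesis
    by (auto simp: capped_cost_def capped_edge_cost_def Let_def ecost_def min_def
        a_def[symmetric])
qed

lemma capped_cost_empty:
  assumes "admissible I" "0 < l"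
  shows "capped_cost I (ereal l) {} j = ereal (1 / (2 * real (budget I) + 1))"
  using assms admissibleD(7)[OF assms(1)]
  by (auto simp: capped_cost_def Let_def top_ereal_def)

lemma capped_cost_real:
  assumes "admissible I" "0 < l" "finite C"
  shows "capped_cost I (ereal l) C j = ereal (rcapped I l C j)"
  using assms(3)
proof induction
  case empty
  then show ?case by (simp add: rcapped_def capped_cost_empty assms)
next
  case (insert i C)
  have "capped_cost I (ereal l) (insert i C) j =
      min (ereal (capped_edge_cost I l i j)) (ereal (rcapped I l C j))"
    using capped_cost_insert[OF assms(1), of "ereal l" i C j] capped_cost_singleton[OF assms(1,2)]
      insert.IH assms(2) by simp
  then show ?case by (simp add: rcapped_def min_def)
qed

lemma rcapped_empty:
  assumes "admissible I" "0 < l"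
  shows "rcapped I l {} j = 1 / (2 * real (budget I) + 1)"
  by (simp add: rcapped_def capped_cost_empty assms)

lemma rcapped_insert:
  assumes "admissible I" "0 < l" "finite C"
  shows "rcapped I l (insert i C) j = min (capped_edge_cost I l i j) (rcapped I l C j)"
  using capped_cost_insert[OF assms(1), of "ereal l" i C j] assms
    capped_cost_singleton[OF assms(1,2)] capped_cost_real[OF assms(1,2)]
  by (simp add: min_def split: if_splits)

lemma capped_edge_cost_bounds:
  assumes "admissible I" "0 < l"
  shows "0 \<le> capped_edge_cost I l i j" "capped_edge_cost I l i j \<le> 1 / (2 * real (budget I) + 1)"
  using assms admissibleD(4)[OF assms(1)] admissibleD(7)[OF assms(1)]
  by (auto simp: capped_edge_cost_def)

lemma rcapped_bounds:
  assumes "admissible I" "0 < l" "finite C"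
  shows "0 \<le> rcapped I l C j \<and> rcapped I l C j \<le> 1 / (2 * real (budget I) + 1)"
  using assms(3)
  by induction (use assms(1,2) capped_edge_cost_bounds[OF assms(1,2)] in
      \<open>auto simp: rcapped_empty rcapped_insert min_le_iff_disj\<close>)

lemma total_capped_cost_real:
  assumes "admissible I" "0 < l" "finite C"
  shows "total_capped_cost I (ereal l) C = ereal (rtotal I l C)"
  by (simp add: total_capped_cost_def rtotal_def capped_cost_real assms)

section \<open>The LP optimum and the effect of one greedy step\<close>

lemma lp_opt_nonneg:
  assumes "admissible I"
  shows "0 \<le> lp_opt I"
  unfolding lp_opt_def
proof (rule Inf_greatest, clarify)
  fix x y assume "lp_feasible I x y"
  then have "0 \<le> (\<Sum>(i, j)\<in>edges I. cost I i j * y i j)"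
    using admissibleD(4)[OF assms] by (intro sum_nonneg) (auto simp: lp_feasible_def)
  then show "0 \<le> ereal (\<Sum>(i, j)\<in>edges I. cost I i j * y i j)" by simp
qed

text \<open>The values of \<open>y\<close> at a customer are nonnegative and sum to 1, so each is at
  most 1. A finite optimum is therefore reached by the search once the guesses pass the sum of all
  costs.\<close>

lemma lp_opt_le_sum_cost:
  assumes "admissible I" "lp_opt I \<noteq> \<infinity>"
  shows "lp_opt I \<le> ereal (\<Sum>(i, j)\<in>edges I. cost I i j)"
proof -
  have "lp_opt I < \<infinity>" using assms by auto
  then obtain x y where f: "lp_feasible I x y"
    unfolding lp_opt_def Inf_less_iff by blast
  note A = admissibleD[OF assms(1)]
  have y: "0 \<le> y i j \<and> y i j \<le> 1" if e: "(i, j) \<in> edges I" for i j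
  proof -
    have fin: "finite {i. (i, j) \<in> edges I}"
      by (rule finite_subset[OF _ A(1)]) (use A(3) in auto)
    have "y i j \<le> (\<Sum>i | (i, j) \<in> edges I. y i j)"
      using f e fin by (intro member_le_sum) (auto simp: lp_feasible_def)
    also have "\<dots> = 1" using f e A(3) by (auto simp: lp_feasible_def)
    finally show ?thesis using f e by (auto simp: lp_feasible_def)
  qed
  have "lp_opt I \<le> ereal (\<Sum>(i, j)\<in>edges I. cost I i j * y i j)"
    unfolding lp_opt_def by (rule Inf_lower) (use f in auto)
  also have "\<dots> \<le> ereal (\<Sum>(i, j)\<in>edges I. cost I i j)"
    using y A(4) by (auto intro!: sum_mono mult_left_le)
  finally show ?thesis .
qed

text \<open>
  A center drawn with probability \<open>x i / k\<close> serves customer \<open>j\<close> as the LP solution does with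
  probability \<open>1 / k\<close>; the best center is at least as good as a random one.
\<close>
lemma ex_center_decreasing_rtotal:
  assumes I: "admissible I" and l: "0 < l" and opt: "lp_opt I < ereal l" and C: "finite C"
  shows "\<exists>i \<in> centers I. rtotal I l (insert i C) \<le>
    (1 - 1 / real (budget I)) * rtotal I l C +
    (1 - 2 * real (budget I) / real (card (customers I))) / real (budget I)"
proof -
  note A = admissibleD[OF I]
  define k where "k = real (budget I)"
  define a where "a = 1 - 2 * real (budget I) / real (card (customers I))"
  have k: "0 < k" using A(5) by (simp add: k_def)
  have a: "0 < a" using A(7) by (simp add: a_def)
  obtain x y where f: "lp_feasible I x y"
    and v: "(\<Sum>(i, j)\<in>edges I. cost I i j * y i j) < l"
    using opt by (auto simp: lp_opt_def Inf_less_iff)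
  have x0: "0 \<le> x i" if "i \<in> centers I" for i using f that by (auto simp: lp_feasible_def)
  have xs: "(\<Sum>i\<in>centers I. x i) = k" using f by (auto simp: lp_feasible_def k_def)
  define g where "g = rcapped I l C"
  define w where "w = capped_edge_cost I l"
  define N where "N j = {i. (i, j) \<in> edges I}" for j
  have N: "N j \<subseteq> centers I" for j using A(3) by (auto simp: N_def)
  have finN: "finite (N j)" for j using N A(1) finite_subset by blast
  \<comment> \<open>The weight \<open>k\<close> of \<open>x\<close> splits into the weight 1 of
    \<open>z\<close>, which is \<open>y\<close> extended by 0 and is charged \<open>w i j\<close>,
    and the remaining weight \<open>k - 1\<close>, which is charged the old value
    \<open>g j\<close>; the minimum is at most either charge.\<close>
  have j: "(\<Sum>i\<in>centers I. x i * min (w i j) (g j)) \<le> (k - 1) * g j + a / l * (\<Sum>i\<in>N j. cost I i j * y i j)"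
    if "j \<in> customers I" for j
  proof -
    define z where "z i = (if i \<in> N j then y i j else 0)" for i
    have sz: "(\<Sum>i\<in>centers I. z i * h i) = (\<Sum>i\<in>N j. y i j * h i)" for h :: "_ \<Rightarrow> real"
      by (rule sum.mono_neutral_cong_right) (use A(1) N in \<open>auto simp: z_def\<close>)
    have y1: "(\<Sum>i\<in>N j. y i j) = 1" using f that by (auto simp: lp_feasible_def N_def)
    have g0: "0 \<le> g j" using rcapped_bounds[OF I l C] by (simp add: g_def)
    have "(\<Sum>i\<in>centers I. x i * min (w i j) (g j)) \<le> (\<Sum>i\<in>centers I. x i * g j - z i * g j + z i * w i j)"
    proof (rule sum_mono)
      fix i assume i: "i \<in> centers I"
      have z: "0 \<le> z i" "z i \<le> x i"
        using f x0[OF i] by (auto simp: z_def N_def lp_feasible_def)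
      have "x i * min (w i j) (g j) = (x i - z i) * min (w i j) (g j) + z i * min (w i j) (g j)"
        by (simp add: algebra_simps)
      also have "\<dots> \<le> (x i - z i) * g j + z i * w i j"
        using z by (intro add_mono mult_left_mono) auto
      finally show "x i * min (w i j) (g j) \<le> x i * g j - z i * g j + z i * w i j"
        by (simp add: algebra_simps)
    qed
    also have "\<dots> = k * g j - (\<Sum>i\<in>N j. y i j) * g j + (\<Sum>i\<in>N j. y i j * w i j)"
      by (simp add: sum.distrib sum_subtractf sz sum_distrib_right[symmetric] xs)
        (use sz[of "\<lambda>_. 1"] in simp)
    also have "\<dots> \<le> (k - 1) * g j + (\<Sum>i\<in>N j. y i j * (a * cost I i j / l))"
    proof -
      have "(\<Sum>i\<in>N j. y i j * w i j) \<le> (\<Sum>i\<in>N j. y i j * (a * cost I i j / l))"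
        using f by (intro sum_mono mult_left_mono)
          (auto simp: N_def w_def capped_edge_cost_def a_def lp_feasible_def)
      then show ?thesis by (simp add: y1 algebra_simps)
    qed
    also have "\<dots> = (k - 1) * g j + a / l * (\<Sum>i\<in>N j. cost I i j * y i j)"
      by (simp add: sum_distrib_left field_simps)
    finally show ?thesis .
  qed
  have tot: "rtotal I l (insert i C) = (\<Sum>j\<in>customers I. min (w i j) (g j))" for i
    by (simp add: rtotal_def rcapped_insert I l C w_def g_def)
  have "(\<Sum>i\<in>centers I. x i * rtotal I l (insert i C)) =
      (\<Sum>j\<in>customers I. \<Sum>i\<in>centers I. x i * min (w i j) (g j))"
    unfolding tot sum_distrib_left by (rule sum.swap)
  also have "\<dots> \<le> (\<Sum>j\<in>customers I. (k - 1) * g j + a / l * (\<Sum>i\<in>N j. cost I i j * y i j))"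
    by (rule sum_mono) (rule j)
  also have "\<dots> = (k - 1) * rtotal I l C + a / l * (\<Sum>j\<in>customers I. \<Sum>i\<in>N j. cost I i j * y i j)"
    by (simp add: sum.distrib sum_distrib_left rtotal_def g_def)
  also have "(\<Sum>j\<in>customers I. \<Sum>i\<in>N j. cost I i j * y i j) = (\<Sum>(i, j)\<in>edges I. cost I i j * y i j)"
  proof -
    have e: "edges I = prod.swap ` (SIGMA j:customers I. N j)" using A(3) by (force simp: N_def)
    have "(\<Sum>j\<in>customers I. \<Sum>i\<in>N j. cost I i j * y i j) =
        (\<Sum>(j, i)\<in>(SIGMA j:customers I. N j). cost I i j * y i j)"
      by (rule sum.Sigma) (use A finN in auto)
    also have "\<dots> = (\<Sum>(i, j)\<in>edges I. cost I i j * y i j)"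
      unfolding e by (subst sum.reindex) (auto simp: o_def case_prod_unfold)
    finally show ?thesis .
  qed
  also have "a / l * (\<Sum>(i, j)\<in>edges I. cost I i j * y i j) \<le> a / l * l"
    using v a l by (intro mult_left_mono) auto
  finally have avg: "(\<Sum>i\<in>centers I. x i * rtotal I l (insert i C)) \<le> (k - 1) * rtotal I l C + a"
    using l by simp
  show ?thesis
  proof (rule ccontr)
    let ?b = "(1 - 1 / k) * rtotal I l C + a / k"
    assume "\<not> ?thesis"
    then have no: "?b < rtotal I l (insert i C)" if "i \<in> centers I" for i
      using that by (force simp: k_def a_def)
    \<comment> \<open>Nonnegative weights with sum \<open>k > 0\<close> include a positive one; it
      makes the comparison of the weighted sums strict.\<close>
    obtain i0 where i0: "i0 \<in> centers I" "0 < x i0"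
      using xs k x0 by (metis less_eq_real_def not_less sum_nonpos)
    have "(\<Sum>i\<in>centers I. x i * ?b) < (\<Sum>i\<in>centers I. x i * rtotal I l (insert i C))"
    proof (rule sum_strict_mono_ex1[OF A(1)])
      show "\<forall>i\<in>centers I. x i * ?b \<le> x i * rtotal I l (insert i C)"
        using no x0 by (meson less_imp_le mult_left_mono)
      show "\<exists>i\<in>centers I. x i * ?b < x i * rtotal I l (insert i C)"
        using i0 no by (intro bexI[of _ i0]) auto
    qed
    moreover have "(\<Sum>i\<in>centers I. x i * ?b) = (k - 1) * rtotal I l C + a"
      using k by (simp only: sum_distrib_right[symmetric] xs) (simp add: field_simps)
    ultimately show False using avg by simp
  qed
qed

text \<open>A relation, because ties between best centers may be broken in any way: it covers every
  run of the program. A center may be chosen again, so \<open>t\<close> counts steps and only bounds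
  the size of the set.\<close>

inductive greedy :: "('u, 'w) kmedian \<Rightarrow> real \<Rightarrow> nat \<Rightarrow> 'u set \<Rightarrow> bool" for I l where
  start: "greedy I l 0 {}"
| step: "greedy I l t C \<Longrightarrow> i \<in> centers I \<Longrightarrow>
    (\<And>i'. i' \<in> centers I \<Longrightarrow> rtotal I l (insert i C) \<le> rtotal I l (insert i' C)) \<Longrightarrow>
    greedy I l (Suc t) (insert i C)"

lemma greedy_subset:
  "greedy I l t C \<Longrightarrow> C \<subseteq> centers I \<and> finite C \<and> card C \<le> t"
  by (induction rule: greedy.induct) (auto simp: card_insert_if)

lemma greedy_exists:
  assumes "admissible I"
  shows "\<exists>C. greedy I l t C"
proof (induction t)
  case (Suc t)
  then obtain C where C: "greedy I l t C" by blast
  obtain i where "i \<in> centers I" "\<And>i'. i' \<in> centers I \<Longrightarrow> rtotal I l (insert i C) \<le> rtotal I l (insert i' C)"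
    using ex_is_arg_min_if_finite[of "centers I" "\<lambda>i. rtotal I l (insert i C)"] admissibleD[OF assms]
    by (auto simp: is_arg_min_linorder)
  then have "greedy I l (Suc t) (insert i C)" by (intro greedy.step[OF C])
  then show ?case ..
qed (auto intro: greedy.start)

text \<open>One step shrinks the distance to the fixed point \<open>1 - 2 k / n\<close> by the
  factor \<open>1 - 1 / k\<close>; the initial total is \<open>n / (2 k + 1)\<close>.\<close>

lemma greedy_rtotal:
  assumes "greedy I l t C" "admissible I" "0 < l" "lp_opt I < ereal l"
  defines "k \<equiv> real (budget I)" and "n \<equiv> real (card (customers I))"
  shows "rtotal I l C \<le> 1 - 2 * k / n + (1 - 1 / k) ^ t * (n / (2 * k + 1) - (1 - 2 * k / n))"
  using assms(1)
proof induction
  case start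
  then show ?case
    by (simp add: rtotal_def rcapped_empty assms(2,3) n_def k_def)
next
  case (step t C i)
  note A = admissibleD[OF assms(2)]
  define a where "a = 1 - 2 * k / n"
  have k: "2 \<le> k" using A(5) by (simp add: k_def)
  obtain i' where "i' \<in> centers I" "rtotal I l (insert i' C) \<le> (1 - 1 / k) * rtotal I l C + a / k"
    using ex_center_decreasing_rtotal[OF assms(2-4), of C] greedy_subset[OF step(1)]
    by (auto simp: k_def n_def a_def)
  with step(3) have "rtotal I l (insert i C) \<le> (1 - 1 / k) * rtotal I l C + a / k" by force
  also have "\<dots> \<le> (1 - 1 / k) * (a + (1 - 1 / k) ^ t * (n / (2 * k + 1) - a)) + a / k"
    using step.IH k by (intro add_right_mono mult_left_mono) (auto simp: a_def)
  also have "\<dots> = a + (1 - 1 / k) ^ Suc t * (n / (2 * k + 1) - a)"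
  proof -
    define c where "c = n / (2 * k + 1) - a"
    show ?thesis unfolding c_def[symmetric] by (simp add: algebra_simps)
  qed
  finally show ?case by (simp add: a_def)
qed

text \<open>
  This is \<open>2 k (2 k + 1) / n^2 < (1 - 1 / k)^t\<close>, cleared of denominators: in place of the
  logarithm in \<^const>\<open>size_bound\<close>, it can be evaluated exactly over the integers.
\<close>
definition more_steps :: "nat \<Rightarrow> nat \<Rightarrow> nat \<Rightarrow> bool" where
  "more_steps n k t \<longleftrightarrow> 2 * k * (2 * k + 1) * k ^ t < n\<^sup>2 * (k - 1) ^ t"

lemma more_steps_real:
  assumes "2 \<le> k" "3 * k \<le> n"
  shows "more_steps n k t \<longleftrightarrow> 2 * real k * (2 * real k + 1) / (real n)\<^sup>2 < (1 - 1 / real k) ^ t"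
proof -
  have "more_steps n k t \<longleftrightarrow>
      real (2 * k * (2 * k + 1) * k ^ t) < real (n\<^sup>2 * (k - 1) ^ t)"
    unfolding more_steps_def of_nat_less_iff ..
  also have "\<dots> \<longleftrightarrow> 2 * real k * (2 * real k + 1) * real k ^ t < (real n)\<^sup>2 * (real k - 1) ^ t"
    using assms by (simp add: of_nat_diff algebra_simps)
  also have "(real k - 1) ^ t = (1 - 1 / real k) ^ t * real k ^ t"
    using assms by (simp add: power_mult_distrib[symmetric] field_simps)
  also have "2 * real k * (2 * real k + 1) * real k ^ t < (real n)\<^sup>2 * ((1 - 1 / real k) ^ t * real k ^ t)
    \<longleftrightarrow> 2 * real k * (2 * real k + 1) < (real n)\<^sup>2 * (1 - 1 / real k) ^ t"
    using assms by (simp add: mult.assoc[symmetric])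
  finally show ?thesis using assms by (simp add: field_simps)
qed

text \<open>With \<open>r = n^2 / (2 k (2 k + 1))\<close>, any \<open>t >= k ln r\<close> satisfies
  \<open>(1 - 1 / k)^t <= exp (- t / k) <= 1 / r\<close>, so the exact criterion stops no later than
  the logarithmic bound.\<close>

lemma more_steps_size_bound:
  assumes "admissible I" "more_steps (card (customers I)) (budget I) t"
  shows "int (Suc t) \<le> size_bound I"
proof (rule ccontr)
  note A = admissibleD[OF assms(1)]
  define k where "k = real (budget I)"
  define n where "n = real (card (customers I))"
  have k: "2 \<le> k" and n: "3 * k \<le> n" using A(5,6) unfolding k_def n_def by linarith+
  define r where "r = n\<^sup>2 / (2 * k * (2 * k + 1))"
  have r: "0 < r" using k n by (auto simp: r_def)
  assume "\<not> ?thesis"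
  then have "size_bound I \<le> int t" by simp
  then have "\<lceil>k * ln r\<rceil> \<le> int t" by (simp add: size_bound_def Let_def r_def k_def n_def)
  then have "k * ln r \<le> real t" by (simp add: ceiling_le_iff)
  then have "ln r \<le> real t / k" using k by (simp add: field_simps)
  have "(1 - 1 / k) ^ t \<le> exp (- (1 / k)) ^ t"
    using exp_ge_add_one_self[of "- (1/k)"] k by (intro power_mono) auto
  also have "\<dots> = exp (- (real t / k))" by (simp add: exp_of_nat_mult[symmetric])
  also have "\<dots> \<le> exp (- ln r)" using \<open>ln r \<le> real t / k\<close> by simp
  also have "\<dots> = 1 / r" using r by (simp add: exp_minus field_simps)
  finally have "(1 - 1 / k) ^ t \<le> 2 * k * (2 * k + 1) / n\<^sup>2" by (simp add: r_def)
  with assms(2) A(5,6) show False by (simp add: more_steps_real k_def n_def)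
qed

text \<open>From \<open>n >= 3 k\<close> and \<open>k >= 2\<close> follows
  \<open>n^2 >= 9 k^2 >= 2 k (2 k + 1)\<close>, so the logarithm is nonnegative. The upper bound
  rests on \<open>ln r <= r\<close> and makes the number of greedy steps polynomial.\<close>

lemma size_bound_bounds:
  assumes "admissible I"
  shows "0 \<le> size_bound I" "size_bound I \<le> (int (card (customers I)))\<^sup>2"
proof -
  note A = admissibleD[OF assms]
  define k where "k = real (budget I)"
  define n where "n = real (card (customers I))"
  have k: "2 \<le> k" and n: "3 * k \<le> n" using A(5,6) unfolding k_def n_def by linarith+
  define r where "r = n\<^sup>2 / (2 * k * (2 * k + 1))"
  have sb: "size_bound I = \<lceil>k * ln r\<rceil>" by (simp add: size_bound_def Let_def r_def k_def n_def)
  have "(3 * k)\<^sup>2 \<le> n\<^sup>2" using k n by (intro power_mono) auto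
  moreover have "2 * k * (2 * k + 1) \<le> (3 * k)\<^sup>2"
    using mult_mono[of 2 k k k] k by (simp add: power2_eq_square algebra_simps)
  ultimately have r: "1 \<le> r" using k by (simp add: r_def)
  then show "0 \<le> size_bound I" using k unfolding sb
    by (smt (verit) ceiling_mono ceiling_zero ln_ge_zero mult_nonneg_nonneg)
  have "k * ln r \<le> k * r" using k r by (intro mult_left_mono) (auto intro: ln_le_minus_one[THEN order_trans])
  also have "\<dots> \<le> n\<^sup>2"
  proof -
    have "k * r = n\<^sup>2 / (2 * (2 * k + 1))" using k by (simp add: r_def)
    also have "\<dots> \<le> n\<^sup>2 / 1" using k by (intro divide_left_mono) auto
    finally show ?thesis by simp
  qed
  finally show "size_bound I \<le> (int (card (customers I)))\<^sup>2"
    unfolding sb ceiling_le_iff by (simp add: n_def)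
qed

text \<open>Minimality of \<open>t\<close> matters as much as the crossing itself: it keeps
  \<open>(1 - 1 / k)^t\<close> from being too small, and this power is the source of the slack below
  1.\<close>

definition last_step :: "nat \<Rightarrow> nat \<Rightarrow> nat \<Rightarrow> bool" where
  "last_step n k t \<longleftrightarrow> \<not> more_steps n k t \<and> (\<forall>u < t. more_steps n k u)"

lemma last_step_exists:
  assumes "admissible I"
  shows "\<exists>t. last_step (card (customers I)) (budget I) t"
proof -
  let ?P = "\<lambda>t. \<not> more_steps (card (customers I)) (budget I) t"
  have "?P (nat (size_bound I))"
    using more_steps_size_bound[OF assms, of "nat (size_bound I)"] size_bound_bounds(1)[OF assms] by auto
  then show ?thesis
    using exists_least_iff[of ?P] unfolding last_step_def by blast
qed

lemma last_step_size_bound: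
  assumes "admissible I" "last_step (card (customers I)) (budget I) t"
  shows "int t \<le> size_bound I"
proof (cases t)
  case 0 then show ?thesis using size_bound_bounds[OF assms(1)] by simp
next
  case (Suc u) then show ?thesis
    using more_steps_size_bound[OF assms(1), of u] assms(2) by (auto simp: last_step_def)
qed

lemma greedy_last_step_rtotal:
  assumes "greedy I l t C" "admissible I" "0 < l" "lp_opt I < ereal l"
    and "last_step (card (customers I)) (budget I) t"
  shows "rtotal I l C \<le> 1 - 1 / (real (card (customers I)))\<^sup>2"
proof -
  note A = admissibleD[OF assms(2)]
  define k where "k = real (budget I)"
  define n where "n = real (card (customers I))"
  have k: "2 \<le> k" and n: "3 * k \<le> n" using A(5,6) unfolding k_def n_def by linarith+
  define q where "q = (1 - 1 / k) ^ t"
  define b where "b = 2 * k * (2 * k + 1)"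
  have b: "20 \<le> b" using mult_mono[of 4 "2*k" 5 "2*k+1"] k by (simp add: b_def)
  have n2: "36 \<le> n\<^sup>2" using power_mono[of 6 n 2] k n by simp
  have qle: "q \<le> b / n\<^sup>2"
    using assms(5) A(5,6) by (simp add: last_step_def more_steps_real q_def k_def n_def b_def)
  \<comment> \<open>The preceding power exceeds \<open>b / n^2\<close>, and a further factor of at
    least \<open>1 / 2\<close> leaves at least \<open>b / (2 n^2)\<close>, where
    \<open>b >= 20\<close>. The constant 3 is chosen to cancel the lower bound \<open>1 / 3\<close>
    of \<open>1 - 2 k / n\<close>.\<close>
  have qge: "3 / n\<^sup>2 \<le> q"
  proof (cases t)
    case 0 then show ?thesis using n2 by (simp add: q_def divide_le_eq_1)
  next
    case (Suc u)
    then have "more_steps (card (customers I)) (budget I) u" using assms(5) by (auto simp: last_step_def)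
    then have u: "b / n\<^sup>2 < (1 - 1 / k) ^ u"
      using A(5,6) by (simp add: more_steps_real k_def n_def b_def)
    have "3 / n\<^sup>2 \<le> b / 2 / n\<^sup>2" using b by (intro divide_right_mono) auto
    also have "\<dots> = 1 / 2 * (b / n\<^sup>2)" by simp
    also have "\<dots> \<le> (1 - 1 / k) * (1 - 1 / k) ^ u"
      using u k b by (intro mult_mono) (auto simp: field_simps)
    finally show ?thesis by (simp add: q_def Suc)
  qed
  have a: "1 / 3 \<le> 1 - 2 * k / n" using A(7) by (simp add: k_def n_def)
  have "rtotal I l C \<le> 1 - 2 * k / n + q * (n / (2 * k + 1) - (1 - 2 * k / n))"
    using greedy_rtotal[OF assms(1-4)] by (simp add: q_def k_def n_def)
  also have "\<dots> = 1 - 2 * k / n + q * (n / (2 * k + 1)) - q * (1 - 2 * k / n)"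
    by (simp add: algebra_simps)
  also have "q * (n / (2 * k + 1)) \<le> b / n\<^sup>2 * (n / (2 * k + 1))"
    using qle k n by (intro mult_right_mono) auto
  also have "b / n\<^sup>2 * (n / (2 * k + 1)) = 2 * k / n"
    using k n by (simp add: b_def power2_eq_square)
  finally have "rtotal I l C \<le> 1 - q * (1 - 2 * k / n)" by simp
  moreover have "3 / n\<^sup>2 * (1 / 3) \<le> q * (1 - 2 * k / n)"
    using qge a n2 order_trans[OF _ qge, of 0] by (intro mult_mono) auto
  ultimately show ?thesis by (simp add: n_def)
qed

text \<open>If every positive cost is at least \<open>l\<close>, an edge has capped cost 0 or
  exactly the cap, because \<open>1 - 2 k / n >= 1 / 3 >= 1 / (2 k + 1)\<close>. Zero costs stay 0
  for every \<open>v\<close>, also by \<open>0 / 0 = 0\<close> for \<open>v = 0\<close>, and the cap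
  bounds all others.\<close>

lemma capped_cost_le_smallest_guess:
  assumes "admissible I" "0 < l" "0 \<le> v" "finite C"
    and "\<And>i j. (i, j) \<in> edges I \<Longrightarrow> cost I i j = 0 \<or> l \<le> cost I i j"
  shows "capped_cost I v C j \<le> ereal (rcapped I l C j)"
  using assms(4)
proof induction
  case empty
  show ?case by (simp add: rcapped_empty assms capped_cost_def Let_def)
next
  case (insert i C)
  note A = admissibleD[OF assms(1)]
  have "capped_cost I v {i} j \<le> ereal (capped_edge_cost I l i j)"
  proof (cases "(i, j) \<in> edges I \<and> cost I i j = 0")
    case True
    then show ?thesis
      by (simp add: capped_cost_def Let_def ecost_def capped_edge_cost_def zero_ereal_def[symmetric])
  next
    case False
    have "capped_edge_cost I l i j = 1 / (2 * real (budget I) + 1)"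
    proof (cases "(i, j) \<in> edges I")
      case True
      let ?a = "1 - 2 * real (budget I) / real (card (customers I))"
      have "1 / (2 * real (budget I) + 1) \<le> 1 / 3" using A(5) by (simp add: field_simps)
      also have "\<dots> \<le> ?a * 1" using A(7) by simp
      also have "\<dots> \<le> ?a * (cost I i j / l)"
        using order_trans[OF _ A(7), of 0] True False assms(2) assms(5)[OF True]
        by (intro mult_left_mono) auto
      finally show ?thesis using True by (simp add: capped_edge_cost_def)
    qed (simp add: capped_edge_cost_def)
    then show ?thesis by (simp add: capped_cost_def Let_def)
  qed
  with insert show ?case
    unfolding capped_cost_insert[OF assms(1,3), of i C] rcapped_insert[OF assms(1,2) insert(1)]
      ereal_min by (intro min.mono) auto
qed

text \<open>Lowering the guess by at most the factor \<open>f\<close> raises an uncapped edge cost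
  by at most that factor, the cap does not change, and the minimum inherits the bound.\<close>

lemma rcapped_le_factor:
  assumes "admissible I" "0 < l" "0 < v" "1 \<le> f" "l \<le> v * f" "finite C"
  shows "rcapped I v C j \<le> f * rcapped I l C j"
  using assms(6)
proof induction
  case empty
  show ?case using assms(4) mult_right_mono[of 1 f "1 / (2 * real (budget I) + 1)"]
    by (simp add: rcapped_empty[OF assms(1)] assms(2,3))
next
  case (insert i C)
  note A = admissibleD[OF assms(1)]
  have "capped_edge_cost I v i j \<le> f * capped_edge_cost I l i j"
  proof (cases "(i, j) \<in> edges I")
    case True
    let ?c = "(1 - 2 * real (budget I) / real (card (customers I))) * cost I i j"
    have "0 \<le> ?c" using A(4)[OF True] A(7) by auto
    then have "?c * l \<le> ?c * (v * f)" using assms(5) by (rule mult_left_mono[rotated])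
    then have "?c / v \<le> f * (?c / l)" using assms(2,3) by (simp add: field_simps)
    moreover have "1 / (2 * real (budget I) + 1) \<le> f * (1 / (2 * real (budget I) + 1))"
      using assms(4) by (simp add: field_simps)
    ultimately show ?thesis using True by (simp add: capped_edge_cost_def min_def)
  next
    case False
    then show ?thesis using assms(4) by (simp add: capped_edge_cost_def field_simps)
  qed
  with insert show ?case
    using assms(4) by (auto simp: rcapped_insert[OF assms(1)] assms(2,3) min_def)
qed

lemma solution_if_lp_infeasible:
  assumes "admissible I" "C \<subseteq> centers I" "int (card C) \<le> size_bound I" "lp_opt I = \<infinity>"
  shows "solution I C"
proof -
  have "capped_cost I \<infinity> C j = 0" for j
    by (simp add: capped_cost_def Let_def divide_ereal_def)
  then show ?thesis using assms by (simp add: solution_def total_capped_cost_def)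
qed

text \<open>Transfers a bound on the total at the guess \<open>l\<close> to the unknown optimum. The
  two alternatives in \<open>guess\<close> belong to the first guess and to all later ones.\<close>

lemma solutionI:
  assumes "admissible I" "0 < l" "C \<subseteq> centers I" "int (card C) \<le> size_bound I"
    and tot: "rtotal I l C \<le> 1 - 1 / (real (card (customers I)))\<^sup>2"
    and guess: "(\<forall>(i, j) \<in> edges I. cost I i j = 0 \<or> l \<le> cost I i j) \<or>
      (\<exists>v. 0 < v \<and> ereal v \<le> lp_opt I \<and> l \<le> v * (1 + 1 / (real (card (customers I)))\<^sup>2))"
  shows "solution I C"
proof (cases "lp_opt I = \<infinity>")
  case True then show ?thesis using assms solution_if_lp_infeasible by blast
next
  case False
  note A = admissibleD[OF assms(1)]
  have C: "finite C" using A(1) assms(3) finite_subset by blast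
  define N where "N = (real (card (customers I)))\<^sup>2"
  have N: "0 < N" using A(5,6) by (auto simp: N_def)
  have "total_capped_cost I (lp_opt I) C < 1"
    using guess
  proof
    assume *: "\<forall>(i, j) \<in> edges I. cost I i j = 0 \<or> l \<le> cost I i j"
    have "total_capped_cost I (lp_opt I) C \<le> (\<Sum>j\<in>customers I. ereal (rcapped I l C j))"
      unfolding total_capped_cost_def
      by (rule sum_mono, rule capped_cost_le_smallest_guess)
        (use assms C lp_opt_nonneg * in auto)
    also have "\<dots> = ereal (rtotal I l C)" by (simp add: rtotal_def)
    also have "\<dots> < 1" using tot N unfolding one_ereal_def by (simp add: N_def[symmetric]) (smt (verit) divide_pos_pos)
    finally show ?thesis .
  next
    assume "\<exists>v. 0 < v \<and> ereal v \<le> lp_opt I \<and> l \<le> v * (1 + 1 / (real (card (customers I)))\<^sup>2)"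
    then obtain v where v: "0 < v" "ereal v \<le> lp_opt I" "l \<le> v * (1 + 1 / N)" by (auto simp: N_def)
    obtain u where u: "lp_opt I = ereal u" using False lp_opt_nonneg[OF assms(1)] by (cases "lp_opt I") auto
    have vu: "v \<le> u" using v u by simp
    \<comment> \<open>The optimum \<open>u\<close> may lie on either side of \<open>l\<close>; what
      counts is that \<open>l\<close> exceeds it by at most the factor \<open>1 + 1 / N\<close>, and
      this passes from the lower bound \<open>v\<close> to \<open>u\<close>.\<close>
    have "l \<le> u * (1 + 1 / N)" using vu v N by (smt (verit) mult_right_mono divide_pos_pos)
    then have "rcapped I u C j \<le> (1 + 1 / N) * rcapped I l C j" for j
      using N v vu by (intro rcapped_le_factor assms C) auto
    then have "rtotal I u C \<le> (1 + 1 / N) * rtotal I l C"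
      unfolding rtotal_def sum_distrib_left by (intro sum_mono) auto
    also have "\<dots> \<le> (1 + 1 / N) * (1 - 1 / N)"
      using tot N by (intro mult_left_mono) (auto simp: N_def)
    also have "\<dots> < 1" using N by (simp add: algebra_simps)
    finally show ?thesis unfolding u using total_capped_cost_real[OF assms(1) _ C, of u] v vu
      by (simp add: one_ereal_def)
  qed
  then show ?thesis using assms by (simp add: solution_def)
qed

text \<open>Real costs have no common denominator from which a search could start. The guess is
  taken from the optimum \<open>u\<close> instead: \<open>u (1 + 1 / N)\<close> if
  \<open>u > 0\<close>, and a number not above any positive cost if \<open>u = 0\<close>.\<close>

lemma solution_exists:
  assumes "admissible I"
  shows "\<exists>C. solution I C"
proof (cases "lp_opt I = \<infinity>")
  case True
  show ?thesis using solution_if_lp_infeasible[OF assms, of "{}"] size_bound_bounds[OF assms] True by auto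
next
  case False
  note A = admissibleD[OF assms]
  define N where "N = (real (card (customers I)))\<^sup>2"
  have N: "0 < N" using A(5,6) by (auto simp: N_def)
  obtain u where u: "lp_opt I = ereal u" "0 \<le> u"
    using False lp_opt_nonneg[OF assms] by (cases "lp_opt I") auto
  \<comment> \<open>The element 1 keeps the set nonempty when all costs are 0.\<close>
  define P where "P = insert 1 ((\<lambda>(i, j). cost I i j) ` edges I \<inter> {0<..})"
  have "finite (edges I)" using A(1-3) finite_subset by blast
  then have P: "finite P" "P \<noteq> {}" by (auto simp: P_def)
  define l where "l = (if u = 0 then Min P else u * (1 + 1 / N))"
  have "Min P \<in> P" using P by simp
  then have "0 < Min P" by (auto simp: P_def)
  then have l: "0 < l" "lp_opt I < ereal l"
    using u N by (auto simp: l_def intro!: mult_pos_pos add_pos_pos)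
  obtain t where t: "last_step (card (customers I)) (budget I) t" using last_step_exists[OF assms] by blast
  obtain C where C: "greedy I l t C" using greedy_exists[OF assms] by blast
  have "solution I C"
  proof (rule solutionI[OF assms l(1)])
    show "C \<subseteq> centers I" "int (card C) \<le> size_bound I"
      using greedy_subset[OF C] last_step_size_bound[OF assms t] by auto
    show "rtotal I l C \<le> 1 - 1 / (real (card (customers I)))\<^sup>2"
      by (rule greedy_last_step_rtotal[OF C assms l t])
    show "(\<forall>(i, j) \<in> edges I. cost I i j = 0 \<or> l \<le> cost I i j) \<or>
      (\<exists>v. 0 < v \<and> ereal v \<le> lp_opt I \<and> l \<le> v * (1 + 1 / (real (card (customers I)))\<^sup>2))"
    proof (cases "u = 0")
      case True
      have "cost I i j = 0 \<or> l \<le> cost I i j" if "(i, j) \<in> edges I" for i j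
      proof (cases "cost I i j = 0")
        case False
        then have "cost I i j \<in> P" using that A(4)[OF that] by (force simp: P_def)
        then show ?thesis using P True by (simp add: l_def)
      qed simp
      then show ?thesis by auto
    next
      case False
      then show ?thesis using u by (intro disjI2 exI[of _ u]) (auto simp: l_def N_def)
    qed
  qed
  then show ?thesis ..
qed

section \<open>Hoare triples for polynomial time\<close>

lemma bits_le_Suc_iff: "bits z \<le> Suc m \<longleftrightarrow> \<bar>z\<bar> < 2 ^ m"
  using bitlen_le_iff_power[of "\<bar>z\<bar>" "int m"] by (auto simp: bits_def)

lemma bits_pos: "0 < bits z"
  by (simp add: bits_def)

lemma abs_less_power_bits: "\<bar>z\<bar> < 2 ^ (bits z - 1)"
  using bits_le_Suc_iff[of z "bits z - 1"] bits_pos[of z] by simp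

lemma bits_mono: "\<bar>y\<bar> \<le> \<bar>z\<bar> \<Longrightarrow> bits y \<le> bits z"
  using bits_le_Suc_iff[of y "bits z - 1"] abs_less_power_bits[of z] bits_pos[of z] by simp

lemma bits_add: "bits (x + y) \<le> bits x + bits y"
proof -
  have *: "(2::int) ^ a + 2 ^ b \<le> 2 ^ (a + b + 1)" for a b :: nat
    using power_increasing[of a "a + b" "2::int"] power_increasing[of b "a + b" "2::int"]
    by (simp del: power_increasing_iff)
  have "\<bar>x + y\<bar> < 2 ^ (bits x - 1 + (bits y - 1) + 1)"
    using abs_less_power_bits[of x] abs_less_power_bits[of y] *[of "bits x - 1" "bits y - 1"] by linarith
  then show ?thesis
    using bits_le_Suc_iff[of "x + y" "bits x - 1 + (bits y - 1) + 1"] bits_pos[of x] bits_pos[of y] by simp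
qed

lemma bits_uminus: "bits (- x) = bits x"
  by (simp add: bits_def)

lemma bits_diff: "bits (x - y) \<le> bits x + bits y"
  using bits_add[of x "- y"] by (simp add: bits_uminus)

lemma bits_mult: "bits (x * y) \<le> bits x + bits y"
proof -
  have "\<bar>x * y\<bar> < 2 ^ (bits x - 1) * 2 ^ (bits y - 1)"
    unfolding abs_mult by (intro mult_strict_mono' abs_less_power_bits) auto
  then have "bits (x * y) \<le> Suc (bits x - 1 + (bits y - 1))"
    unfolding bits_le_Suc_iff by (simp add: power_add)
  then show ?thesis using bits_pos[of x] bits_pos[of y] by simp
qed

text \<open>Floor division does not increase the absolute value: for \<open>a < 0 < b\<close> one
  has \<open>a <= a div b < 0\<close>, and division by 0 yields 0.\<close>

lemma bits_div: "bits (x div y) \<le> bits x"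
proof (rule bits_mono)
  have pos: "\<bar>a div b\<bar> \<le> \<bar>a\<bar>" if "0 < b" for a b :: int
  proof (cases "0 \<le> a")
    case True
    then show ?thesis using that zdiv_mono2[of a 1 b] pos_imp_zdiv_nonneg_iff[of b a] by simp
  next
    case False
    then have "a * b \<le> a" using that by (simp add: mult_le_cancel_left)
    then have "a \<le> a div b" using that by (metis less_le nonzero_mult_div_cancel_right zdiv_mono1)
    moreover have "a div b < 0" using False that by (simp add: neg_imp_zdiv_neg_iff pos_imp_zdiv_neg_iff)
    ultimately show ?thesis using False by simp
  qed
  show "\<bar>x div y\<bar> \<le> \<bar>x\<bar>"
  proof (cases "y < 0")
    case True
    then show ?thesis using pos[of "- y" "- x"] by simp
  next
    case False
    then show ?thesis using pos[of y x] by (cases "y = 0") auto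
  qed
qed

text \<open>Lengths of values are bounded by multiples of one length \<open>bits m\<close>, with a
  factor that depends on the expression only. Lengths add up under multiplication; the same crude
  bound serves the other operations. A value that is read counts once, whatever its address.\<close>

fun value_coeff :: "aexp \<Rightarrow> nat" where
  "value_coeff (Num z) = bits z"
| "value_coeff (Read a e) = 1"
| "value_coeff (Add e f) = value_coeff e + value_coeff f"
| "value_coeff (Sub e f) = value_coeff e + value_coeff f"
| "value_coeff (Mul e f) = value_coeff e + value_coeff f"
| "value_coeff (Div e f) = value_coeff e + value_coeff f"

fun time_coeff :: "aexp \<Rightarrow> nat" where
  "time_coeff (Num z) = bits z"
| "time_coeff (Read a e) = time_coeff e + value_coeff e + 1"
| "time_coeff (Add e f) = time_coeff e + time_coeff f + value_coeff e + value_coeff f"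
| "time_coeff (Sub e f) = time_coeff e + time_coeff f + value_coeff e + value_coeff f"
| "time_coeff (Mul e f) = time_coeff e + time_coeff f + value_coeff e + value_coeff f"
| "time_coeff (Div e f) = time_coeff e + time_coeff f + value_coeff e + value_coeff f"

definition bounded_memory :: "int \<Rightarrow> memory \<Rightarrow> bool" where
  "bounded_memory m s \<longleftrightarrow> (\<forall>a i. \<bar>s a i\<bar> \<le> m)"

lemma bits_aval:
  assumes "bounded_memory m s"
  shows "bits (aval e s) \<le> value_coeff e * bits m"
proof (induction e)
  case (Num z)
  show ?case using bits_pos[of m] by simp
next
  case (Read a e)
  have "\<bar>s a (aval e s)\<bar> \<le> \<bar>m\<bar>" using assms by (auto simp: bounded_memory_def intro: order_trans[OF _ abs_ge_self])
  then show ?case using bits_mono by simp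
next
  case (Add e f)
  then show ?case using bits_add[of "aval e s" "aval f s"] by (simp add: algebra_simps)
next
  case (Sub e f)
  then show ?case using bits_diff[of "aval e s" "aval f s"] by (simp add: algebra_simps)
next
  case (Mul e f)
  then show ?case using bits_mult[of "aval e s" "aval f s"] by (simp add: algebra_simps)
next
  case (Div e f)
  then show ?case using bits_div[of "aval e s" "aval f s"] by (simp add: algebra_simps)
qed

lemma atime_le:
  assumes "bounded_memory m s"
  shows "atime e s \<le> time_coeff e * bits m"
proof (induction e)
  case (Num z)
  show ?case using bits_pos[of m] by simp
next
  case (Read a e)
  moreover have "bits (s a (aval e s)) \<le> bits m"
    using assms by (intro bits_mono) (auto simp: bounded_memory_def intro: order_trans[OF _ abs_ge_self])
  ultimately show ?case using bits_aval[OF assms, of e] by (simp add: algebra_simps)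
next
  case (Add e f)
  then show ?case using bits_aval[OF assms, of e] bits_aval[OF assms, of f] by (simp add: algebra_simps)
next
  case (Sub e f)
  then show ?case using bits_aval[OF assms, of e] bits_aval[OF assms, of f] by (simp add: algebra_simps)
next
  case (Mul e f)
  then show ?case using bits_aval[OF assms, of e] bits_aval[OF assms, of f] by (simp add: algebra_simps)
next
  case (Div e f)
  then show ?case using bits_aval[OF assms, of e] bits_aval[OF assms, of f] by (simp add: algebra_simps)
qed

section \<open>Functions bounded by a polynomial in a size\<close>

definition poly_bounded :: "('x \<Rightarrow> nat) \<Rightarrow> ('x \<Rightarrow> nat) \<Rightarrow> bool" where
  "poly_bounded sz f \<longleftrightarrow> (\<exists>q :: nat poly. \<forall>x. f x \<le> poly q (sz x))"

lemma poly_bounded_const: "poly_bounded sz (\<lambda>_. c)"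
  unfolding poly_bounded_def by (rule exI[of _ "[:c:]"]) simp

lemma poly_bounded_size: "poly_bounded sz sz"
  unfolding poly_bounded_def by (rule exI[of _ "[:0, 1:]"]) simp

lemma poly_bounded_add: "poly_bounded sz f \<Longrightarrow> poly_bounded sz g \<Longrightarrow> poly_bounded sz (\<lambda>x. f x + g x)"
  unfolding poly_bounded_def by (metis (no_types, lifting) add_mono poly_add)

lemma poly_bounded_mult: "poly_bounded sz f \<Longrightarrow> poly_bounded sz g \<Longrightarrow> poly_bounded sz (\<lambda>x. f x * g x)"
  unfolding poly_bounded_def by (metis (no_types, lifting) mult_mono poly_mult zero_le)

lemma poly_bounded_mono: "poly_bounded sz f \<Longrightarrow> (\<And>x. g x \<le> f x) \<Longrightarrow> poly_bounded sz g"
  unfolding poly_bounded_def by (meson order_trans)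

lemma poly_bounded_power: "poly_bounded sz f \<Longrightarrow> poly_bounded sz (\<lambda>x. f x ^ d)"
  by (induction d) (auto intro: poly_bounded_mult poly_bounded_const[of sz 1, simplified])

lemmas poly_bounded_intros = poly_bounded_const poly_bounded_size poly_bounded_add poly_bounded_mult
  poly_bounded_power

text \<open>
  A bound \<open>cap x\<close> of polynomial bit length on all integers in memory makes the cost of every
  single expression polynomial in the size of the input \<open>x\<close>, so a triple can hide its time bound.
  The bound does not depend on the logical variable \<open>z\<close>, which relates the states before and after
  the execution; in the rules for loops it also carries the iteration.
\<close>
locale poly_machine =
  fixes sz :: "'x \<Rightarrow> nat" and cap :: "'x \<Rightarrow> int"
  assumes cap_bits: "poly_bounded sz (\<lambda>x. bits (cap x))"
begin

definition triple ::
    "('x \<Rightarrow> 'z \<Rightarrow> memory \<Rightarrow> bool) \<Rightarrow> com \<Rightarrow> ('x \<Rightarrow> 'z \<Rightarrow> memory \<Rightarrow> bool) \<Rightarrow> bool" where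
  "triple P c Q \<longleftrightarrow> (\<exists>f. poly_bounded sz f \<and>
     (\<forall>x z s. P x z s \<longrightarrow> bounded_memory (cap x) s \<longrightarrow>
       (\<exists>t s'. exec c s t s' \<and> t \<le> f x \<and> bounded_memory (cap x) s' \<and> Q x z s')))"

lemma tripleI:
  assumes "poly_bounded sz f"
    and "\<And>x z s. P x z s \<Longrightarrow> bounded_memory (cap x) s \<Longrightarrow>
      \<exists>t s'. exec c s t s' \<and> t \<le> f x \<and> bounded_memory (cap x) s' \<and> Q x z s'"
  shows "triple P c Q"
  using assms unfolding triple_def by blast

text \<open>The general rule of consequence: the logical variable may be chosen anew for each
  initial state, and even have another type.\<close>

lemma triple_adapt:
  assumes "triple P' c Q'"
    and "\<And>x z s. P x z s \<Longrightarrow> \<exists>z'. P' x z' s \<and> (\<forall>s'. Q' x z' s' \<longrightarrow> Q x z s')"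
  shows "triple P c Q"
proof -
  obtain f where f: "poly_bounded sz f"
    "\<And>x z s. P' x z s \<Longrightarrow> bounded_memory (cap x) s \<Longrightarrow>
      \<exists>t s'. exec c s t s' \<and> t \<le> f x \<and> bounded_memory (cap x) s' \<and> Q' x z s'"
    using assms(1) unfolding triple_def by blast
  show ?thesis
    by (rule tripleI[OF f(1)]) (meson assms(2) f(2))
qed

lemma triple_pre:
  assumes "triple P' c Q" and "\<And>x z s. P x z s \<Longrightarrow> P' x z s"
  shows "triple P c Q"
  by (rule triple_adapt[OF assms(1)]) (use assms(2) in blast)

lemma triple_conseq:
  assumes "triple P' c Q'" and "\<And>x z s. P x z s \<Longrightarrow> P' x z s" and "\<And>x z s. Q' x z s \<Longrightarrow> Q x z s"
  shows "triple P c Q"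
  by (rule triple_adapt[OF assms(1)]) (use assms(2,3) in blast)

text \<open>Turns a specification that relates the final state to the initial one into a
  precondition for an arbitrary \<open>Q\<close>, so that a verified subprogram can be treated like
  a primitive statement.\<close>

lemma triple_call:
  assumes "triple (\<lambda>x s0 s. s = s0 \<and> P x s) c R"
  shows "triple (\<lambda>x z s. P x s \<and> (\<forall>s'. R x s s' \<longrightarrow> Q x z s')) c Q"
  by (rule triple_adapt[OF assms]) blast

lemma triple_Skip: "triple Q Skip Q"
  by (rule tripleI[OF poly_bounded_const[of _ 1]]) (use exec.Skip in force)

text \<open>Only the stored value has to respect \<open>cap x\<close>. The address and the
  intermediate values may be larger; their lengths are bounded by \<open>bits_aval\<close> and
  \<open>atime_le\<close>.\<close>

lemma triple_Write:
  "triple (\<lambda>x z s. \<bar>aval f s\<bar> \<le> cap x \<and> Q x z (s(a := (s a)(aval e s := aval f s)))) (Write a e f) Q"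
proof (rule tripleI)
  let ?c = "time_coeff e + time_coeff f + value_coeff e + value_coeff f"
  show "poly_bounded sz (\<lambda>x. ?c * bits (cap x))"
    by (intro poly_bounded_intros cap_bits)
  fix x z s
  assume *: "\<bar>aval f s\<bar> \<le> cap x \<and> Q x z (s(a := (s a)(aval e s := aval f s)))"
    and b: "bounded_memory (cap x) s"
  have "atime e s + atime f s + bits (aval e s) + bits (aval f s) \<le> ?c * bits (cap x)"
    using atime_le[OF b, of e] atime_le[OF b, of f] bits_aval[OF b, of e] bits_aval[OF b, of f]
    by (simp add: algebra_simps)
  moreover have "bounded_memory (cap x) (s(a := (s a)(aval e s := aval f s)))"
    using b * by (simp add: bounded_memory_def)
  ultimately show "\<exists>t s'. exec (Write a e f) s t s' \<and> t \<le> ?c * bits (cap x) \<and>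
      bounded_memory (cap x) s' \<and> Q x z s'"
    using * exec.Write by blast
qed

text \<open>The premises stand in backward order: repeated application of the rules then computes a
  precondition from the postcondition, and a single implication between preconditions
  remains.\<close>

lemma triple_Seq:
  assumes "triple R d Q" "triple P c R"
  shows "triple P (Seq c d) Q"
proof -
  obtain g where g: "poly_bounded sz g"
    "\<And>x z s. R x z s \<Longrightarrow> bounded_memory (cap x) s \<Longrightarrow>
      \<exists>t s'. exec d s t s' \<and> t \<le> g x \<and> bounded_memory (cap x) s' \<and> Q x z s'"
    using assms(1) unfolding triple_def by blast
  obtain f where f: "poly_bounded sz f"
    "\<And>x z s. P x z s \<Longrightarrow> bounded_memory (cap x) s \<Longrightarrow>
      \<exists>t s'. exec c s t s' \<and> t \<le> f x \<and> bounded_memory (cap x) s' \<and> R x z s'"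
    using assms(2) unfolding triple_def by blast
  show ?thesis
  proof (rule tripleI)
    show "poly_bounded sz (\<lambda>x. f x + g x)" by (intro poly_bounded_intros f g)
  qed (meson f(2) g(2) exec.Seq add_mono)
qed

lemma triple_If:
  assumes "triple P c Q" "triple P' d Q"
  shows "triple (\<lambda>x z s. if 0 < aval e s then P x z s else P' x z s) (If e c d) Q"
proof -
  obtain f where f: "poly_bounded sz f"
    "\<And>x z s. P x z s \<Longrightarrow> bounded_memory (cap x) s \<Longrightarrow>
      \<exists>t s'. exec c s t s' \<and> t \<le> f x \<and> bounded_memory (cap x) s' \<and> Q x z s'"
    using assms(1) unfolding triple_def by blast
  obtain g where g: "poly_bounded sz g"
    "\<And>x z s. P' x z s \<Longrightarrow> bounded_memory (cap x) s \<Longrightarrow>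
      \<exists>t s'. exec d s t s' \<and> t \<le> g x \<and> bounded_memory (cap x) s' \<and> Q x z s'"
    using assms(2) unfolding triple_def by blast
  let ?c = "time_coeff e + value_coeff e"
  show ?thesis
  proof (rule tripleI)
    show "poly_bounded sz (\<lambda>x. ?c * bits (cap x) + (f x + g x))"
      by (intro poly_bounded_intros cap_bits f g)
    fix x z s
    assume P: "if 0 < aval e s then P x z s else P' x z s" and b: "bounded_memory (cap x) s"
    have c: "atime e s + bits (aval e s) \<le> ?c * bits (cap x)"
      using atime_le[OF b, of e] bits_aval[OF b, of e] by (simp add: algebra_simps)
    show "\<exists>t s'. exec (If e c d) s t s' \<and> t \<le> ?c * bits (cap x) + (f x + g x) \<and>
      bounded_memory (cap x) s' \<and> Q x z s'"
    proof (cases "0 < aval e s")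
      case True
      then obtain t s' where "exec c s t s'" "t \<le> f x" "bounded_memory (cap x) s'" "Q x z s'"
        using P b f(2) by (metis (full_types))
      then show ?thesis using exec.IfTrue[OF True, of c t s' d] c
        by (intro exI[of _ "atime e s + bits (aval e s) + t"] exI[of _ s']) auto
    next
      case False
      then obtain t s' where "exec d s t s'" "t \<le> g x" "bounded_memory (cap x) s'" "Q x z s'"
        using P b g(2) by (metis (full_types))
      then show ?thesis using exec.IfFalse[OF False, of d t s' c] c
        by (intro exI[of _ "atime e s + bits (aval e s) + t"] exI[of _ s']) auto
    qed
  qed
qed

text \<open>The argument \<open>l\<close> of the invariant bounds the number of remaining iterations.\<close>
lemma triple_While:
  assumes body: "triple (\<lambda>x zl s. Inv x (fst zl) (snd zl) s \<and> 0 < aval e s) c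
      (\<lambda>x zl s. \<exists>l' < snd zl. Inv x (fst zl) l' s)"
    and N: "poly_bounded sz N"
  shows "triple (\<lambda>x z s. \<exists>l \<le> N x. Inv x z l s) (While e c)
    (\<lambda>x z s. \<exists>l. Inv x z l s \<and> \<not> 0 < aval e s)"
proof -
  obtain f where f: "poly_bounded sz f"
    and ex: "\<And>x z s. Inv x (fst z) (snd z) s \<and> 0 < aval e s \<Longrightarrow> bounded_memory (cap x) s \<Longrightarrow>
      \<exists>t s'. exec c s t s' \<and> t \<le> f x \<and> bounded_memory (cap x) s' \<and>
        (\<exists>l' < snd z. Inv x (fst z) l' s')"
    using body unfolding triple_def by blast
  define k where "k x = (time_coeff e + value_coeff e) * bits (cap x)" for x
  have "poly_bounded sz (\<lambda>x. (time_coeff e + value_coeff e) * bits (cap x))"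
    by (intro poly_bounded_intros cap_bits)
  then have k: "poly_bounded sz k" by (simp add: k_def[abs_def])
  have test: "atime e s + bits (aval e s) \<le> k x" if "bounded_memory (cap x) s" for x s
    using atime_le[OF that, of e] bits_aval[OF that, of e] by (simp add: k_def algebra_simps)
  have run: "\<exists>t s'. exec (While e c) s t s' \<and> t \<le> (l + 1) * (k x + f x) \<and> bounded_memory (cap x) s' \<and>
      (\<exists>l. Inv x z l s' \<and> \<not> 0 < aval e s')"
    if "Inv x z l s" "bounded_memory (cap x) s" for x z l s
    using that
  proof (induction l arbitrary: s rule: less_induct)
    case (less l)
    show ?case
    proof (cases "0 < aval e s")
      case True
      then obtain t s' l' where t: "exec c s t s'" "t \<le> f x" "bounded_memory (cap x) s'" "l' < l" "Inv x z l' s'"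
        using ex[of x "(z, l)" s] less.prems by auto
      from less.IH[OF t(4,5,3)] obtain t' s'' where
        t': "exec (While e c) s' t' s''" "t' \<le> (l' + 1) * (k x + f x)" "bounded_memory (cap x) s''"
          "\<exists>l. Inv x z l s'' \<and> \<not> 0 < aval e s''" by blast
      have "atime e s + bits (aval e s) + t + t' \<le> k x + f x + (l' + 1) * (k x + f x)"
        using test[OF less.prems(2)] t(2) t'(2) by linarith
      also have "\<dots> = (l' + 2) * (k x + f x)" by (simp add: algebra_simps)
      also have "\<dots> \<le> (l + 1) * (k x + f x)" using t(4) by (intro mult_right_mono) auto
      finally show ?thesis using exec.WhileTrue[OF True t(1) t'(1)] t'(3,4) by blast
    next
      case False
      have "atime e s + bits (aval e s) \<le> (l + 1) * (k x + f x)"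
        using test[OF less.prems(2)] by (simp add: trans_le_add1)
      then show ?thesis using exec.WhileFalse[OF False, of c] less.prems False by blast
    qed
  qed
  show ?thesis
  proof (rule tripleI)
    show "poly_bounded sz (\<lambda>x. (N x + 1) * (k x + f x))" by (intro poly_bounded_intros N k f)
    fix x z s
    assume "\<exists>l \<le> N x. Inv x z l s" and b: "bounded_memory (cap x) s"
    then obtain l where l: "l \<le> N x" "Inv x z l s" by blast
    have "(l + 1) * (k x + f x) \<le> (N x + 1) * (k x + f x)" using l by (intro mult_right_mono) auto
    then show "\<exists>t s'. exec (While e c) s t s' \<and> t \<le> (N x + 1) * (k x + f x) \<and> bounded_memory (cap x) s' \<and>
      (\<exists>l. Inv x z l s' \<and> \<not> 0 < aval e s')"
      using run[OF l(2) b] order_trans by blast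
  qed
qed

end

section \<open>Counting loops\<close>

abbreviation V :: "nat \<Rightarrow> aexp" where
  "V a \<equiv> Read a (Num 0)"

definition For :: "nat \<Rightarrow> aexp \<Rightarrow> com \<Rightarrow> com" where
  "For a e c = Seq (Write a (Num 0) (Num 0))
     (While (Sub e (V a)) (Seq c (Write a (Num 0) (Add (V a) (Num 1)))))"

context poly_machine
begin

text \<open>The loop bound is evaluated anew in each round, so the invariant has to fix its value
  \<open>N x\<close>; \<open>N x <= cap x\<close> lets the counter be stored, and
  \<open>N x <= sz x\<close> bounds the rounds. The assumption \<open>counter\<close> makes the
  invariant blind to the counter array, so that incrementing it preserves the invariant. The measure
  is \<open>N x - l\<close>.\<close>

lemma triple_For:
  assumes body: "triple (\<lambda>x zl s. Inv x (fst zl) (snd zl) s \<and> s a 0 = int (snd zl) \<and> snd zl < N x) c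
      (\<lambda>x zl s. Inv x (fst zl) (Suc (snd zl)) s \<and> s a 0 = int (snd zl))"
    and e: "\<And>x z l s. Inv x z l s \<Longrightarrow> aval e s = int (N x) \<and> int (N x) \<le> cap x \<and> N x \<le> sz x"
    and counter: "\<And>x z l s f. Inv x z l s \<Longrightarrow> Inv x z l (s(a := f))"
  shows "triple (\<lambda>x z s. Inv x z 0 s) (For a e c) (\<lambda>x z s. Inv x z (N x) s)"
proof -
  define J where "J x z r s \<longleftrightarrow> (\<exists>l. Inv x z l s \<and> s a 0 = int l \<and> l \<le> N x \<and> r = N x - l)" for x z r s
  have "triple (\<lambda>x zr s. J x (fst zr) (snd zr) s \<and> 0 < aval (Sub e (V a)) s)
      (Seq c (Write a (Num 0) (Add (V a) (Num 1)))) (\<lambda>x zr s. \<exists>r' < snd zr. J x (fst zr) r' s)"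
  proof (rule triple_Seq[OF triple_Write], rule triple_adapt[OF body])
    fix x zr s
    assume *: "J x (fst zr) (snd zr) s \<and> 0 < aval (Sub e (V a)) s"
    obtain z r where zr: "zr = (z, r)" by (cases zr)
    from * obtain l where l: "Inv x z l s" "s a 0 = int l" "r = N x - l" "l < N x"
      using e by (fastforce simp: zr J_def)
    have "int l + 1 \<le> cap x \<and> (\<exists>r' < N x - l. J x z r' (s'(a := (s' a)(0 := int l + 1))))"
      if s': "Inv x z (Suc l) s'" "s' a 0 = int l" for s'
    proof -
      have "J x z (N x - Suc l) (s'(a := (s' a)(0 := int l + 1)))"
        using s' l counter by (auto simp: J_def intro!: exI[of _ "Suc l"])
      then show ?thesis
        using e[OF l(1)] l by (auto intro!: exI[of _ "N x - Suc l"])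
    qed
    then show "\<exists>z'. (Inv x (fst z') (snd z') s \<and> s a 0 = int (snd z') \<and> snd z' < N x) \<and>
      (\<forall>s'. Inv x (fst z') (Suc (snd z')) s' \<and> s' a 0 = int (snd z') \<longrightarrow>
        \<bar>aval (Add (V a) (Num 1)) s'\<bar> \<le> cap x \<and>
        (\<exists>r' < snd zr. J x (fst zr) r'
          (s'(a := (s' a)(aval (Num 0) s' := aval (Add (V a) (Num 1)) s')))))"
      by (intro exI[of _ "(z, l)"]) (auto simp: zr l)
  qed
  from triple_While[OF this poly_bounded_size] have
    "triple (\<lambda>x z s. \<exists>r \<le> sz x. J x z r s) (While (Sub e (V a)) (Seq c (Write a (Num 0) (Add (V a) (Num 1)))))
      (\<lambda>x z s. \<exists>r. J x z r s \<and> \<not> 0 < aval (Sub e (V a)) s)" .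
  then have "triple (\<lambda>x z s. \<exists>r \<le> sz x. J x z r s) (While (Sub e (V a)) (Seq c (Write a (Num 0) (Add (V a) (Num 1)))))
      (\<lambda>x z s. Inv x z (N x) s)"
  proof (rule triple_adapt)
    fix x z s assume *: "\<exists>r \<le> sz x. J x z r s"
    have "Inv x z (N x) s'" if "J x z r s'" "\<not> 0 < aval (Sub e (V a)) s'" for r s'
    proof -
      obtain l where l: "Inv x z l s'" "s' a 0 = int l" "l \<le> N x" using \<open>J x z r s'\<close> by (auto simp: J_def)
      then have "l = N x" using e[OF l(1)] that(2) by auto
      then show ?thesis using l by simp
    qed
    with * show "\<exists>z'. (\<exists>r \<le> sz x. J x z' r s) \<and>
      (\<forall>s'. (\<exists>r. J x z' r s' \<and> \<not> 0 < aval (Sub e (V a)) s') \<longrightarrow> Inv x z (N x) s')"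
      by blast
  qed
  from triple_Seq[OF this triple_Write] show ?thesis
    unfolding For_def
  proof (rule triple_pre)
    fix x z s assume I: "Inv x z 0 s"
    then have "J x z (N x) (s(a := (s a)(0 := 0)))" using counter by (auto simp: J_def)
    then show "\<bar>aval (Num 0) s\<bar> \<le> cap x \<and>
       (\<exists>r \<le> sz x. J x z r (s(a := (s a)(aval (Num 0) s := aval (Num 0) s))))"
      using e[OF I] by auto
  qed
qed

lemma triple_polytime_computable:
  assumes c: "triple (\<lambda>x (_ :: unit) s. x \<in> D \<and> s = input_memory (enc x)) c (\<lambda>x _ s. R x (output_list s))"
    and sz: "\<And>x. sz x = input_size (enc x)"
    and cap: "\<And>x. x \<in> D \<Longrightarrow> bounded_memory (cap x) (input_memory (enc x))"
  shows "polytime_computable enc D R"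
proof -
  obtain f where f: "poly_bounded sz f" and run: "\<forall>x z s. x \<in> D \<and> s = input_memory (enc x) \<longrightarrow>
      bounded_memory (cap x) s \<longrightarrow>
      (\<exists>t s'. exec c s t s' \<and> t \<le> f x \<and> bounded_memory (cap x) s' \<and> R x (output_list s'))"
    using c unfolding triple_def by blast
  obtain q where q: "\<And>x. f x \<le> poly q (sz x)" using f unfolding poly_bounded_def by blast
  have "\<exists>t s. exec c (input_memory (enc x)) t s \<and> t \<le> poly q (input_size (enc x)) \<and> R x (output_list s)"
    if x: "x \<in> D" for x
  proof -
    obtain t s where "exec c (input_memory (enc x)) t s" "t \<le> f x" "R x (output_list s)"
      using run cap[OF x] x by blast
    then show ?thesis using q[of x] sz[of x] by (metis order_trans)
  qed
  then show ?thesis unfolding polytime_computable_def by blast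
qed

end

section \<open>Decoding instances\<close>

abbreviation num_centers :: "raw_instance \<Rightarrow> nat" where
  "num_centers r \<equiv> fst r"

abbreviation num_customers :: "raw_instance \<Rightarrow> nat" where
  "num_customers r \<equiv> fst (snd r)"

abbreviation num_open :: "raw_instance \<Rightarrow> nat" where
  "num_open r \<equiv> snd (snd (snd (snd r)))"

abbreviation (input) valid :: "raw_instance \<Rightarrow> bool" where
  "valid r \<equiv> admissible (instance_of r)"

abbreviation size_of :: "raw_instance \<Rightarrow> nat" where
  "size_of r \<equiv> input_size (encode_instance r)"

text \<open>Row-major order, in which \<open>List.product\<close> enumerates the pairs.\<close>

definition pair_index :: "raw_instance \<Rightarrow> nat \<Rightarrow> nat \<Rightarrow> nat" where
  "pair_index r i j = i * num_customers r + j"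

text \<open>The header occupies positions 0 to 2; three entries per pair follow.\<close>

definition flag :: "raw_instance \<Rightarrow> nat \<Rightarrow> int" where
  "flag r q = encode_instance r ! (3 + 3 * q)"

definition numer :: "raw_instance \<Rightarrow> nat \<Rightarrow> int" where
  "numer r q = encode_instance r ! (4 + 3 * q)"

definition denom :: "raw_instance \<Rightarrow> nat \<Rightarrow> int" where
  "denom r q = encode_instance r ! (5 + 3 * q)"

text \<open>A product rather than a least common multiple: it takes one multiplication per pair, and
  its bit length is still linear in the input size. Non-edges are encoded with the fraction
  \<open>0 / 1\<close> and so change neither this product nor the sum of the costs.\<close>

definition common_denom :: "raw_instance \<Rightarrow> int" where
  "common_denom r = (\<Prod>q < num_centers r * num_customers r. denom r q)"

definition int_cost :: "raw_instance \<Rightarrow> nat \<Rightarrow> int" where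
  "int_cost r q = numer r q * (common_denom r div denom r q)"

definition int_cost_sum :: "raw_instance \<Rightarrow> int" where
  "int_cost_sum r = (\<Sum>q < num_centers r * num_customers r. int_cost r q)"

lemma instance_of_simps [simp]:
  "centers (instance_of r) = {..<num_centers r}"
  "customers (instance_of r) = {..<num_customers r}"
  "budget (instance_of r) = num_open r"
  "edges (instance_of r) = fst (snd (snd r))"
  "cost (instance_of r) = (\<lambda>i j. real_of_rat (fst (snd (snd (snd r))) i j))"
  by (cases r; simp)+

lemma concat_triples_nth:
  assumes "\<And>x. length (f x) = 3" "q < length xs" "d < 3"
  shows "concat (map f xs) ! (3 * q + d) = f (xs ! q) ! d"
  using assms(2)
proof (induction xs arbitrary: q)
  case (Cons x xs)
  show ?case
  proof (cases q)
    case 0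
    then show ?thesis using assms by (simp add: nth_append)
  next
    case (Suc q')
    then show ?thesis using Cons assms by (simp add: nth_append)
  qed
qed simp

lemma length_encode_instance:
  "length (encode_instance r) = 3 + 3 * (num_centers r * num_customers r)"
proof -
  have "length (concat (map f xs)) = 3 * length xs" if "\<And>x. length (f x) = 3"
    for f :: "nat \<times> nat \<Rightarrow> int list" and xs
    using that by (induction xs) auto
  then show ?thesis by (cases r) (simp add: case_prod_unfold)
qed

lemma encode_instance_header:
  "encode_instance r ! 0 = int (num_centers r)"
  "encode_instance r ! 1 = int (num_customers r)"
  "encode_instance r ! 2 = int (num_open r)"
  by (cases r; simp)+

lemma pair_index_less:
  assumes "i < num_centers r" "j < num_customers r"
  shows "pair_index r i j < num_centers r * num_customers r"
proof -
  have "pair_index r i j < (i + 1) * num_customers r" using assms by (simp add: pair_index_def)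
  also have "\<dots> \<le> num_centers r * num_customers r" using assms by (intro mult_right_mono) auto
  finally show ?thesis .
qed

lemma encode_instance_entry:
  assumes "q < num_centers r * num_customers r" "d < 3"
  defines "i \<equiv> q div num_customers r" and "j \<equiv> q mod num_customers r"
  shows "encode_instance r ! (3 + (3 * q + d)) =
    (if (i, j) \<in> edges (instance_of r)
     then [1, fst (quotient_of (fst (snd (snd (snd r))) i j)), snd (quotient_of (fst (snd (snd (snd r))) i j))]
     else [0, 0, 1]) ! d"
proof -
  obtain p n E c k where r: "r = (p, n, E, c, k)" by (cases r)
  have n: "0 < n" using assms(1) by (cases n) (auto simp: r)
  have "q div n < p" using assms(1) by (simp add: r less_mult_imp_div_less)
  then have "List.product [0..<p] [0..<n] ! q = (i, j)"
    using assms(1) n by (subst product_nth) (auto simp: r i_def j_def)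
  then show ?thesis
    using concat_triples_nth[of "\<lambda>(i, j). if (i, j) \<in> E
         then [1, fst (quotient_of (c i j)), snd (quotient_of (c i j))]
         else [0, 0, 1]" q "List.product [0..<p] [0..<n]" d] assms(1,2)
    by (auto simp: r)
qed

lemma quotient_of_real:
  "real_of_rat x = real_of_int (fst (quotient_of x)) / real_of_int (snd (quotient_of x))"
  using quotient_of_div[of x "fst (quotient_of x)" "snd (quotient_of x)"]
  by (metis of_rat_divide of_rat_of_int_eq prod.collapse)

lemma denom_pos:
  assumes "q < num_centers r * num_customers r"
  shows "0 < denom r q"
  using encode_instance_entry[OF assms, of 2] quotient_of_denom_pos'
  by (auto simp: denom_def numeral_2_eq_2 add.commute)

lemma flag_pair_index:
  assumes "i < num_centers r" "j < num_customers r"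
  shows "flag r (pair_index r i j) = (if (i, j) \<in> edges (instance_of r) then 1 else 0)"
  using encode_instance_entry[OF pair_index_less[OF assms], of 0] assms
  by (auto simp: flag_def pair_index_def)

lemma numer_nonneg:
  assumes "valid r" "q < num_centers r * num_customers r"
  shows "0 \<le> numer r q"
proof -
  let ?x = "fst (snd (snd (snd r))) (q div num_customers r) (q mod num_customers r)"
  show ?thesis
  proof (cases "(q div num_customers r, q mod num_customers r) \<in> edges (instance_of r)")
    case True
    from admissibleD(4)[OF assms(1) True] have "0 \<le> real_of_rat ?x" by simp
    then have "0 \<le> fst (quotient_of ?x)"
      using quotient_of_denom_pos'[of ?x] by (simp add: quotient_of_real zero_le_divide_iff)
    then show ?thesis using True encode_instance_entry[OF assms(2), of 1] by (simp add: numer_def)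
  next
    case False
    then show ?thesis using encode_instance_entry[OF assms(2), of 1] by (simp add: numer_def)
  qed
qed

lemma denom_dvd_common_denom:
  assumes "q < num_centers r * num_customers r"
  shows "denom r q dvd common_denom r"
  unfolding common_denom_def by (rule dvd_prodI) (use assms in auto)

lemma common_denom_pos: "0 < common_denom r"
  unfolding common_denom_def by (rule prod_pos) (auto intro: denom_pos)

lemma int_cost_nonneg:
  assumes "valid r" "q < num_centers r * num_customers r"
  shows "0 \<le> int_cost r q"
  using numer_nonneg[OF assms] denom_pos[OF assms(2)] common_denom_pos[of r]
  by (simp add: int_cost_def pos_imp_zdiv_nonneg_iff)

lemma cost_pair_index:
  assumes "(i, j) \<in> edges (instance_of r)" "i < num_centers r" "j < num_customers r"
  shows "cost (instance_of r) i j = real_of_int (int_cost r (pair_index r i j)) / real_of_int (common_denom r)"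
proof -
  let ?q = "pair_index r i j"
  note q = pair_index_less[OF assms(2,3)]
  have ij: "?q div num_customers r = i" "?q mod num_customers r = j"
    using assms by (auto simp: pair_index_def)
  obtain c where c: "common_denom r = denom r ?q * c" using denom_dvd_common_denom[OF q] by blast
  have d: "0 < denom r ?q" by (rule denom_pos[OF q])
  have cp: "c \<noteq> 0" using c common_denom_pos[of r] by auto
  have "cost (instance_of r) i j = real_of_int (numer r ?q) / real_of_int (denom r ?q)"
    using encode_instance_entry[OF q, of 1] encode_instance_entry[OF q, of 2] assms(1)
    by (simp add: quotient_of_real numer_def denom_def ij add.commute numeral_2_eq_2)
  also have "\<dots> = real_of_int (numer r ?q * c) / real_of_int (denom r ?q * c)"
    using cp d by simp
  also have "\<dots> = real_of_int (int_cost r ?q) / real_of_int (common_denom r)"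
    using d by (simp add: int_cost_def c)
  finally show ?thesis .
qed

lemma edge_bounds:
  assumes "valid r" "(i, j) \<in> edges (instance_of r)"
  shows "i < num_centers r" "j < num_customers r"
  using admissibleD(3)[OF assms(1)] assms(2) by auto

text \<open>Costs are integer multiples of \<open>1 / D\<close>; this is what qualifies
  \<open>1 / D\<close> as the first guess.\<close>

lemma cost_zero_or_ge:
  assumes "valid r" "(i, j) \<in> edges (instance_of r)"
  shows "cost (instance_of r) i j = 0 \<or> 1 / real_of_int (common_denom r) \<le> cost (instance_of r) i j"
proof -
  note b = edge_bounds[OF assms]
  have "0 \<le> int_cost r (pair_index r i j)" by (rule int_cost_nonneg[OF assms(1) pair_index_less[OF b]])
  then have "int_cost r (pair_index r i j) = 0 \<or> 1 \<le> int_cost r (pair_index r i j)" by linarith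
  then show ?thesis unfolding cost_pair_index[OF assms(2) b] using common_denom_pos[of r]
    by (auto intro!: divide_right_mono)
qed

text \<open>Edges occupy distinct positions, and the other terms of the sum over all positions are
  nonnegative.\<close>

lemma sum_cost_le:
  assumes "valid r"
  shows "(\<Sum>(i, j)\<in>edges (instance_of r). cost (instance_of r) i j) \<le>
    real_of_int (int_cost_sum r) / real_of_int (common_denom r)"
proof -
  let ?E = "edges (instance_of r)" and ?q = "\<lambda>(i, j). pair_index r i j"
  let ?m = "num_centers r * num_customers r"
  have inj: "inj_on ?q ?E"
  proof (rule inj_on_inverseI[of _ "\<lambda>q. (q div num_customers r, q mod num_customers r)"])
    fix e assume "e \<in> ?E"
    then show "(\<lambda>q. (q div num_customers r, q mod num_customers r)) (?q e) = e"
      using edge_bounds[OF assms, of "fst e" "snd e"] by (cases e) (auto simp: pair_index_def)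
  qed
  have "(\<Sum>(i, j)\<in>?E. cost (instance_of r) i j) =
      (\<Sum>e\<in>?E. real_of_int (int_cost r (?q e)) / real_of_int (common_denom r))"
  proof (rule sum.cong[OF refl])
    fix e assume e: "e \<in> ?E"
    obtain i j where ij: "e = (i, j)" by (cases e)
    show "(case e of (i, j) \<Rightarrow> cost (instance_of r) i j) =
        real_of_int (int_cost r (?q e)) / real_of_int (common_denom r)"
      unfolding ij prod.case
      using e cost_pair_index edge_bounds[OF assms] unfolding ij by blast
  qed
  also have "\<dots> = (\<Sum>q\<in>?q ` ?E. real_of_int (int_cost r q) / real_of_int (common_denom r))"
    by (subst sum.reindex[OF inj]) simp
  also have "\<dots> \<le> (\<Sum>q<?m. real_of_int (int_cost r q) / real_of_int (common_denom r))"
  proof (rule sum_mono2)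
    show "?q ` ?E \<subseteq> {..<?m}"
    proof
      fix q assume "q \<in> ?q ` ?E"
      then obtain i j where "(i, j) \<in> ?E" "q = pair_index r i j" by auto
      then show "q \<in> {..<?m}" using pair_index_less edge_bounds[OF assms] by simp
    qed
  qed (use int_cost_nonneg[OF assms] common_denom_pos[of r] in \<open>auto intro!: divide_nonneg_pos\<close>)
  finally show ?thesis by (simp add: int_cost_sum_def sum_divide_distrib)
qed

lemma input_size_eq_sum: "input_size xs = (\<Sum>q<length xs. bits (xs ! q))"
  by (simp add: input_size_def sum_list_sum_nth atLeast0LessThan)

section \<open>Integer representation of capped costs\<close>

lemma abs_nth_le_power_input_size:
  assumes "q < length xs"
  shows "\<bar>xs ! q\<bar> \<le> 2 ^ input_size xs"
proof -
  have "bits (xs ! q) \<le> input_size xs"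
    unfolding input_size_eq_sum by (rule member_le_sum) (use assms in auto)
  then have "(2::int) ^ (bits (xs ! q) - 1) \<le> 2 ^ input_size xs" by (intro power_increasing) auto
  then show ?thesis using abs_less_power_bits[of "xs ! q"] by linarith
qed

text \<open>Each factor is below 2 to its own bit length, and the lengths of distinct entries add up
  to at most the input size. This keeps the product of all denominators below
  \<open>base r\<close>.\<close>

lemma prod_nth_le_power_input_size:
  assumes "A \<subseteq> {..<length xs}"
  shows "(\<Prod>q\<in>A. \<bar>xs ! q\<bar>) \<le> 2 ^ input_size xs"
proof -
  have "(\<Prod>q\<in>A. \<bar>xs ! q\<bar>) \<le> (\<Prod>q\<in>A. 2 ^ bits (xs ! q))"
  proof (rule prod_mono)
    fix q
    have "(2::int) ^ (bits (xs ! q) - 1) \<le> 2 ^ bits (xs ! q)" by (intro power_increasing) auto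
    then show "0 \<le> \<bar>xs ! q\<bar> \<and> \<bar>xs ! q\<bar> \<le> 2 ^ bits (xs ! q)" using abs_less_power_bits[of "xs ! q"] by linarith
  qed
  also have "\<dots> = 2 ^ (\<Sum>q\<in>A. bits (xs ! q))" by (rule power_sum[symmetric])
  also have "\<dots> \<le> 2 ^ input_size xs"
    unfolding input_size_eq_sum using assms by (intro power_increasing sum_mono2) auto
  finally show ?thesis .
qed

lemma length_le_input_size: "length xs \<le> input_size xs"
proof -
  have "(\<Sum>q<length xs. 1) \<le> (\<Sum>q<length xs. bits (xs ! q))"
    by (rule sum_mono) (use bits_pos in \<open>simp add: Suc_le_eq\<close>)
  then show ?thesis by (simp add: input_size_eq_sum)
qed

text \<open>
  The exponent leaves room for \<open>k ^ t\<close>, where the number \<open>t\<close> of greedy steps is at most the square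
  of the input size; everything else in memory is below \<open>base r ^ 20\<close>.
\<close>
definition base :: "raw_instance \<Rightarrow> int" where
  "base r = 2 ^ size_of r"

definition capacity :: "raw_instance \<Rightarrow> int" where
  "capacity r = base r ^ ((size_of r)\<^sup>2 + 20)"

lemma size_of_bounds:
  assumes "valid r"
  shows "0 < num_centers r" "6 \<le> num_customers r" "2 \<le> num_open r" "3 * num_open r \<le> num_customers r"
    "num_centers r * num_customers r \<le> size_of r" "num_centers r \<le> size_of r"
    "num_customers r \<le> size_of r"
proof -
  note A = admissibleD[OF assms]
  show k: "2 \<le> num_open r" "3 * num_open r \<le> num_customers r" using A(5,6) by auto
  then show n: "6 \<le> num_customers r" by linarith
  show p: "0 < num_centers r" using A(8) by (auto simp: lessThan_empty_iff)
  show pn: "num_centers r * num_customers r \<le> size_of r"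
    using length_le_input_size[of "encode_instance r"] unfolding length_encode_instance by linarith
  have "num_centers r * 1 \<le> num_centers r * num_customers r" using n by (intro mult_left_mono) auto
  with pn show "num_centers r \<le> size_of r" by linarith
  have "1 * num_customers r \<le> num_centers r * num_customers r" using p by (intro mult_right_mono) auto
  with pn show "num_customers r \<le> size_of r" by linarith
qed

lemma less_base: "a \<le> size_of r \<Longrightarrow> int a < base r"
  unfolding base_def
  by (metis le_less_trans less_exp of_nat_less_iff of_nat_numeral of_nat_power)

lemma base_ge:
  assumes "valid r"
  shows "6 < base r" "int (num_centers r) < base r" "int (num_customers r) < base r"
    "int (num_open r) < base r" "int (num_centers r * num_customers r) < base r"
proof -
  note b = size_of_bounds[OF assms]
  have "int 6 < base r" "int (num_open r) < base r" using b by (intro less_base; linarith)+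
  then show "6 < base r" "int (num_open r) < base r" by auto
  show "int (num_centers r) < base r" "int (num_customers r) < base r"
    "int (num_centers r * num_customers r) < base r"
    using b by (intro less_base; simp)+
qed

lemma le_capacity:
  assumes "valid r" "d \<le> (size_of r)\<^sup>2 + 20" "z \<le> base r ^ d"
  shows "z \<le> capacity r"
  using assms(3) base_ge(1)[OF assms(1)] power_increasing[OF assms(2), of "base r"]
  unfolding capacity_def by linarith

lemma common_denom_le_base:
  assumes "valid r"
  shows "common_denom r \<le> base r"
proof -
  let ?m = "num_centers r * num_customers r"
  have "common_denom r = (\<Prod>q<?m. \<bar>encode_instance r ! (5 + 3 * q)\<bar>)"
    unfolding common_denom_def by (rule prod.cong) (use denom_pos[of _ r] in \<open>force simp: denom_def\<close>)+
  also have "\<dots> = (\<Prod>q\<in>(\<lambda>q. 5 + 3 * q) ` {..<?m}. \<bar>encode_instance r ! q\<bar>)"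
    by (subst prod.reindex) (auto intro: inj_onI)
  also have "\<dots> \<le> base r"
    unfolding base_def by (rule prod_nth_le_power_input_size) (auto simp: length_encode_instance)
  finally show ?thesis .
qed

lemma partial_denom_le_base:
  assumes "valid r" "l \<le> num_centers r * num_customers r"
  shows "0 < (\<Prod>q<l. denom r q)" "(\<Prod>q<l. denom r q) \<le> base r"
proof -
  show "0 < (\<Prod>q<l. denom r q)" using assms(2) by (intro prod_pos) (auto intro: denom_pos)
  have "(\<Prod>q<l. denom r q) \<le> common_denom r"
    unfolding common_denom_def using assms(2) denom_pos[of _ r]
    by (intro prod_mono2) (auto simp: less_imp_le int_one_le_iff_zero_less)
  then show "(\<Prod>q<l. denom r q) \<le> base r" using common_denom_le_base[OF assms(1)] by simp
qed

lemma int_cost_le: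
  assumes "valid r" "q < num_centers r * num_customers r"
  shows "int_cost r q \<le> base r ^ 2"
proof -
  have "\<bar>numer r q\<bar> \<le> base r"
    unfolding numer_def base_def
    by (rule abs_nth_le_power_input_size) (use assms in \<open>simp add: length_encode_instance\<close>)
  moreover have "common_denom r div denom r q \<le> base r"
    using zdiv_mono2[of "common_denom r" 1 "denom r q"] denom_pos[OF assms(2)] common_denom_pos[of r]
      common_denom_le_base[OF assms(1)] by simp
  moreover have "0 \<le> common_denom r div denom r q"
    using denom_pos[OF assms(2)] common_denom_pos[of r] by (simp add: pos_imp_zdiv_nonneg_iff)
  ultimately show ?thesis
    using base_ge(1)[OF assms(1)] unfolding int_cost_def power2_eq_square by (intro mult_mono) auto
qed

lemma partial_cost_sum_le:
  assumes "valid r" "l \<le> num_centers r * num_customers r"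
  shows "0 \<le> (\<Sum>q<l. int_cost r q)" "(\<Sum>q<l. int_cost r q) \<le> base r ^ 3"
proof -
  show "0 \<le> (\<Sum>q<l. int_cost r q)" using assms int_cost_nonneg by (intro sum_nonneg) auto
  have "(\<Sum>q<l. int_cost r q) \<le> int (card {..<l}) * base r ^ 2"
    using assms int_cost_le by (intro sum_bounded_above) auto
  also have "\<dots> \<le> base r * base r ^ 2"
    using of_nat_mono[OF assms(2), where 'a = int] base_ge(5)[OF assms(1)] by (intro mult_right_mono) auto
  finally show "(\<Sum>q<l. int_cost r q) \<le> base r ^ 3" by (simp add: power_numeral_reduce)
qed

text \<open>For \<open>N = n^2\<close>, in units of \<open>1 / (D n^2)\<close>, the start
  \<open>N\<close> stands for \<open>1 / D\<close>. Rounding the increment down keeps the growth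
  factor at most \<open>1 + 1 / N\<close>, and starting at \<open>N\<close> keeps the increment at
  least 1.\<close>

fun guess :: "nat \<Rightarrow> nat \<Rightarrow> int" where
  "guess N 0 = int N"
| "guess N (Suc q) = guess N q + guess N q div int N"

lemma guess_ge: "int N \<le> guess N q"
proof (induction q)
  case (Suc q)
  then have "0 \<le> guess N q div int N" by (cases "N = 0") (auto simp: pos_imp_zdiv_nonneg_iff)
  then show ?case using Suc by simp
qed simp

lemma guess_Suc_le_double: "guess N (Suc q) \<le> 2 * guess N q"
  using guess_ge[of N q] zdiv_mono2[of "guess N q" 1 "int N"] by (cases "N = 0") auto

lemma guess_Suc_le_factor:
  "0 < N \<Longrightarrow> real_of_int (guess N (Suc q)) \<le> real_of_int (guess N q) * (1 + 1 / real N)"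
  using real_of_int_div4[of "guess N q" "int N"]
  by (simp add: algebra_simps)

text \<open>The increments never decrease, so each of the next \<open>m\<close> is at least the
  current one.\<close>

lemma guess_growth:
  assumes "0 < N"
  shows "guess N q + int m * (guess N q div int N) \<le> guess N (q + m)"
proof -
  have mono: "guess N q \<le> guess N (q + m)" for m
  proof (induction m)
    case (Suc m)
    have "0 \<le> guess N (q + m) div int N"
      using assms guess_ge[of N "q + m"] by (simp add: pos_imp_zdiv_nonneg_iff)
    with Suc show ?case by simp
  qed simp
  show ?thesis
  proof (induction m)
    case (Suc m)
    have "guess N q div int N \<le> guess N (q + m) div int N"
      using assms mono by (intro zdiv_mono1) auto
    with Suc show ?case by (simp add: algebra_simps)
  qed simp
qed

text \<open>A guess \<open>g >= N\<close> has \<open>d = g div N >= 1\<close> and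
  \<open>g < N d + N <= 2 N d\<close>. Hence \<open>2 N\<close> increments of at least
  \<open>d\<close> double it.\<close>

lemma guess_exponential:
  assumes "0 < N"
  shows "2 ^ m \<le> guess N (2 * N * m)"
proof (induction m)
  case 0
  then show ?case using assms by simp
next
  case (Suc m)
  let ?g = "guess N (2 * N * m)"
  have "int N \<le> ?g" by (rule guess_ge)
  then have "1 \<le> ?g div int N" using assms zdiv_mono1[of "int N" ?g "int N"] by simp
  then have "int N * 1 \<le> int N * (?g div int N)" by (intro mult_left_mono) auto
  moreover have "?g < int N * (?g div int N) + int N"
    using assms by (metis mult_div_mod_eq add_strict_left_mono of_nat_0_less_iff pos_mod_bound)
  ultimately have "?g \<le> 2 * int N * (?g div int N)" by linarith
  then have "2 * ?g \<le> guess N (2 * N * m + 2 * N)"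
    using guess_growth[OF assms, of "2 * N * m" "2 * N"] by simp
  then show ?case using Suc by (simp add: algebra_simps)
qed

definition scaled_guess :: "raw_instance \<Rightarrow> int \<Rightarrow> real" where
  "scaled_guess r L = real_of_int L / (real_of_int (common_denom r) * (real (num_customers r))\<^sup>2)"

definition value_scale :: "raw_instance \<Rightarrow> int \<Rightarrow> real" where
  "value_scale r L = (2 * real (num_open r) + 1) * real (num_customers r) * real_of_int L"

text \<open>Multiplying \<open>(1 - 2 k / n) c / l\<close> by \<open>value_scale\<close> cancels the
  guess: the weights are the same for all guesses, and only the scaled cap \<open>n L\<close>
  changes.\<close>

definition weight_factor :: "raw_instance \<Rightarrow> int" where
  "weight_factor r = (2 * int (num_open r) + 1) * (int (num_customers r) - 2 * int (num_open r)) *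
     (int (num_customers r) * int (num_customers r))"

definition weight :: "raw_instance \<Rightarrow> nat \<Rightarrow> nat \<Rightarrow> int" where
  "weight r i j = int_cost r (pair_index r i j) * weight_factor r"

text \<open>The flag is 0 or 1, so one positivity test covers both the presence of the edge and the
  improvement. A non-edge could offer only the cap, which never improves an entry.\<close>

definition updated :: "raw_instance \<Rightarrow> nat \<Rightarrow> (int \<Rightarrow> int) \<Rightarrow> nat \<Rightarrow> int" where
  "updated r i m j =
     (if 0 < flag r (pair_index r i j) * (m (int j) - weight r i j) then weight r i j else m (int j))"

definition updated_total :: "raw_instance \<Rightarrow> nat \<Rightarrow> (int \<Rightarrow> int) \<Rightarrow> int" where
  "updated_total r i m = (\<Sum>j<num_customers r. updated r i m j)"

text \<open>
  The integers in memory are capped costs multiplied by \<^const>\<open>value_scale\<close>, which clears the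
  denominators \<open>2 k + 1\<close>, \<open>n\<close> and \<open>D\<close>, and the guess.
\<close>
definition represents :: "raw_instance \<Rightarrow> int \<Rightarrow> nat set \<Rightarrow> (int \<Rightarrow> int) \<Rightarrow> bool" where
  "represents r L C m \<longleftrightarrow> (\<forall>j<num_customers r.
     real_of_int (m (int j)) = value_scale r L * rcapped (instance_of r) (scaled_guess r L) C j)"

lemma scaled_guess_pos: "valid r \<Longrightarrow> 0 < L \<Longrightarrow> 0 < scaled_guess r L"
  using common_denom_pos[of r] size_of_bounds(2)[of r] by (auto simp: scaled_guess_def)

lemma value_scale_pos: "valid r \<Longrightarrow> 0 < L \<Longrightarrow> 0 < value_scale r L"
  using size_of_bounds(2)[of r] by (auto simp: value_scale_def intro!: mult_pos_pos)

lemma weight_nonneg: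
  assumes "valid r" "i < num_centers r" "j < num_customers r"
  shows "0 \<le> weight r i j"
  using int_cost_nonneg[OF assms(1) pair_index_less[OF assms(2,3)]] size_of_bounds(4)[OF assms(1)]
  by (auto simp: weight_def weight_factor_def intro!: mult_nonneg_nonneg)

lemma value_scale_capped_edge_cost:
  assumes r: "valid r" and L: "0 < L" and i: "i < num_centers r" and j: "j < num_customers r"
  shows "value_scale r L * capped_edge_cost (instance_of r) (scaled_guess r L) i j =
    (if (i, j) \<in> edges (instance_of r)
     then min (real (num_customers r) * real_of_int L) (real_of_int (weight r i j))
     else real (num_customers r) * real_of_int L)"
proof -
  define k where "k = real (num_open r)"
  define n where "n = real (num_customers r)"
  define D where "D = real_of_int (common_denom r)"
  define z where "z = real_of_int (int_cost r (pair_index r i j))"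
  define l where "l = real_of_int L"
  have pos: "0 < k" "0 < n" "0 < D" "0 < l"
    using size_of_bounds[OF r] common_denom_pos[of r] L by (auto simp: k_def n_def D_def l_def)
  have 1: "value_scale r L * (1 / (2 * k + 1)) = n * l"
    using pos by (simp add: value_scale_def k_def[symmetric] n_def[symmetric] l_def[symmetric])
  have 2: "value_scale r L * ((1 - 2 * k / n) * cost (instance_of r) i j / scaled_guess r L) =
      real_of_int (weight r i j)" if "(i, j) \<in> edges (instance_of r)"
  proof -
    have "(1 - 2 * k / n) * cost (instance_of r) i j / scaled_guess r L =
        (1 - 2 * k / n) * (z / D) / (l / (D * n\<^sup>2))"
      unfolding cost_pair_index[OF that i j] scaled_guess_def z_def D_def n_def l_def ..
    also have "\<dots> = (n - 2 * k) * n * z / l"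
      using pos by (simp add: field_simps power2_eq_square)
    finally have "value_scale r L * ((1 - 2 * k / n) * cost (instance_of r) i j / scaled_guess r L) =
        (2 * k + 1) * n * l * ((n - 2 * k) * n * z / l)"
      by (simp add: value_scale_def k_def n_def l_def)
    also have "\<dots> = z * ((2 * k + 1) * (n - 2 * k) * (n * n))"
      using pos by (simp add: field_simps)
    also have "\<dots> = real_of_int (weight r i j)"
      by (simp add: weight_def weight_factor_def k_def n_def z_def)
    finally show ?thesis .
  qed
  have 3: "value_scale r L * min a b = min (value_scale r L * a) (value_scale r L * b)" for a b
    using value_scale_pos[OF r L] by (simp add: min_mult_distrib_left)
  show ?thesis
    using 1 2 unfolding capped_edge_cost_def
    by (auto simp: 3 n_def k_def l_def)
qed

lemma represents_bounds:
  assumes "valid r" "0 < L" "finite C" "represents r L C m" "j < num_customers r"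
  shows "0 \<le> m (int j)" "m (int j) \<le> int (num_customers r) * L"
proof -
  let ?c = "rcapped (instance_of r) (scaled_guess r L) C j"
  note sp = value_scale_pos[OF assms(1,2)]
  have b: "0 \<le> ?c" "?c \<le> 1 / (2 * real (num_open r) + 1)"
    using rcapped_bounds[OF assms(1) scaled_guess_pos[OF assms(1,2)] assms(3), of j] by auto
  have m: "real_of_int (m (int j)) = value_scale r L * ?c" using assms(4,5) by (simp add: represents_def)
  have "0 \<le> real_of_int (m (int j))" using b sp m by simp
  then show "0 \<le> m (int j)" by linarith
  have "real_of_int (m (int j)) \<le> value_scale r L * (1 / (2 * real (num_open r) + 1))"
    unfolding m using b sp by (intro mult_left_mono) auto
  also have "\<dots> = real (num_customers r) * real_of_int L" by (simp add: value_scale_def)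
  finally have "real_of_int (m (int j)) \<le> real_of_int (int (num_customers r) * L)" by simp
  then show "m (int j) \<le> int (num_customers r) * L" by (simp only: of_int_le_iff)
qed

lemma represents_empty:
  assumes "valid r" "0 < L" "\<And>j. j < num_customers r \<Longrightarrow> m (int j) = int (num_customers r) * L"
  shows "represents r L {} m"
  using rcapped_empty[OF assms(1) scaled_guess_pos[OF assms(1,2)]] assms(3)
  by (auto simp: represents_def value_scale_def)

lemma represents_updated:
  assumes "valid r" "0 < L" "finite C" "represents r L C m" "i < num_centers r" "j < num_customers r"
  shows "real_of_int (updated r i m j) =
    value_scale r L * rcapped (instance_of r) (scaled_guess r L) (insert i C) j"
proof -
  note sp = value_scale_pos[OF assms(1,2)]
  have "value_scale r L * rcapped (instance_of r) (scaled_guess r L) (insert i C) j =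
      min (value_scale r L * capped_edge_cost (instance_of r) (scaled_guess r L) i j) (real_of_int (m (int j)))"
    using assms(4,6) sp
    by (simp add: rcapped_insert[OF assms(1) scaled_guess_pos[OF assms(1,2)] assms(3)]
        represents_def min_mult_distrib_left)
  also have "\<dots> = real_of_int (updated r i m j)"
  proof -
    \<comment> \<open>Entries never exceed the scaled cap, so comparing an entry with the uncapped
      weight gives the same minimum.\<close>
    have "real_of_int (m (int j)) \<le> real_of_int (int (num_customers r) * L)"
      using represents_bounds(2)[OF assms(1-4,6)] by (simp only: of_int_le_iff)
    then have le: "real_of_int (m (int j)) \<le> real (num_customers r) * real_of_int L" by simp
    show ?thesis
      unfolding value_scale_capped_edge_cost[OF assms(1,2,5,6)] updated_def flag_pair_index[OF assms(5,6)]
      using le by (auto simp: min_def simp del: instance_of_simps)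
  qed
  finally show ?thesis ..
qed

lemma represents_total:
  assumes "represents r L C m"
  shows "real_of_int (\<Sum>j<num_customers r. m (int j)) =
    value_scale r L * rtotal (instance_of r) (scaled_guess r L) C"
  using assms by (simp add: represents_def rtotal_def sum_distrib_left)

lemma represents_updated_total:
  assumes "valid r" "0 < L" "finite C" "represents r L C m" "i < num_centers r"
  shows "real_of_int (updated_total r i m) =
    value_scale r L * rtotal (instance_of r) (scaled_guess r L) (insert i C)"
  using represents_updated[OF assms]
  by (simp add: updated_total_def rtotal_def sum_distrib_left)

lemma updated_bounds:
  assumes "valid r" "i < num_centers r" "j < num_customers r" "0 \<le> m (int j)"
  shows "0 \<le> updated r i m j" "updated r i m j \<le> m (int j)"
  using weight_nonneg[OF assms(1-3)] assms(4) flag_pair_index[OF assms(2,3)]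
  by (auto simp: updated_def)

section \<open>The program\<close>

lemma capacity_bits: "poly_bounded size_of (\<lambda>r. bits (capacity r))"
proof (rule poly_bounded_mono)
  show "poly_bounded size_of (\<lambda>r. size_of r * ((size_of r)\<^sup>2 + 20) + 2)"
    by (intro poly_bounded_intros)
  fix r
  let ?d = "size_of r * ((size_of r)\<^sup>2 + 20)"
  have "capacity r = 2 ^ ?d" unfolding capacity_def base_def by (rule power_mult[symmetric])
  then have "bits (capacity r) \<le> Suc (?d + 1)" unfolding bits_le_Suc_iff by simp
  then show "bits (capacity r) \<le> ?d + 2" by simp
qed

interpretation km: poly_machine size_of capacity
  by unfold_locales (rule capacity_bits)

text \<open>
  \<open>vDen\<close> is the common denominator, \<open>vSum\<close> the sum of all costs in units of \<open>1 / vDen\<close>, and \<open>vGuess\<close>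
  the guess in units of \<open>1 / (vDen * n^2)\<close>. \<open>vCap\<close> is the array of scaled capped costs and \<open>vTot\<close> its
  sum; \<open>vSel\<close> marks the selected centers. The greedy loop runs while \<open>vLhs > vRhs\<close>.
\<close>
abbreviation (input) vDen :: nat where "vDen \<equiv> 2"
abbreviation (input) vIdx :: nat where "vIdx \<equiv> 3"
abbreviation (input) vSum :: nat where "vSum \<equiv> 4"
abbreviation (input) vGuess :: nat where "vGuess \<equiv> 5"
abbreviation (input) vRun :: nat where "vRun \<equiv> 6"
abbreviation (input) vCap :: nat where "vCap \<equiv> 7"
abbreviation (input) vSel :: nat where "vSel \<equiv> 8"
abbreviation (input) vLhs :: nat where "vLhs \<equiv> 9"
abbreviation (input) vRhs :: nat where "vRhs \<equiv> 10"
abbreviation (input) vTot :: nat where "vTot \<equiv> 11"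
abbreviation (input) vBest :: nat where "vBest \<equiv> 12"
abbreviation (input) vI :: nat where "vI \<equiv> 13"
abbreviation (input) vJ :: nat where "vJ \<equiv> 14"
abbreviation (input) vAcc :: nat where "vAcc \<equiv> 15"

definition pE :: aexp where "pE = Read 0 (Num 0)"
definition nE :: aexp where "nE = Read 0 (Num 1)"
definition kE :: aexp where "kE = Read 0 (Num 2)"
definition fieldE :: "int \<Rightarrow> aexp \<Rightarrow> aexp" where "fieldE d e = Read 0 (Add (Num d) (Mul (Num 3) e))"
definition pairE :: aexp where "pairE = Add (Mul (V vI) nE) (V vJ)"
definition int_costE :: "aexp \<Rightarrow> aexp" where
  "int_costE e = Mul (fieldE 4 e) (Div (V vDen) (fieldE 5 e))"
definition weightE :: aexp where
  "weightE = Mul (int_costE pairE)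
     (Mul (Mul (Add (Mul (Num 2) kE) (Num 1)) (Sub nE (Mul (Num 2) kE))) (Mul nE nE))"
definition improvesE :: aexp where
  "improvesE = Mul (fieldE 3 pairE) (Sub (Read vCap (V vJ)) weightE)"

text \<open>The accumulator \<open>vSum\<close> relies on memory being 0 initially, as does the
  output array in \<open>write_output\<close>.\<close>

definition prepare :: com where
  "prepare =
     Seq (Write vDen (Num 0) (Num 1))
    (Seq (For vIdx (Mul pE nE) (Write vDen (Num 0) (Mul (V vDen) (fieldE 5 (V vIdx)))))
    (Seq (For vIdx (Mul pE nE) (Write vSum (Num 0) (Add (V vSum) (int_costE (V vIdx)))))
    (Seq (Write vGuess (Num 0) (Mul nE nE))
         (Write vRun (Num 0) (Num 1)))))"

definition evaluate :: com where
  "evaluate =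
     Seq (Write vAcc (Num 0) (Num 0))
         (For vJ nE
            (If improvesE
              (Write vAcc (Num 0) (Add (V vAcc) weightE))
              (Write vAcc (Num 0) (Add (V vAcc) (Read vCap (V vJ))))))"

text \<open>The search for the minimum starts one above the current total. The strict comparison
  then accepts the first center even if no center lowers the total, so \<open>vBest\<close> is
  always set.\<close>

definition choose_best :: com where
  "choose_best =
     Seq (Write vTot (Num 0) (Add (V vTot) (Num 1)))
         (For vI pE
           (Seq evaluate
             (If (Sub (V vTot) (V vAcc))
               (Seq (Write vTot (Num 0) (V vAcc)) (Write vBest (Num 0) (V vI)))
               Skip)))"

text \<open>The chosen center is copied to \<open>vI\<close> because \<open>improvesE\<close> and
  \<open>weightE\<close> read the center there.\<close>

definition add_best :: com where
  "add_best =
     Seq (Write vSel (V vBest) (Num 1))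
    (Seq (Write vI (Num 0) (V vBest))
         (For vJ nE (If improvesE (Write vCap (V vJ) weightE) Skip)))"

text \<open>\<open>vLhs\<close> and \<open>vRhs\<close> carry \<open>n^2 (k - 1)^t\<close> and
  \<open>2 k (2 k + 1) k^t\<close>, the two sides of \<open>more_steps\<close>, and are kept up to
  date by one multiplication each.\<close>

definition run_greedy :: com where
  "run_greedy =
     Seq (For vJ nE (Write vCap (V vJ) (Mul nE (V vGuess))))
    (Seq (For vI pE (Write vSel (V vI) (Num 0)))
    (Seq (Write vLhs (Num 0) (Mul nE nE))
    (Seq (Write vRhs (Num 0) (Mul (Mul (Num 2) kE) (Add (Mul (Num 2) kE) (Num 1))))
    (Seq (Write vTot (Num 0) (Mul nE (Mul nE (V vGuess))))
         (While (Sub (V vLhs) (V vRhs))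
           (Seq (Write vLhs (Num 0) (Mul (V vLhs) (Sub kE (Num 1))))
           (Seq (Write vRhs (Num 0) (Mul (V vRhs) kE))
           (Seq choose_best add_best))))))))"

text \<open>The outer test says that the total exceeds \<open>1 - 1 / n^2\<close>, multiplied by
  \<open>n^2\<close> and \<open>value_scale\<close>; the inner one says that the guess exceeds the
  sum of all costs. The guess is advanced even in the last round, which is harmless: the output
  depends on \<open>vSel\<close> only.\<close>

definition try_guesses :: com where
  "try_guesses =
     While (V vRun)
       (Seq run_greedy
       (Seq (If (Sub (Mul (Mul nE nE) (V vTot))
                     (Mul (Mul (Mul (Add (Mul (Num 2) kE) (Num 1)) nE) (V vGuess))
                          (Sub (Mul nE nE) (Num 1))))
              (If (Sub (V vGuess) (Mul (Mul nE nE) (V vSum))) (Write vRun (Num 0) (Num 0)) Skip)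
              (Write vRun (Num 0) (Num 0)))
            (Write vGuess (Num 0) (Add (V vGuess) (Div (V vGuess) (Mul nE nE))))))"

definition write_output :: com where
  "write_output =
     For vI pE
       (If (Read vSel (V vI))
         (Seq (Write 1 (Num 0) (Add (V 1) (Num 1))) (Write 1 (V 1) (V vI)))
         Skip)"

definition kmedian_program :: com where
  "kmedian_program = Seq prepare (Seq try_guesses write_output)"

section \<open>Memory contents and the values of the expressions\<close>

definition same_except :: "nat set \<Rightarrow> memory \<Rightarrow> memory \<Rightarrow> bool" where
  "same_except A s0 s \<longleftrightarrow> (\<forall>b. b \<notin> A \<longrightarrow> s b = s0 b)"

definition has_input :: "raw_instance \<Rightarrow> memory \<Rightarrow> bool" where
  "has_input r s \<longleftrightarrow> valid r \<and> s 0 = input_memory (encode_instance r) 0"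

definition ready :: "raw_instance \<Rightarrow> memory \<Rightarrow> bool" where
  "ready r s \<longleftrightarrow> has_input r s \<and> s vDen 0 = common_denom r \<and> s vSum 0 = int_cost_sum r"

lemma has_input_cong: "has_input r s \<Longrightarrow> s' 0 = s 0 \<Longrightarrow> has_input r s'"
  by (simp add: has_input_def)

lemma ready_cong: "ready r s \<Longrightarrow> s' 0 = s 0 \<Longrightarrow> s' vDen = s vDen \<Longrightarrow> s' vSum = s vSum \<Longrightarrow> ready r s'"
  by (simp add: ready_def has_input_def)

lemma has_input_nth:
  assumes "has_input r s" "q < 3 + 3 * (num_centers r * num_customers r)"
  shows "s 0 (int q) = encode_instance r ! q"
proof -
  have "int q < int (length (encode_instance r))"
    using assms(2) unfolding length_encode_instance of_nat_less_iff .
  then show ?thesis using assms(1) by (simp add: has_input_def input_memory_def)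
qed

lemma aval_header:
  assumes "has_input r s"
  shows "aval pE s = int (num_centers r)" "aval nE s = int (num_customers r)" "aval kE s = int (num_open r)"
  using has_input_nth[OF assms, of 0] has_input_nth[OF assms, of 1] has_input_nth[OF assms, of 2]
    encode_instance_header[of r]
  by (simp_all add: pE_def nE_def kE_def)

lemma aval_field:
  assumes "has_input r s" "aval e s = int q" "q < num_centers r * num_customers r"
  shows "aval (fieldE 3 e) s = flag r q" "aval (fieldE 4 e) s = numer r q" "aval (fieldE 5 e) s = denom r q"
  using has_input_nth[OF assms(1), of "3 + 3 * q"] has_input_nth[OF assms(1), of "4 + 3 * q"]
    has_input_nth[OF assms(1), of "5 + 3 * q"] assms(2,3)
  by (simp_all add: fieldE_def flag_def numer_def denom_def)

lemma aval_int_cost: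
  assumes "has_input r s" "aval e s = int q" "q < num_centers r * num_customers r"
    "s vDen 0 = common_denom r"
  shows "aval (int_costE e) s = int_cost r q"
  using aval_field[OF assms(1-3)] assms(4) by (simp add: int_costE_def int_cost_def)

lemma aval_pair:
  assumes "has_input r s" "s vI 0 = int i" "s vJ 0 = int j"
  shows "aval pairE s = int (pair_index r i j)"
  using aval_header[OF assms(1)] assms(2,3) by (simp add: pairE_def pair_index_def)

lemma aval_weight:
  assumes "ready r s" "s vI 0 = int i" "s vJ 0 = int j" "i < num_centers r" "j < num_customers r"
  shows "aval weightE s = weight r i j"
    "aval improvesE s = flag r (pair_index r i j) * (s vCap (int j) - weight r i j)"
proof -
  have h: "has_input r s" "s vDen 0 = common_denom r" using assms(1) by (auto simp: ready_def)
  note q = pair_index_less[OF assms(4,5)]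
  note p = aval_pair[OF h(1) assms(2,3)]
  show w: "aval weightE s = weight r i j"
    using aval_int_cost[OF h(1) p q h(2)] aval_header[OF h(1)]
    by (simp add: weightE_def weight_def weight_factor_def)
  show "aval improvesE s = flag r (pair_index r i j) * (s vCap (int j) - weight r i j)"
    using aval_field(1)[OF h(1) p q] w assms(3) by (simp add: improvesE_def)
qed

lemma header_le_capacity:
  assumes "valid r"
  shows "int (num_centers r) \<le> capacity r" "int (num_customers r) \<le> capacity r"
    "int (num_centers r * num_customers r) \<le> capacity r" "1 \<le> capacity r"
  using base_ge[OF assms] by (auto intro!: le_capacity[OF assms, of 1])

section \<open>Common denominator and sum of the costs\<close>

lemma triple_denom_loop:
  "km.triple (\<lambda>r s0 s. s = s0 \<and> has_input r s \<and> s vDen 0 = 1)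
    (For vIdx (Mul pE nE) (Write vDen (Num 0) (Mul (V vDen) (fieldE 5 (V vIdx)))))
    (\<lambda>r s0 s. same_except {vDen, vIdx} s0 s \<and> s vDen 0 = common_denom r)"
proof -
  define Inv where "Inv r s0 l s \<longleftrightarrow> has_input r s \<and> l \<le> num_centers r * num_customers r \<and>
      same_except {vDen, vIdx} s0 s \<and> s vDen 0 = (\<Prod>q<l. denom r q)" for r s0 l s
  have "km.triple (\<lambda>r s0 s. Inv r s0 0 s)
    (For vIdx (Mul pE nE) (Write vDen (Num 0) (Mul (V vDen) (fieldE 5 (V vIdx)))))
    (\<lambda>r s0 s. Inv r s0 (num_centers r * num_customers r) s)"
  proof (rule km.triple_For)
    show "km.triple (\<lambda>r zl s. Inv r (fst zl) (snd zl) s \<and> s vIdx 0 = int (snd zl) \<and>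
        snd zl < num_centers r * num_customers r)
      (Write vDen (Num 0) (Mul (V vDen) (fieldE 5 (V vIdx))))
      (\<lambda>r zl s. Inv r (fst zl) (Suc (snd zl)) s \<and> s vIdx 0 = int (snd zl))"
    proof (rule km.triple_pre[OF km.triple_Write])
      fix r and zl :: "memory \<times> nat" and s
      assume *: "Inv r (fst zl) (snd zl) s \<and> s vIdx 0 = int (snd zl) \<and> snd zl < num_centers r * num_customers r"
      then have h: "has_input r s" and v: "valid r" by (auto simp: Inv_def has_input_def)
      have f: "aval (fieldE 5 (V vIdx)) s = denom r (snd zl)" using aval_field(3)[OF h, of "V vIdx"] * by simp
      have "\<bar>\<Prod>q<Suc (snd zl). denom r q\<bar> \<le> capacity r"
        using partial_denom_le_base[OF v, of "Suc (snd zl)"] * le_capacity[OF v, of 1] by simp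
      then show "\<bar>aval (Mul (V vDen) (fieldE 5 (V vIdx))) s\<bar> \<le> capacity r \<and>
          Inv r (fst zl) (Suc (snd zl)) (s(vDen := (s vDen)(aval (Num 0) s := aval (Mul (V vDen) (fieldE 5 (V vIdx))) s))) \<and>
          (s(vDen := (s vDen)(aval (Num 0) s := aval (Mul (V vDen) (fieldE 5 (V vIdx))) s))) vIdx 0 = int (snd zl)"
        using * f by (auto simp: Inv_def same_except_def has_input_def)
    qed
    show "aval (Mul pE nE) s = int (num_centers r * num_customers r) \<and>
        int (num_centers r * num_customers r) \<le> capacity r \<and> num_centers r * num_customers r \<le> size_of r"
      if "Inv r z l s" for r z l s
      using that aval_header[of r s] header_le_capacity[of r] size_of_bounds[of r]
      by (auto simp: Inv_def has_input_def)
    show "Inv r z l (s(vIdx := f))" if "Inv r z l s" for r z l s f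
      using that by (auto simp: Inv_def same_except_def has_input_def)
  qed
  then show ?thesis
    by (rule km.triple_conseq) (auto simp: Inv_def same_except_def common_denom_def)
qed

lemma triple_sum_loop:
  "km.triple (\<lambda>r s0 s. s = s0 \<and> has_input r s \<and> s vDen 0 = common_denom r \<and> s vSum 0 = 0)
    (For vIdx (Mul pE nE) (Write vSum (Num 0) (Add (V vSum) (int_costE (V vIdx)))))
    (\<lambda>r s0 s. same_except {vSum, vIdx} s0 s \<and> s vSum 0 = int_cost_sum r)"
proof -
  define Inv where "Inv r s0 l s \<longleftrightarrow> has_input r s \<and> l \<le> num_centers r * num_customers r \<and>
      s vDen 0 = common_denom r \<and>
      same_except {vSum, vIdx} s0 s \<and> s vSum 0 = (\<Sum>q<l. int_cost r q)" for r s0 l s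
  have "km.triple (\<lambda>r s0 s. Inv r s0 0 s)
    (For vIdx (Mul pE nE) (Write vSum (Num 0) (Add (V vSum) (int_costE (V vIdx)))))
    (\<lambda>r s0 s. Inv r s0 (num_centers r * num_customers r) s)"
  proof (rule km.triple_For)
    show "km.triple (\<lambda>r zl s. Inv r (fst zl) (snd zl) s \<and> s vIdx 0 = int (snd zl) \<and>
        snd zl < num_centers r * num_customers r)
      (Write vSum (Num 0) (Add (V vSum) (int_costE (V vIdx))))
      (\<lambda>r zl s. Inv r (fst zl) (Suc (snd zl)) s \<and> s vIdx 0 = int (snd zl))"
    proof (rule km.triple_pre[OF km.triple_Write])
      fix r and zl :: "memory \<times> nat" and s
      assume *: "Inv r (fst zl) (snd zl) s \<and> s vIdx 0 = int (snd zl) \<and> snd zl < num_centers r * num_customers r"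
      then have h: "has_input r s" and v: "valid r" by (auto simp: Inv_def has_input_def)
      have f: "aval (int_costE (V vIdx)) s = int_cost r (snd zl)"
        using aval_int_cost[OF h, of "V vIdx"] * by (simp add: Inv_def)
      have "\<bar>\<Sum>q<Suc (snd zl). int_cost r q\<bar> \<le> capacity r"
        using partial_cost_sum_le[OF v, of "Suc (snd zl)"] * le_capacity[OF v, of 3] by simp
      then show "\<bar>aval (Add (V vSum) (int_costE (V vIdx))) s\<bar> \<le> capacity r \<and>
          Inv r (fst zl) (Suc (snd zl)) (s(vSum := (s vSum)(aval (Num 0) s := aval (Add (V vSum) (int_costE (V vIdx))) s))) \<and>
          (s(vSum := (s vSum)(aval (Num 0) s := aval (Add (V vSum) (int_costE (V vIdx))) s))) vIdx 0 = int (snd zl)"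
        using * f by (auto simp: Inv_def same_except_def has_input_def)
    qed
    show "aval (Mul pE nE) s = int (num_centers r * num_customers r) \<and>
        int (num_centers r * num_customers r) \<le> capacity r \<and> num_centers r * num_customers r \<le> size_of r"
      if "Inv r z l s" for r z l s
      using that aval_header[of r s] header_le_capacity[of r] size_of_bounds[of r]
      by (auto simp: Inv_def has_input_def)
    show "Inv r z l (s(vIdx := f))" if "Inv r z l s" for r z l s f
      using that by (auto simp: Inv_def same_except_def has_input_def)
  qed
  then show ?thesis
    by (rule km.triple_conseq) (auto simp: Inv_def same_except_def int_cost_sum_def)
qed

lemma triple_prepare:
  "km.triple (\<lambda>r z s. has_input r s \<and> (\<forall>b. b \<noteq> 0 \<longrightarrow> s b = (\<lambda>_. 0))) prepare
    (\<lambda>r z s. ready r s \<and> s 1 = (\<lambda>_. 0) \<and> s vGuess 0 = guess ((num_customers r)\<^sup>2) 0 \<and> s vRun 0 = 1)"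
  unfolding prepare_def
proof (rule km.triple_pre, (rule km.triple_Seq km.triple_Write
      km.triple_call[OF triple_denom_loop] km.triple_call[OF triple_sum_loop])+, goal_cases)
  case (1 r z s)
  then have v: "valid r" by (auto simp: has_input_def)
  have n2: "int (num_customers r) * int (num_customers r) \<le> capacity r"
    using base_ge(3)[OF v] by (intro le_capacity[OF v, of 2]) (auto simp: power2_eq_square intro!: mult_mono)
  show ?case
    using 1 header_le_capacity(4)[OF v] n2
    by (auto simp: same_except_def ready_def has_input_def power2_eq_square
        aval_header[of r] simp del: aval.simps(2) intro!: has_input_cong)
qed

section \<open>A greedy step\<close>

text \<open>Guesses stay below \<open>base r ^ 6\<close>, so the scaled cap \<open>n L\<close> stays
  below \<open>base r ^ 7\<close>; greedy updates only lower the entries.\<close>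

definition small :: "raw_instance \<Rightarrow> (int \<Rightarrow> int) \<Rightarrow> bool" where
  "small r m \<longleftrightarrow> (\<forall>j<num_customers r. 0 \<le> m (int j) \<and> m (int j) \<le> base r ^ 7)"

lemma partial_sum_le_capacity:
  assumes "valid r" "l \<le> num_customers r" "\<And>j. j < l \<Longrightarrow> 0 \<le> g j \<and> g j \<le> base r ^ 7"
  shows "0 \<le> (\<Sum>j<l. g j)" "(\<Sum>j<l. g j) \<le> base r ^ 8"
proof -
  show "0 \<le> (\<Sum>j<l. g j)" using assms(3) by (intro sum_nonneg) auto
  have "(\<Sum>j<l. g j) \<le> int (card {..<l}) * base r ^ 7"
    using assms(3) by (intro sum_bounded_above) auto
  also have "\<dots> \<le> base r * base r ^ 7"
    using assms(2) base_ge(1,3)[OF assms(1)] by (intro mult_right_mono) auto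
  finally show "(\<Sum>j<l. g j) \<le> base r ^ 8" by (simp add: power_numeral_reduce)
qed

lemma small_updated:
  assumes "valid r" "small r m" "i < num_centers r" "j < num_customers r"
  shows "0 \<le> updated r i m j \<and> updated r i m j \<le> base r ^ 7"
  using assms updated_bounds[of r i j m] by (fastforce simp: small_def)

lemma small_updated_total:
  assumes "valid r" "small r m" "i < num_centers r"
  shows "0 \<le> updated_total r i m" "updated_total r i m \<le> (\<Sum>j<num_customers r. m (int j))"
    "updated_total r i m \<le> base r ^ 8"
proof -
  show "0 \<le> updated_total r i m" "updated_total r i m \<le> base r ^ 8"
    unfolding updated_total_def
    using partial_sum_le_capacity[OF assms(1) order_refl] small_updated[OF assms] by blast+
  show "updated_total r i m \<le> (\<Sum>j<num_customers r. m (int j))"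
    unfolding updated_total_def
    using updated_bounds(2)[OF assms(1,3)] assms(2) by (intro sum_mono) (auto simp: small_def)
qed

lemma triple_evaluate:
  "km.triple (\<lambda>r s0 s. s = s0 \<and> ready r s \<and> small r (s vCap) \<and> (\<exists>i<num_centers r. s vI 0 = int i))
    evaluate
    (\<lambda>r s0 s. same_except {vJ, vAcc} s0 s \<and> s vAcc 0 = updated_total r (nat (s0 vI 0)) (s0 vCap))"
proof -
  define Inv where "Inv r s0 l s \<longleftrightarrow> ready r s0 \<and> small r (s0 vCap) \<and> (\<exists>i<num_centers r. s0 vI 0 = int i) \<and>
      l \<le> num_customers r \<and> same_except {vJ, vAcc} s0 s \<and>
      s vAcc 0 = (\<Sum>j<l. updated r (nat (s0 vI 0)) (s0 vCap) j)" for r s0 l s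
  have "km.triple (\<lambda>r s0 s. Inv r s0 0 s)
    (For vJ nE (If improvesE
              (Write vAcc (Num 0) (Add (V vAcc) weightE))
              (Write vAcc (Num 0) (Add (V vAcc) (Read vCap (V vJ))))))
    (\<lambda>r s0 s. Inv r s0 (num_customers r) s)"
  proof (rule km.triple_For)
    show "km.triple (\<lambda>r zl s. Inv r (fst zl) (snd zl) s \<and> s vJ 0 = int (snd zl) \<and> snd zl < num_customers r)
      (If improvesE
              (Write vAcc (Num 0) (Add (V vAcc) weightE))
              (Write vAcc (Num 0) (Add (V vAcc) (Read vCap (V vJ)))))
      (\<lambda>r zl s. Inv r (fst zl) (Suc (snd zl)) s \<and> s vJ 0 = int (snd zl))"
    proof (rule km.triple_pre, (rule km.triple_If km.triple_Write)+, goal_cases)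
      case (1 r zl s)
      obtain s0 l where zl: "zl = (s0, l)" by (cases zl)
      from 1 obtain i where i: "i < num_centers r" "s0 vI 0 = int i" by (auto simp: Inv_def zl)
      from 1 have rdy: "ready r s0" and sm: "small r (s0 vCap)" and l: "l < num_customers r" "s vJ 0 = int l"
        and sx: "same_except {vJ, vAcc} s0 s" and acc: "s vAcc 0 = (\<Sum>j<l. updated r i (s0 vCap) j)"
        by (auto simp: Inv_def zl i)
      have v: "valid r" using rdy by (simp add: ready_def has_input_def)
      have rs: "ready r s" by (rule ready_cong[OF rdy]) (use sx in \<open>auto simp: same_except_def\<close>)
      have eq: "s vI = s0 vI" "s vCap = s0 vCap" using sx by (auto simp: same_except_def)
      note w = aval_weight[OF rs, of i l]
      have b: "\<bar>\<Sum>j<Suc l. updated r i (s0 vCap) j\<bar> \<le> capacity r"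
        using partial_sum_le_capacity[OF v, of "Suc l" "updated r i (s0 vCap)"] small_updated[OF v sm i(1)] l
          le_capacity[OF v, of 8] by simp
      show ?case
        using b w i l eq acc rdy sm sx
        by (auto simp: zl Inv_def same_except_def updated_def)
    qed
    show "aval nE s = int (num_customers r) \<and> int (num_customers r) \<le> capacity r \<and> num_customers r \<le> size_of r"
      if "Inv r z l s" for r z l s
    proof -
      have "has_input r s" using that by (auto simp: Inv_def same_except_def ready_def has_input_def)
      then show ?thesis using aval_header header_le_capacity size_of_bounds by (auto simp: has_input_def)
    qed
    show "Inv r z l (s(vJ := f))" if "Inv r z l s" for r z l s f
      using that by (auto simp: Inv_def same_except_def)
  qed
  from km.triple_Seq[OF this km.triple_Write] show ?thesis
    unfolding evaluate_def
  proof (rule km.triple_conseq, goal_cases)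
    case (1 r s0 s)
    then have "0 \<le> capacity r" using header_le_capacity(4)[of r] by (auto simp: ready_def has_input_def)
    then show ?case using 1 by (auto simp: Inv_def same_except_def)
  next
    case (2 r s0 s)
    then show ?case by (auto simp: Inv_def updated_total_def)
  qed
qed

lemma triple_choose_best:
  "km.triple (\<lambda>r s0 s. s = s0 \<and> ready r s \<and> small r (s vCap) \<and> s vTot 0 = (\<Sum>j<num_customers r. s vCap (int j)))
    choose_best
    (\<lambda>r s0 s. same_except {vTot, vBest, vI, vJ, vAcc} s0 s \<and>
      (\<exists>i<num_centers r. s vBest 0 = int i \<and> s vTot 0 = updated_total r i (s0 vCap) \<and>
        (\<forall>i'<num_centers r. updated_total r i (s0 vCap) \<le> updated_total r i' (s0 vCap))))"
proof -
  define A where "A = {vTot, vBest, vI, vJ, vAcc}"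
  define Inv where "Inv r s0 l s \<longleftrightarrow> ready r s0 \<and> small r (s0 vCap) \<and> l \<le> num_centers r \<and> same_except A s0 s \<and>
      (if l = 0 then s vTot 0 = (\<Sum>j<num_customers r. s0 vCap (int j)) + 1
       else \<exists>i<l. s vBest 0 = int i \<and> s vTot 0 = updated_total r i (s0 vCap) \<and>
        (\<forall>i'<l. updated_total r i (s0 vCap) \<le> updated_total r i' (s0 vCap)))" for r s0 l s
  have "km.triple (\<lambda>r s0 s. Inv r s0 0 s)
    (For vI pE
           (Seq evaluate
             (If (Sub (V vTot) (V vAcc))
               (Seq (Write vTot (Num 0) (V vAcc)) (Write vBest (Num 0) (V vI)))
               Skip)))
    (\<lambda>r s0 s. Inv r s0 (num_centers r) s)"
  proof (rule km.triple_For)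
    show "km.triple (\<lambda>r zl s. Inv r (fst zl) (snd zl) s \<and> s vI 0 = int (snd zl) \<and> snd zl < num_centers r)
      (Seq evaluate
             (If (Sub (V vTot) (V vAcc))
               (Seq (Write vTot (Num 0) (V vAcc)) (Write vBest (Num 0) (V vI)))
               Skip))
      (\<lambda>r zl s. Inv r (fst zl) (Suc (snd zl)) s \<and> s vI 0 = int (snd zl))"
    proof (rule km.triple_pre, (rule km.triple_Seq km.triple_If km.triple_Write km.triple_Skip
          km.triple_call[OF triple_evaluate])+, goal_cases)
      case (1 r zl s)
      obtain s0 l where zl: "zl = (s0, l)" by (cases zl)
      from 1 have rdy: "ready r s0" and sm: "small r (s0 vCap)" and l: "l < num_centers r" "s vI 0 = int l"
        and sx: "same_except A s0 s"
        by (auto simp: Inv_def zl)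
      have v: "valid r" using rdy by (simp add: ready_def has_input_def)
      have rs: "ready r s" by (rule ready_cong[OF rdy]) (use sx in \<open>auto simp: same_except_def A_def\<close>)
      have cap: "s vCap = s0 vCap" using sx by (auto simp: same_except_def A_def)
      have tc: "\<bar>updated_total r l (s0 vCap)\<bar> \<le> capacity r"
        using small_updated_total[OF v sm l(1)] le_capacity[OF v, of 8] by auto
      have lc: "int l \<le> capacity r" using l header_le_capacity(1)[OF v] by linarith
      let ?t = "updated_total r l (s0 vCap)"
      have le: "?t \<le> (\<Sum>j<num_customers r. s0 vCap (int j))" using small_updated_total[OF v sm l(1)] by simp
      have better: "Inv r s0 (Suc l) s''"
        if "?t < s vTot 0" "same_except A s0 s''" "s'' vTot 0 = ?t" "s'' vBest 0 = int l" for s''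
      proof -
        have "\<forall>i'<l. ?t \<le> updated_total r i' (s0 vCap)"
          using 1 that(1) by (fastforce simp: Inv_def zl split: if_splits)
        then show ?thesis using that rdy sm l by (auto simp: Inv_def less_Suc_eq)
      qed
      have keep: "Inv r s0 (Suc l) s''"
        if "\<not> ?t < s vTot 0" "same_except A s0 s''" "s'' vTot 0 = s vTot 0" "s'' vBest 0 = s vBest 0" for s''
      proof -
        have "l \<noteq> 0" using 1 that(1) le by (auto simp: Inv_def zl split: if_splits)
        then obtain i where "i < l" "s vBest 0 = int i" "s vTot 0 = updated_total r i (s0 vCap)"
          "\<forall>i'<l. updated_total r i (s0 vCap) \<le> updated_total r i' (s0 vCap)"
          using 1 by (auto simp: Inv_def zl)
        then show ?thesis using that rdy sm l by (auto simp: Inv_def less_Suc_eq intro!: exI[of _ i])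
      qed
      show ?case
      proof (intro conjI allI impI, goal_cases)
        case 1 show ?case by (rule rs)
      next
        case 2 show ?case using sm cap by simp
      next
        case 3 show ?case using l by blast
      next
        case (4 s')
        then have s': "same_except {vJ, vAcc} s s'" "s' vAcc 0 = ?t" using l cap by auto
        have e: "s' vTot = s vTot" "s' vBest = s vBest" "s' vI = s vI" using s'(1) by (auto simp: same_except_def)
        have sx': "same_except A s0 s'" using sx s'(1) by (auto simp: same_except_def A_def)
        show ?case
          using better[of "s'(vTot := (s' vTot)(0 := ?t), vBest := (s' vBest)(0 := int l))"] keep[of s']
            sx' s' e l tc lc
          by (auto simp: zl same_except_def A_def)
      qed
    qed
    show "aval pE s = int (num_centers r) \<and> int (num_centers r) \<le> capacity r \<and> num_centers r \<le> size_of r"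
      if "Inv r z l s" for r z l s
    proof -
      have "has_input r s" using that by (auto simp: Inv_def same_except_def ready_def has_input_def A_def)
      then show ?thesis using aval_header header_le_capacity size_of_bounds by (auto simp: has_input_def)
    qed
    show "Inv r z l (s(vI := f))" if "Inv r z l s" for r z l s f
      using that by (auto simp: Inv_def same_except_def A_def)
  qed
  from km.triple_Seq[OF this km.triple_Write] show ?thesis
    unfolding choose_best_def
  proof (rule km.triple_conseq, goal_cases)
    case (1 r s0 s)
    then have v: "valid r" by (auto simp: ready_def has_input_def)
    have "0 \<le> s vTot 0" "s vTot 0 \<le> base r ^ 8"
      using 1 partial_sum_le_capacity[OF v order_refl, of "\<lambda>j. s vCap (int j)"] by (auto simp: small_def)
    moreover have "base r ^ 8 + 1 \<le> base r ^ 9"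
    proof -
      have "1 \<le> base r ^ 8" using base_ge(1)[OF v] by (intro one_le_power) auto
      moreover have "2 * base r ^ 8 \<le> base r * base r ^ 8" using base_ge(1)[OF v] by (intro mult_right_mono) auto
      ultimately show ?thesis by (simp add: power_numeral_reduce)
    qed
    ultimately have "\<bar>s vTot 0 + 1\<bar> \<le> capacity r" using le_capacity[OF v, of 9 "s vTot 0 + 1"] by simp
    then show ?case using 1 by (auto simp: Inv_def same_except_def A_def)
  next
    case (2 r s0 s)
    then have "0 < num_centers r" using size_of_bounds(1)[of r] by (auto simp: Inv_def ready_def has_input_def)
    then show ?case using 2 by (auto simp: Inv_def A_def)
  qed
qed

lemma triple_add_best:
  "km.triple (\<lambda>r s0 s. s = s0 \<and> ready r s \<and> small r (s vCap) \<and> (\<exists>i<num_centers r. s vBest 0 = int i))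
    add_best
    (\<lambda>r s0 s. same_except {vCap, vSel, vI, vJ} s0 s \<and> s vSel = (s0 vSel)(s0 vBest 0 := 1) \<and>
      (\<forall>j<num_customers r. s vCap (int j) = updated r (nat (s0 vBest 0)) (s0 vCap) j))"
proof -
  \<comment> \<open>The array is updated in place: entries below \<open>l\<close> are new, and those
    from \<open>l\<close> on still hold the values that the comparison has to read.\<close>
  define Inv where "Inv r s0 l s \<longleftrightarrow> ready r s0 \<and> small r (s0 vCap) \<and> (\<exists>i<num_centers r. s0 vI 0 = int i) \<and>
      l \<le> num_customers r \<and> same_except {vCap, vJ} s0 s \<and>
      (\<forall>j<l. s vCap (int j) = updated r (nat (s0 vI 0)) (s0 vCap) j) \<and>
      (\<forall>j. l \<le> j \<longrightarrow> s vCap (int j) = s0 vCap (int j))" for r s0 l s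
  have "km.triple (\<lambda>r s0 s. Inv r s0 0 s)
    (For vJ nE (If improvesE (Write vCap (V vJ) weightE) Skip))
    (\<lambda>r s0 s. Inv r s0 (num_customers r) s)"
  proof (rule km.triple_For)
    show "km.triple (\<lambda>r zl s. Inv r (fst zl) (snd zl) s \<and> s vJ 0 = int (snd zl) \<and> snd zl < num_customers r)
      (If improvesE (Write vCap (V vJ) weightE) Skip)
      (\<lambda>r zl s. Inv r (fst zl) (Suc (snd zl)) s \<and> s vJ 0 = int (snd zl))"
    proof (rule km.triple_pre, (rule km.triple_If km.triple_Write km.triple_Skip)+, goal_cases)
      case (1 r zl s)
      obtain s0 l where zl: "zl = (s0, l)" by (cases zl)
      from 1 obtain i where i: "i < num_centers r" "s0 vI 0 = int i" by (auto simp: Inv_def zl)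
      from 1 have rdy: "ready r s0" and sm: "small r (s0 vCap)" and l: "l < num_customers r" "s vJ 0 = int l"
        and sx: "same_except {vCap, vJ} s0 s" and c: "s vCap (int l) = s0 vCap (int l)"
        by (auto simp: Inv_def zl i)
      have v: "valid r" using rdy by (simp add: ready_def has_input_def)
      have rs: "ready r s" by (rule ready_cong[OF rdy]) (use sx in \<open>auto simp: same_except_def\<close>)
      have eq: "s vI = s0 vI" using sx by (auto simp: same_except_def)
      note w = aval_weight[OF rs, of i l]
      have "\<bar>updated r i (s0 vCap) l\<bar> \<le> capacity r"
        using small_updated[OF v sm i(1) l(1)] le_capacity[OF v, of 7] by simp
      then show ?case
        using w i l eq c 1
        by (auto simp: zl Inv_def same_except_def updated_def less_Suc_eq)
    qed
    show "aval nE s = int (num_customers r) \<and> int (num_customers r) \<le> capacity r \<and> num_customers r \<le> size_of r"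
      if "Inv r z l s" for r z l s
    proof -
      have "has_input r s" using that by (auto simp: Inv_def same_except_def ready_def has_input_def)
      then show ?thesis using aval_header header_le_capacity size_of_bounds by (auto simp: has_input_def)
    qed
    show "Inv r z l (s(vJ := f))" if "Inv r z l s" for r z l s f
      using that by (auto simp: Inv_def same_except_def)
  qed
  then have loop: "km.triple (\<lambda>r s0 s. s = s0 \<and> Inv r s 0 s)
    (For vJ nE (If improvesE (Write vCap (V vJ) weightE) Skip))
    (\<lambda>r s0 s. Inv r s0 (num_customers r) s)"
    by (rule km.triple_pre) auto
  show ?thesis
    unfolding add_best_def
  proof (rule km.triple_pre, (rule km.triple_Seq km.triple_Write km.triple_call[OF loop])+, goal_cases)
    case (1 r s0 s)
    then obtain i where i: "i < num_centers r" "s0 vBest 0 = int i" and [simp]: "s = s0" by auto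
    have v: "valid r" using 1 by (auto simp: ready_def has_input_def)
    have ic: "int i \<le> capacity r" using i header_le_capacity(1)[OF v] by linarith
    have "ready r (s0(vSel := (s0 vSel)(int i := 1), vI := (s0 vI)(0 := int i)))"
      by (rule ready_cong[of r s0]) (use 1 in auto)
    then show ?case using 1 i ic header_le_capacity(4)[OF v]
      by (auto simp: Inv_def same_except_def)
  qed
qed

section \<open>A greedy run\<close>

lemma triple_reset_capped:
  "km.triple (\<lambda>r s0 s. s = s0 \<and> ready r s \<and> \<bar>int (num_customers r) * s vGuess 0\<bar> \<le> capacity r)
    (For vJ nE (Write vCap (V vJ) (Mul nE (V vGuess))))
    (\<lambda>r s0 s. same_except {vCap, vJ} s0 s \<and>
      (\<forall>j<num_customers r. s vCap (int j) = int (num_customers r) * s0 vGuess 0))"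
proof -
  define Inv where "Inv r s0 l s \<longleftrightarrow> ready r s0 \<and> \<bar>int (num_customers r) * s0 vGuess 0\<bar> \<le> capacity r \<and>
      l \<le> num_customers r \<and> same_except {vCap, vJ} s0 s \<and>
      (\<forall>j<l. s vCap (int j) = int (num_customers r) * s0 vGuess 0)" for r s0 l s
  have hs: "has_input r s" if "Inv r s0 l s" for r s0 l s
    using that by (auto simp: Inv_def same_except_def ready_def has_input_def)
  have "km.triple (\<lambda>r s0 s. Inv r s0 0 s)
    (For vJ nE (Write vCap (V vJ) (Mul nE (V vGuess)))) (\<lambda>r s0 s. Inv r s0 (num_customers r) s)"
  proof (rule km.triple_For)
    show "km.triple (\<lambda>r zl s. Inv r (fst zl) (snd zl) s \<and> s vJ 0 = int (snd zl) \<and> snd zl < num_customers r)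
      (Write vCap (V vJ) (Mul nE (V vGuess)))
      (\<lambda>r zl s. Inv r (fst zl) (Suc (snd zl)) s \<and> s vJ 0 = int (snd zl))"
    proof (rule km.triple_pre[OF km.triple_Write], goal_cases)
      case (1 r zl s)
      then show ?case using aval_header(2)[OF hs, of r "fst zl" "snd zl" s]
        by (auto simp: Inv_def same_except_def less_Suc_eq)
    qed
    show "aval nE s = int (num_customers r) \<and> int (num_customers r) \<le> capacity r \<and> num_customers r \<le> size_of r"
      if "Inv r z l s" for r z l s
      using hs[OF that] aval_header header_le_capacity size_of_bounds by (auto simp: has_input_def)
    show "Inv r z l (s(vJ := f))" if "Inv r z l s" for r z l s f
      using that by (auto simp: Inv_def same_except_def)
  qed
  then show ?thesis
    by (rule km.triple_conseq) (auto simp: Inv_def same_except_def)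
qed

lemma triple_reset_selected:
  "km.triple (\<lambda>r s0 s. s = s0 \<and> ready r s)
    (For vI pE (Write vSel (V vI) (Num 0)))
    (\<lambda>r s0 s. same_except {vSel, vI} s0 s \<and> (\<forall>i<num_centers r. s vSel (int i) = 0))"
proof -
  define Inv where "Inv r s0 l s \<longleftrightarrow> ready r s0 \<and> l \<le> num_centers r \<and> same_except {vSel, vI} s0 s \<and>
      (\<forall>i<l. s vSel (int i) = 0)" for r s0 l s
  have hs: "has_input r s" if "Inv r s0 l s" for r s0 l s
    using that by (auto simp: Inv_def same_except_def ready_def has_input_def)
  have "km.triple (\<lambda>r s0 s. Inv r s0 0 s)
    (For vI pE (Write vSel (V vI) (Num 0))) (\<lambda>r s0 s. Inv r s0 (num_centers r) s)"
  proof (rule km.triple_For)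
    show "km.triple (\<lambda>r zl s. Inv r (fst zl) (snd zl) s \<and> s vI 0 = int (snd zl) \<and> snd zl < num_centers r)
      (Write vSel (V vI) (Num 0))
      (\<lambda>r zl s. Inv r (fst zl) (Suc (snd zl)) s \<and> s vI 0 = int (snd zl))"
    proof (rule km.triple_pre[OF km.triple_Write], goal_cases)
      case (1 r zl s)
      then have "0 \<le> capacity r" using hs header_le_capacity(4)[of r] by (fastforce simp: has_input_def)
      then show ?case using 1 by (auto simp: Inv_def same_except_def less_Suc_eq)
    qed
    show "aval pE s = int (num_centers r) \<and> int (num_centers r) \<le> capacity r \<and> num_centers r \<le> size_of r"
      if "Inv r z l s" for r z l s
      using hs[OF that] aval_header header_le_capacity size_of_bounds by (auto simp: has_input_def)
    show "Inv r z l (s(vI := f))" if "Inv r z l s" for r z l s f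
      using that by (auto simp: Inv_def same_except_def)
  qed
  then show ?thesis
    by (rule km.triple_conseq) (auto simp: Inv_def same_except_def)
qed

definition greedy_state :: "raw_instance \<Rightarrow> int \<Rightarrow> nat \<Rightarrow> nat set \<Rightarrow> memory \<Rightarrow> bool" where
  "greedy_state r L t C s \<longleftrightarrow> greedy (instance_of r) (scaled_guess r L) t C \<and>
     C = {i. i < num_centers r \<and> 0 < s vSel (int i)} \<and> represents r L C (s vCap) \<and>
     s vTot 0 = (\<Sum>j<num_customers r. s vCap (int j))"

lemma greedy_state_start:
  assumes "valid r" "0 < L" "\<And>j. j < num_customers r \<Longrightarrow> s vCap (int j) = int (num_customers r) * L"
    "\<And>i. i < num_centers r \<Longrightarrow> s vSel (int i) = 0"
    "s vTot 0 = int (num_customers r) * (int (num_customers r) * L)"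
  shows "greedy_state r L 0 {} s"
  using assms represents_empty[OF assms(1,2)] greedy.start by (auto simp: greedy_state_def)

text \<open>Integer and real totals differ by the positive factor \<open>value_scale\<close>, so the
  minimum found by the program is a best choice in the sense of \<open>greedy\<close>.\<close>

lemma greedy_state_step:
  assumes st: "greedy_state r L t C s" and v: "valid r" and L: "0 < L" and i: "i < num_centers r"
    and best: "\<And>i'. i' < num_centers r \<Longrightarrow> updated_total r i (s vCap) \<le> updated_total r i' (s vCap)"
    and sel: "s' vSel = (s vSel)(int i := 1)"
    and cap: "\<And>j. j < num_customers r \<Longrightarrow> s' vCap (int j) = updated r i (s vCap) j"
    and tot: "s' vTot 0 = updated_total r i (s vCap)"
  shows "greedy_state r L (Suc t) (insert i C) s'"
proof -
  from st have g: "greedy (instance_of r) (scaled_guess r L) t C"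
    and C: "C = {i. i < num_centers r \<and> 0 < s vSel (int i)}" and rep: "represents r L C (s vCap)"
    by (auto simp: greedy_state_def)
  have fin: "finite C" using C by simp
  have "greedy (instance_of r) (scaled_guess r L) (Suc t) (insert i C)"
  proof (rule greedy.step[OF g])
    show "i \<in> centers (instance_of r)" using i by simp
    fix i' assume "i' \<in> centers (instance_of r)"
    then have i': "i' < num_centers r" by simp
    have "real_of_int (updated_total r i (s vCap)) \<le> real_of_int (updated_total r i' (s vCap))"
      using best[OF i'] by simp
    then show "rtotal (instance_of r) (scaled_guess r L) (insert i C) \<le>
        rtotal (instance_of r) (scaled_guess r L) (insert i' C)"
      using represents_updated_total[OF v L fin rep] i i' value_scale_pos[OF v L] by simp
  qed
  moreover have "insert i C = {i. i < num_centers r \<and> 0 < s' vSel (int i)}"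
    using C sel i by auto
  moreover have "represents r L (insert i C) (s' vCap)"
    using represents_updated[OF v L fin rep i] cap by (auto simp: represents_def)
  moreover have "s' vTot 0 = (\<Sum>j<num_customers r. s' vCap (int j))"
    using tot cap by (simp add: updated_total_def)
  ultimately show ?thesis by (simp add: greedy_state_def)
qed

lemma greedy_state_small:
  assumes "greedy_state r L t C s" "valid r" "0 < L" "L \<le> base r ^ 6"
  shows "small r (s vCap)"
proof -
  have "int (num_customers r) * L \<le> base r * base r ^ 6"
    using assms base_ge(1,3)[OF assms(2)] by (intro mult_mono) auto
  then have "int (num_customers r) * L \<le> base r ^ 7" by (simp add: power_numeral_reduce)
  moreover have "finite C" "represents r L C (s vCap)" using assms(1) by (auto simp: greedy_state_def)
  ultimately show ?thesis
    using represents_bounds[OF assms(2,3)] by (fastforce simp: small_def)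
qed

text \<open>This number bounds the rounds of the greedy loop and also the exponent of
  \<open>k\<close> in memory, for which \<open>capacity\<close> leaves room.\<close>

lemma steps_le_size:
  assumes "valid r" "more_steps (num_customers r) (num_open r) t"
  shows "Suc t \<le> (size_of r)\<^sup>2"
proof -
  have "int (Suc t) \<le> (int (num_customers r))\<^sup>2"
    using more_steps_size_bound[OF assms(1), of t] size_bound_bounds(2)[OF assms(1)] assms(2) by simp
  then have "int (Suc t) \<le> int ((num_customers r)\<^sup>2)" by simp
  then have "Suc t \<le> (num_customers r)\<^sup>2" by (simp only: of_nat_le_iff)
  also have "\<dots> \<le> (size_of r)\<^sup>2" using size_of_bounds(7)[OF assms(1)] by (intro power_mono) auto
  finally show ?thesis .
qed

lemma step_counters_le_capacity:
  assumes v: "valid r" and t: "t \<le> (size_of r)\<^sup>2"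
  shows "int ((num_customers r)\<^sup>2 * (num_open r - 1) ^ t) \<le> capacity r"
    "int (2 * num_open r * (2 * num_open r + 1) * num_open r ^ t) \<le> capacity r"
proof -
  note b = base_ge[OF v] size_of_bounds[OF v]
  have pow: "int a ^ t \<le> base r ^ t" if "int a \<le> base r" for a using that by (intro power_mono) auto
  have "int ((num_customers r)\<^sup>2 * (num_open r - 1) ^ t) =
      (int (num_customers r))\<^sup>2 * int (num_open r - 1) ^ t" by simp
  also have "\<dots> \<le> (base r)\<^sup>2 * base r ^ t"
    using b by (intro mult_mono power_mono pow) auto
  finally show "int ((num_customers r)\<^sup>2 * (num_open r - 1) ^ t) \<le> capacity r"
    using t by (intro le_capacity[OF v, of "2 + t"]) (auto simp: power_add power2_eq_square)
  have k: "2 * int (num_open r) + 1 \<le> base r" using b by linarith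
  have "int (2 * num_open r * (2 * num_open r + 1) * num_open r ^ t) =
      (2 * int (num_open r)) * (2 * int (num_open r) + 1) * int (num_open r) ^ t" by (simp add: algebra_simps)
  also have "\<dots> \<le> (base r * base r) * base r ^ t"
    using b k by (intro mult_mono pow) auto
  finally show "int (2 * num_open r * (2 * num_open r + 1) * num_open r ^ t) \<le> capacity r"
    using t by (intro le_capacity[OF v, of "2 + t"]) (auto simp: power_add power2_eq_square)
qed

abbreviation (input) greedy_vars :: "nat set" where
  "greedy_vars \<equiv> {vCap, vSel, vLhs, vRhs, vTot, vBest, vI, vJ, vAcc}"

definition greedy_inv :: "raw_instance \<Rightarrow> memory \<Rightarrow> nat \<Rightarrow> memory \<Rightarrow> bool" where
  "greedy_inv r s0 l s \<longleftrightarrow> ready r s0 \<and> 0 < s0 vGuess 0 \<and> s0 vGuess 0 \<le> base r ^ 6 \<and>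
     same_except greedy_vars s0 s \<and>
     (\<exists>t C. greedy_state r (s0 vGuess 0) t C s \<and>
       s vLhs 0 = int ((num_customers r)\<^sup>2 * (num_open r - 1) ^ t) \<and>
       s vRhs 0 = int (2 * num_open r * (2 * num_open r + 1) * num_open r ^ t) \<and>
       (\<forall>u<t. more_steps (num_customers r) (num_open r) u) \<and> l = (size_of r)\<^sup>2 + 1 - t)"

lemma triple_greedy_loop:
  "km.triple (\<lambda>r s0 s. \<exists>l \<le> (size_of r)\<^sup>2 + 1. greedy_inv r s0 l s)
    (While (Sub (V vLhs) (V vRhs))
           (Seq (Write vLhs (Num 0) (Mul (V vLhs) (Sub kE (Num 1))))
           (Seq (Write vRhs (Num 0) (Mul (V vRhs) kE))
           (Seq choose_best add_best))))
    (\<lambda>r s0 s. \<exists>l. greedy_inv r s0 l s \<and> \<not> 0 < aval (Sub (V vLhs) (V vRhs)) s)"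
proof (rule km.triple_While)
  show "poly_bounded size_of (\<lambda>r. (size_of r)\<^sup>2 + 1)" by (intro poly_bounded_intros)
  show "km.triple (\<lambda>r zl s. greedy_inv r (fst zl) (snd zl) s \<and> 0 < aval (Sub (V vLhs) (V vRhs)) s)
     (Seq (Write vLhs (Num 0) (Mul (V vLhs) (Sub kE (Num 1))))
           (Seq (Write vRhs (Num 0) (Mul (V vRhs) kE))
           (Seq choose_best add_best)))
     (\<lambda>r zl s. \<exists>l' < snd zl. greedy_inv r (fst zl) l' s)"
  proof (rule km.triple_pre, (rule km.triple_Seq km.triple_Write km.triple_call[OF triple_choose_best]
        km.triple_call[OF triple_add_best])+, goal_cases)
    case (1 r zl s)
    obtain s0 l where zl: "zl = (s0, l)" by (cases zl)
    define L where "L = s0 vGuess 0"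
    from 1 obtain t C where rdy: "ready r s0" and L: "0 < L" "L \<le> base r ^ 6"
      and sx: "same_except greedy_vars s0 s" and gs: "greedy_state r L t C s"
      and lhs: "s vLhs 0 = int ((num_customers r)\<^sup>2 * (num_open r - 1) ^ t)"
      and rhs: "s vRhs 0 = int (2 * num_open r * (2 * num_open r + 1) * num_open r ^ t)"
      and more: "\<forall>u<t. more_steps (num_customers r) (num_open r) u" and l: "l = (size_of r)\<^sup>2 + 1 - t"
      by (auto simp: greedy_inv_def zl L_def)
    have v: "valid r" using rdy by (simp add: ready_def has_input_def)
    have "int (2 * num_open r * (2 * num_open r + 1) * num_open r ^ t) <
        int ((num_customers r)\<^sup>2 * (num_open r - 1) ^ t)"
      using 1 lhs rhs by simp
    then have mt: "more_steps (num_customers r) (num_open r) t"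
      unfolding of_nat_less_iff more_steps_def .
    note tX = steps_le_size[OF v mt]
    have k: "int (num_open r - 1) = int (num_open r) - 1" using size_of_bounds(3)[OF v] by simp
    define a where "a = int ((num_customers r)\<^sup>2 * (num_open r - 1) ^ Suc t)"
    define b where "b = int (2 * num_open r * (2 * num_open r + 1) * num_open r ^ Suc t)"
    have ab: "\<bar>a\<bar> \<le> capacity r" "\<bar>b\<bar> \<le> capacity r"
      using step_counters_le_capacity[OF v tX] by (simp_all add: a_def b_def)
    have rs: "ready r s" by (rule ready_cong[OF rdy]) (use sx in \<open>auto simp: same_except_def\<close>)
    then have h: "has_input r s" by (simp add: ready_def)
    have e1: "aval (Mul (V vLhs) (Sub kE (Num 1))) s = a"
      using lhs aval_header(3)[OF h] k by (simp add: a_def algebra_simps)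
    define s1 where "s1 = s(vLhs := (s vLhs)(0 := a))"
    have h1: "has_input r s1" using h by (simp add: s1_def has_input_def)
    have e2: "aval (Mul (V vRhs) kE) s1 = b"
      using rhs aval_header(3)[OF h1] by (simp add: b_def s1_def algebra_simps)
    define s2 where "s2 = s1(vRhs := (s1 vRhs)(0 := b))"
    have rs2: "ready r s2" by (rule ready_cong[OF rs]) (auto simp: s2_def s1_def)
    have eq2: "s2 vCap = s vCap" "s2 vTot = s vTot" "s2 vSel = s vSel" by (auto simp: s2_def s1_def)
    have sm: "small r (s2 vCap)" using greedy_state_small[OF gs v L] by (simp add: eq2)
    have tot: "s2 vTot 0 = (\<Sum>j<num_customers r. s2 vCap (int j))" using gs by (simp add: eq2 greedy_state_def)
    have "ready r s3 \<and> small r (s3 vCap) \<and> (\<exists>i<num_centers r. s3 vBest 0 = int i) \<and>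
        (\<forall>s4. same_except {vCap, vSel, vI, vJ} s3 s4 \<and> s4 vSel = (s3 vSel)(s3 vBest 0 := 1) \<and>
            (\<forall>j<num_customers r. s4 vCap (int j) = updated r (nat (s3 vBest 0)) (s3 vCap) j) \<longrightarrow>
          (\<exists>l' < l. greedy_inv r s0 l' s4))"
      if s3: "same_except {vTot, vBest, vI, vJ, vAcc} s2 s3"
        and i: "i < num_centers r" "s3 vBest 0 = int i" "s3 vTot 0 = updated_total r i (s2 vCap)"
        and best: "\<forall>i'<num_centers r. updated_total r i (s2 vCap) \<le> updated_total r i' (s2 vCap)" for s3 i
    proof -
      have eq3: "s3 vCap = s vCap" "s3 vSel = s vSel" "s3 vLhs = s2 vLhs" "s3 vRhs = s2 vRhs"
        using s3 eq2 by (auto simp: same_except_def)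
      have rs3: "ready r s3" by (rule ready_cong[OF rs2]) (use s3 in \<open>auto simp: same_except_def\<close>)
      have "\<exists>l' < l. greedy_inv r s0 l' s4"
        if s4: "same_except {vCap, vSel, vI, vJ} s3 s4" "s4 vSel = (s3 vSel)(s3 vBest 0 := 1)"
          "\<forall>j<num_customers r. s4 vCap (int j) = updated r (nat (s3 vBest 0)) (s3 vCap) j" for s4
      proof -
        have "s4 vTot = s3 vTot" "s4 vLhs = s2 vLhs" "s4 vRhs = s2 vRhs"
          using s4(1) eq3 by (auto simp: same_except_def)
        then have eq4: "s4 vTot 0 = updated_total r i (s vCap)" "s4 vLhs 0 = a" "s4 vRhs 0 = b"
          using i eq2 by (auto simp: s2_def s1_def)
        have "greedy_state r L (Suc t) (insert i C) s4"
          by (rule greedy_state_step[OF gs v L(1) i(1)]) (use best s4 i eq2 eq3 eq4 in auto)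
        moreover have "same_except greedy_vars s0 s4"
          using sx s3 s4(1) by (auto simp: same_except_def s2_def s1_def)
        moreover have "\<forall>u<Suc t. more_steps (num_customers r) (num_open r) u"
          using more mt by (auto simp: less_Suc_eq)
        ultimately have "greedy_inv r s0 ((size_of r)\<^sup>2 + 1 - Suc t) s4"
          unfolding greedy_inv_def using rdy L eq4 by (auto simp: L_def a_def b_def)
        \<comment> \<open>The subtraction is truncated; the measure really drops because
          \<open>steps_le_size\<close> gives \<open>Suc t <= (size_of r)^2\<close> while the loop
          test holds.\<close>
        moreover have "(size_of r)\<^sup>2 + 1 - Suc t < l" using tX l by simp
        ultimately show ?thesis by blast
      qed
      then show ?thesis using rs3 sm eq2 eq3 i by auto
    qed
    then have "\<forall>s3. same_except {vTot, vBest, vI, vJ, vAcc} s2 s3 \<and>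
        (\<exists>i<num_centers r. s3 vBest 0 = int i \<and> s3 vTot 0 = updated_total r i (s2 vCap) \<and>
          (\<forall>i'<num_centers r. updated_total r i (s2 vCap) \<le> updated_total r i' (s2 vCap))) \<longrightarrow>
        (ready r s3 \<and> small r (s3 vCap) \<and> (\<exists>i<num_centers r. s3 vBest 0 = int i)) \<and>
        (\<forall>s4. same_except {vCap, vSel, vI, vJ} s3 s4 \<and> s4 vSel = (s3 vSel)(s3 vBest 0 := 1) \<and>
            (\<forall>j<num_customers r. s4 vCap (int j) = updated r (nat (s3 vBest 0)) (s3 vCap) j) \<longrightarrow>
          (\<exists>l' < l. greedy_inv r s0 l' s4))"
      by blast
    then show ?case
      unfolding e1 aval.simps(1)[of 0] s1_def[symmetric] e2 s2_def[symmetric] zl fst_conv snd_conv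
      using ab rs2 sm tot by simp
  qed
qed

lemma triple_run_greedy:
  "km.triple (\<lambda>r s0 s. s = s0 \<and> ready r s \<and> 0 < s vGuess 0 \<and> s vGuess 0 \<le> base r ^ 6)
    run_greedy
    (\<lambda>r s0 s. same_except greedy_vars s0 s \<and>
      (\<exists>t C. greedy_state r (s0 vGuess 0) t C s \<and> last_step (num_customers r) (num_open r) t))"
proof -
  have loop: "km.triple (\<lambda>r s0 s. greedy_inv r s0 ((size_of r)\<^sup>2 + 1) s)
    (While (Sub (V vLhs) (V vRhs))
           (Seq (Write vLhs (Num 0) (Mul (V vLhs) (Sub kE (Num 1))))
           (Seq (Write vRhs (Num 0) (Mul (V vRhs) kE))
           (Seq choose_best add_best))))
    (\<lambda>r s0 s. same_except greedy_vars s0 s \<and>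
      (\<exists>t C. greedy_state r (s0 vGuess 0) t C s \<and> last_step (num_customers r) (num_open r) t))"
  proof (rule km.triple_conseq[OF triple_greedy_loop], goal_cases)
    case (1 r s0 s)
    then show ?case by blast
  next
    case (2 r s0 s)
    then obtain t C where sx: "same_except greedy_vars s0 s" and gs: "greedy_state r (s0 vGuess 0) t C s"
      and "\<not> int (2 * num_open r * (2 * num_open r + 1) * num_open r ^ t) <
        int ((num_customers r)\<^sup>2 * (num_open r - 1) ^ t)"
      and more: "\<forall>u<t. more_steps (num_customers r) (num_open r) u"
      by (auto simp: greedy_inv_def)
    then have "last_step (num_customers r) (num_open r) t"
      unfolding of_nat_less_iff last_step_def more_steps_def by blast
    with sx gs show ?case by blast
  qed
  show ?thesis
    unfolding run_greedy_def
  proof (rule km.triple_pre, rule km.triple_Seq[OF km.triple_Seq[OF km.triple_Seq[OF km.triple_Seq[OF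
          km.triple_Seq[OF loop km.triple_Write] km.triple_Write] km.triple_Write]
          km.triple_call[OF triple_reset_selected]] km.triple_call[OF triple_reset_capped]], goal_cases)
    case (1 r s0 s)
    define L where "L = s0 vGuess 0"
    define n where "n = int (num_customers r)"
    from 1 have s: "s = s0" and rdy: "ready r s0" and L: "0 < L" "L \<le> base r ^ 6" by (auto simp: L_def)
    have v: "valid r" using rdy by (simp add: ready_def has_input_def)
    note b = base_ge[OF v]
    have n: "0 \<le> n" "n \<le> base r" using b by (auto simp: n_def)
    have nL: "n * L \<le> base r ^ 7"
      using mult_mono[OF n(2) L(2)] b L by (simp add: power_numeral_reduce)
    have nnL: "n * (n * L) \<le> base r ^ 8"
      using mult_mono[OF n(2) nL] b L n by (simp add: power_numeral_reduce)
    have c: "\<bar>n * L\<bar> \<le> capacity r" "\<bar>n * (n * L)\<bar> \<le> capacity r"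
      using nL nnL n L le_capacity[OF v, of 7 "n * L"] le_capacity[OF v, of 8 "n * (n * L)"] by auto
    note c0 = step_counters_le_capacity[OF v, of 0]
    have "\<bar>n * n\<bar> \<le> capacity r \<and> \<bar>2 * int (num_open r) * (2 * int (num_open r) + 1)\<bar> \<le> capacity r"
      using c0 by (simp add: n_def power2_eq_square algebra_simps)
    note c = c this
    have fin: "greedy_inv r s0 ((size_of r)\<^sup>2 + 1)
        (s2(vLhs := (s2 vLhs)(0 := n * n), vRhs := (s2 vRhs)(0 := 2 * int (num_open r) * (2 * int (num_open r) + 1)),
          vTot := (s2 vTot)(0 := n * (n * L))))"
      if s1: "same_except {vCap, vJ} s0 s1" "\<forall>j<num_customers r. s1 vCap (int j) = n * L"
        and s2: "same_except {vSel, vI} s1 s2" "\<forall>i<num_centers r. s2 vSel (int i) = 0" for s1 s2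
    proof -
      let ?s = "s2(vLhs := (s2 vLhs)(0 := n * n), vRhs := (s2 vRhs)(0 := 2 * int (num_open r) * (2 * int (num_open r) + 1)),
          vTot := (s2 vTot)(0 := n * (n * L)))"
      have "s2 vCap = s1 vCap" using s2(1) by (auto simp: same_except_def)
      then have "greedy_state r L 0 {} ?s"
        using s1(2) s2(2) by (intro greedy_state_start[OF v L(1)]) (auto simp: n_def)
      moreover have "same_except greedy_vars s0 ?s" using s1(1) s2(1) by (auto simp: same_except_def)
      ultimately show ?thesis
        using rdy L unfolding greedy_inv_def
        by (auto simp: L_def n_def power2_eq_square algebra_simps intro!: exI[of _ "0::nat"] exI[of _ "{}"])
    qed
    have "ready r s1 \<and> (\<forall>s2. same_except {vSel, vI} s1 s2 \<and> (\<forall>i<num_centers r. s2 vSel (int i) = 0) \<longrightarrow>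
        ready r s2 \<and> s2 vGuess 0 = L)" if s1: "same_except {vCap, vJ} s0 s1" for s1
    proof -
      have r1: "ready r s1" by (rule ready_cong[OF rdy]) (use s1 in \<open>auto simp: same_except_def\<close>)
      have "ready r s2" if "same_except {vSel, vI} s1 s2" for s2
        by (rule ready_cong[OF r1]) (use that in \<open>auto simp: same_except_def\<close>)
      moreover have "s2 vGuess = s0 vGuess" if "same_except {vSel, vI} s1 s2" for s2
        using that s1 by (auto simp: same_except_def)
      ultimately show ?thesis using r1 by (auto simp: L_def)
    qed
    note rr = this
    have hdr: "aval nE (s2(x := y)) = n" "aval kE (s2(x := y)) = int (num_open r)"
      "aval nE s2 = n" "aval kE s2 = int (num_open r)"
      if "ready r s2" "x \<noteq> 0" for s2 :: memory and x y
    proof -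
      have "has_input r (s2(x := y))" "has_input r s2" using that by (auto simp: ready_def has_input_def)
      then show "aval nE (s2(x := y)) = n" "aval kE (s2(x := y)) = int (num_open r)"
        "aval nE s2 = n" "aval kE s2 = int (num_open r)"
        using aval_header by (auto simp: n_def)
    qed
    show ?case unfolding s
    proof (intro conjI allI impI, goal_cases)
      case 1 show ?case using rdy by simp
    next
      case 2 show ?case using c(1) by (simp add: n_def L_def)
    next
      case (3 s1) then show ?case using rr by blast
    next
      case (4 s1 s2)
      then have "ready r s2" using rr by blast
      then show ?case using c hdr[of s2 1] by simp
    next
      case (5 s1 s2)
      then have "ready r s2" using rr by blast
      then show ?case using c hdr[of s2] by simp
    next
      case (6 s1 s2)
      then have *: "ready r s2" "s2 vGuess 0 = L" using rr by blast+
      have "ready r (s2(vLhs := f))" for f by (rule ready_cong[OF *(1)]) auto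
      then show ?case using c hdr * by simp
    next
      case (7 s1 s2)
      then have *: "ready r s2" "s2 vGuess 0 = L" using rr by blast+
      have **: "ready r (s2(vLhs := f))" for f by (rule ready_cong[OF *(1)]) auto
      show ?case using fin[of s1 s2] 7 hdr[OF *(1)] hdr(3,4)[OF *(1), of 1] hdr[OF **] * s by (simp add: n_def L_def)
    qed
  qed
qed

section \<open>Searching for the LP optimum\<close>

lemma guess_mono: "q \<le> q' \<Longrightarrow> guess N q \<le> guess N q'"
proof (cases "N = 0")
  case True
  have "guess 0 q = 0" for q by (induction q) auto
  then show ?thesis using True by simp
next
  case False
  assume "q \<le> q'"
  have "0 \<le> guess N q div int N" using False guess_ge[of N q] by (simp add: pos_imp_zdiv_nonneg_iff)
  then have "0 \<le> int (q' - q) * (guess N q div int N)" by simp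
  then show ?thesis using guess_growth[of N q "q' - q"] False \<open>q \<le> q'\<close> by simp
qed

text \<open>The search goes on only while the guess is at most \<open>n^2\<close> times the scaled
  sum of costs, which is at most \<open>base r ^ 5\<close>. Exponential growth bounds the index of
  such a guess, and one more step at most doubles its value.\<close>

lemma guess_bounds:
  assumes v: "valid r" and prev: "0 < q \<Longrightarrow> guess ((num_customers r)\<^sup>2) (q - 1) \<le> (int (num_customers r))\<^sup>2 * int_cost_sum r"
  shows "q \<le> 12 * (size_of r) ^ 3" "guess ((num_customers r)\<^sup>2) q \<le> base r ^ 6"
proof -
  define N where "N = (num_customers r)\<^sup>2"
  define X where "X = size_of r"
  note b = base_ge[OF v] size_of_bounds[OF v]
  have N0: "0 < N" using b by (auto simp: N_def)
  have Nb: "int N \<le> base r ^ 2" using b by (simp add: N_def power_mono)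
  have "int_cost_sum r \<le> base r ^ 3" "0 \<le> int_cost_sum r"
    using partial_cost_sum_le[OF v order_refl] by (simp_all add: int_cost_sum_def)
  then have "int N * int_cost_sum r \<le> base r ^ 2 * base r ^ 3"
    using Nb by (intro mult_mono) auto
  then have NS: "(int (num_customers r))\<^sup>2 * int_cost_sum r \<le> base r ^ 5"
    by (simp add: N_def power_add[symmetric])
  have X1: "1 \<le> X" "num_customers r \<le> X" using b by (auto simp: X_def)
  show "q \<le> 12 * (size_of r) ^ 3"
  proof (cases "q = 0")
    case False
    \<comment> \<open>Since \<open>base r ^ 5 = 2 ^ (5 X)\<close>, the guess with index
      \<open>2 N (5 X + 1)\<close> is already too large; \<open>N <= X^2\<close> and
      \<open>5 X + 1 <= 6 X\<close> then give the constant 12.\<close>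
    let ?q = "2 * N * (5 * X + 1)"
    have "q - 1 < ?q"
    proof (rule ccontr)
      assume "\<not> q - 1 < ?q"
      then have "guess N ?q \<le> guess N (q - 1)" by (intro guess_mono) auto
      also have "\<dots> \<le> base r ^ 5" using prev False NS by (simp add: N_def)
      finally have "guess N ?q \<le> 2 ^ (5 * X)" by (simp add: base_def X_def power_mult[symmetric] mult.commute)
      then have "(2::int) ^ (5 * X + 1) \<le> 2 ^ (5 * X)" using guess_exponential[OF N0, of "5 * X + 1"] by linarith
      then show False by simp
    qed
    then have "q \<le> ?q" by simp
    also have "\<dots> \<le> 2 * X\<^sup>2 * (6 * X)"
      unfolding N_def using X1 by (intro mult_mono power_mono) auto
    also have "\<dots> = 12 * X ^ 3" by (simp add: power_numeral_reduce)
    finally show ?thesis by (simp add: X_def)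
  qed simp
  have "guess N q \<le> 2 * base r ^ 5"
  proof (cases q)
    case 0
    have "base r ^ 2 \<le> base r ^ 5" using b by (intro power_increasing) auto
    moreover have "0 \<le> base r ^ 5" using b by simp
    ultimately show ?thesis using 0 Nb by (simp only: guess.simps)
  next
    case (Suc q')
    then show ?thesis using guess_Suc_le_double[of N q'] prev NS by (simp add: N_def)
  qed
  also have "\<dots> \<le> base r * base r ^ 5" using b by (intro mult_right_mono) auto
  finally show "guess ((num_customers r)\<^sup>2) q \<le> base r ^ 6" by (simp add: N_def power_numeral_reduce)
qed

lemma greedy_test_iff:
  assumes v: "valid r" and L: "0 < L" and gs: "greedy_state r L t C s"
  shows "(2 * int (num_open r) + 1) * int (num_customers r) * L * (int (num_customers r) * int (num_customers r) - 1) <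
      int (num_customers r) * int (num_customers r) * s vTot 0 \<longleftrightarrow>
    \<not> rtotal (instance_of r) (scaled_guess r L) C \<le> 1 - 1 / (real (num_customers r))\<^sup>2"
proof -
  define n where "n = real (num_customers r)"
  define R where "R = rtotal (instance_of r) (scaled_guess r L) C"
  have n: "0 < n" using size_of_bounds(2)[OF v] by (simp add: n_def)
  have tot: "real_of_int (s vTot 0) = value_scale r L * R"
    using represents_total[of r L C "s vCap"] gs unfolding greedy_state_def R_def by metis
  have "(2 * int (num_open r) + 1) * int (num_customers r) * L * (int (num_customers r) * int (num_customers r) - 1) <
      int (num_customers r) * int (num_customers r) * s vTot 0 \<longleftrightarrow>
    real_of_int ((2 * int (num_open r) + 1) * int (num_customers r) * L * (int (num_customers r) * int (num_customers r) - 1)) <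
      real_of_int (int (num_customers r) * int (num_customers r) * s vTot 0)"
    by (simp only: of_int_less_iff)
  also have "\<dots> \<longleftrightarrow> value_scale r L * (n * n - 1) < n * n * (value_scale r L * R)"
    by (simp add: tot value_scale_def n_def)
  also have "\<dots> \<longleftrightarrow> value_scale r L * (n * n - 1) < value_scale r L * (n * n * R)" by (simp add: mult_ac)
  also have "\<dots> \<longleftrightarrow> n * n - 1 < n * n * R" using value_scale_pos[OF v L] by (rule mult_less_cancel_left_pos)
  also have "\<dots> \<longleftrightarrow> 1 - 1 / n\<^sup>2 < R" using n by (simp add: field_simps power2_eq_square)
  finally show ?thesis by (simp add: n_def R_def not_le)
qed

lemma greedy_state_card:
  assumes "valid r" "greedy_state r L t C s" "last_step (num_customers r) (num_open r) t"
  shows "C \<subseteq> centers (instance_of r)" "int (card C) \<le> size_bound (instance_of r)"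
proof -
  have "greedy (instance_of r) (scaled_guess r L) t C" using assms(2) unfolding greedy_state_def by blast
  from greedy_subset[OF this] show "C \<subseteq> centers (instance_of r)" "int (card C) \<le> size_bound (instance_of r)"
    using last_step_size_bound[OF assms(1), of t] assms(3) by auto
qed

text \<open>The contrapositive of \<open>greedy_last_step_rtotal\<close>.\<close>

lemma failed_guess:
  assumes "valid r" "0 < L" "greedy_state r L t C s" "last_step (num_customers r) (num_open r) t"
    "\<not> rtotal (instance_of r) (scaled_guess r L) C \<le> 1 - 1 / (real (num_customers r))\<^sup>2"
  shows "ereal (scaled_guess r L) \<le> lp_opt (instance_of r)"
proof (rule ccontr)
  assume "\<not> ?thesis"
  then have "lp_opt (instance_of r) < ereal (scaled_guess r L)" by simp
  moreover have "greedy (instance_of r) (scaled_guess r L) t C" using assms(3) unfolding greedy_state_def by blast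
  ultimately show False
    using greedy_last_step_rtotal[OF _ assms(1) scaled_guess_pos[OF assms(1,2)], of t C] assms(4,5) by simp
qed

text \<open>For \<open>q = 0\<close> the guess is \<open>1 / D\<close>, below which there is no
  positive cost. For \<open>q > 0\<close> the previous guess, which failed, is the lower bound on
  the optimum that \<open>solutionI\<close> asks for.\<close>

lemma successful_guess:
  assumes v: "valid r" and gs: "greedy_state r L t C s" "last_step (num_customers r) (num_open r) t"
    and L: "L = guess ((num_customers r)\<^sup>2) q"
    and tot: "rtotal (instance_of r) (scaled_guess r L) C \<le> 1 - 1 / (real (num_customers r))\<^sup>2"
    and prev: "0 < q \<Longrightarrow> ereal (scaled_guess r (guess ((num_customers r)\<^sup>2) (q - 1))) \<le> lp_opt (instance_of r)"
  shows "solution (instance_of r) C"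
proof -
  define N where "N = (num_customers r)\<^sup>2"
  have N: "0 < N" using size_of_bounds(2)[OF v] by (auto simp: N_def)
  have gp: "0 < guess N q" for q using guess_ge[of N q] N by linarith
  show ?thesis
  proof (rule solutionI[OF v])
    show "0 < scaled_guess r L" using gp[of q] by (intro scaled_guess_pos[OF v]) (simp add: L N_def)
    show "C \<subseteq> centers (instance_of r)" "int (card C) \<le> size_bound (instance_of r)"
      using greedy_state_card[OF v gs] by auto
    show "rtotal (instance_of r) (scaled_guess r L) C \<le> 1 - 1 / (real (card (customers (instance_of r))))\<^sup>2"
      using tot by simp
    show "(\<forall>(i, j)\<in>edges (instance_of r).
          cost (instance_of r) i j = 0 \<or> scaled_guess r L \<le> cost (instance_of r) i j) \<or>
        (\<exists>w. 0 < w \<and> ereal w \<le> lp_opt (instance_of r) \<and>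
          scaled_guess r L \<le> w * (1 + 1 / (real (card (customers (instance_of r))))\<^sup>2))"
    proof (cases q)
      case 0
      have "scaled_guess r L = 1 / real_of_int (common_denom r)"
        using size_of_bounds(2)[OF v] by (auto simp: L 0 scaled_guess_def)
      then show ?thesis using cost_zero_or_ge[OF v] by (auto simp del: instance_of_simps)
    next
      case (Suc q')
      let ?w = "scaled_guess r (guess N q')"
      have "real_of_int (guess N (Suc q')) \<le> real_of_int (guess N q') * (1 + 1 / real N)"
        by (rule guess_Suc_le_factor[OF N])
      then have "scaled_guess r L \<le> real_of_int (guess N q') * (1 + 1 / real N) /
          (real_of_int (common_denom r) * (real (num_customers r))\<^sup>2)"
        using common_denom_pos[of r] unfolding scaled_guess_def L Suc N_def[symmetric]
        by (intro divide_right_mono) auto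
      also have "\<dots> = ?w * (1 + 1 / real N)" by (simp add: scaled_guess_def)
      finally have "scaled_guess r L \<le> ?w * (1 + 1 / (real (card (customers (instance_of r))))\<^sup>2)"
        by (simp add: N_def)
      moreover have "0 < ?w" using gp by (intro scaled_guess_pos[OF v])
      moreover have "ereal ?w \<le> lp_opt (instance_of r)" using prev Suc by (simp add: N_def)
      ultimately show ?thesis by blast
    qed
  qed
qed

text \<open>A finite optimum is at most the sum of all costs, so a lower bound beyond this sum makes
  it infinite. The set of the failed run itself is then returned: its size is within the
  bound.\<close>

lemma exhausted_guesses:
  assumes v: "valid r" and gs: "greedy_state r L t C s" "last_step (num_customers r) (num_open r) t"
    and opt: "ereal (scaled_guess r L) \<le> lp_opt (instance_of r)"
    and L: "(int (num_customers r))\<^sup>2 * int_cost_sum r < L"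
  shows "solution (instance_of r) C"
proof (rule solution_if_lp_infeasible[OF v greedy_state_card[OF v gs]], rule ccontr)
  assume "lp_opt (instance_of r) \<noteq> \<infinity>"
  let ?S = "\<Sum>(i, j)\<in>edges (instance_of r). cost (instance_of r) i j"
  define D where "D = real_of_int (common_denom r)"
  define n where "n = real (num_customers r)"
  have pos: "0 < D" "0 < n" using common_denom_pos[of r] size_of_bounds(2)[OF v] by (auto simp: D_def n_def)
  have "ereal (scaled_guess r L) \<le> ereal ?S"
    using opt lp_opt_le_sum_cost[OF v \<open>lp_opt (instance_of r) \<noteq> \<infinity>\<close>] by (rule order_trans)
  then have "scaled_guess r L \<le> ?S" by (simp only: ereal_less_eq)
  also have "\<dots> \<le> real_of_int (int_cost_sum r) / D" using sum_cost_le[OF v] by (simp only: D_def)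
  finally have "real_of_int L / (D * n\<^sup>2) \<le> real_of_int (int_cost_sum r) / D"
    by (simp add: scaled_guess_def D_def n_def)
  then have "real_of_int L \<le> n\<^sup>2 * real_of_int (int_cost_sum r)"
    using pos by (simp add: field_simps)
  then have "real_of_int L \<le> real_of_int ((int (num_customers r))\<^sup>2 * int_cost_sum r)" by (simp add: n_def)
  then show False using L by (simp only: of_int_le_iff)
qed

text \<open>While the search runs, the previous guess is known to be a lower bound on the optimum,
  needed if the current guess succeeds, and to be at most the scaled sum of costs, which by
  \<open>guess_bounds\<close> limits \<open>q\<close> and keeps the measure positive.\<close>

definition search_inv :: "raw_instance \<Rightarrow> nat \<Rightarrow> memory \<Rightarrow> bool" where
  "search_inv r l s \<longleftrightarrow> ready r s \<and> s 1 = (\<lambda>_. 0) \<and>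
     (\<exists>q. s vGuess 0 = guess ((num_customers r)\<^sup>2) q \<and>
       (if 0 < s vRun 0
        then (0 < q \<longrightarrow> ereal (scaled_guess r (guess ((num_customers r)\<^sup>2) (q - 1))) \<le> lp_opt (instance_of r) \<and>
            guess ((num_customers r)\<^sup>2) (q - 1) \<le> (int (num_customers r))\<^sup>2 * int_cost_sum r) \<and>
          l = 12 * size_of r ^ 3 + 2 - q
        else l = 0 \<and> solution (instance_of r) {i. i < num_centers r \<and> 0 < s vSel (int i)}))"

lemma triple_try_guesses:
  "km.triple (\<lambda>r z s. ready r s \<and> s 1 = (\<lambda>_. 0) \<and> s vGuess 0 = guess ((num_customers r)\<^sup>2) 0 \<and> s vRun 0 = 1)
    try_guesses
    (\<lambda>r z s. has_input r s \<and> s 1 = (\<lambda>_. 0) \<and>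
      solution (instance_of r) {i. i < num_centers r \<and> 0 < s vSel (int i)})"
proof -
  have "km.triple (\<lambda>r (z :: 'a) s. \<exists>l \<le> 12 * size_of r ^ 3 + 2. search_inv r l s) try_guesses
    (\<lambda>r z s. \<exists>l. search_inv r l s \<and> \<not> 0 < aval (V vRun) s)"
    unfolding try_guesses_def
  proof (rule km.triple_While)
    show "poly_bounded size_of (\<lambda>r. 12 * size_of r ^ 3 + 2)" by (intro poly_bounded_intros)
  next
    show "km.triple (\<lambda>r (zl :: 'a \<times> nat) s. search_inv r (snd zl) s \<and> 0 < aval (V vRun) s)
       (Seq run_greedy
       (Seq (If (Sub (Mul (Mul nE nE) (V vTot))
                     (Mul (Mul (Mul (Add (Mul (Num 2) kE) (Num 1)) nE) (V vGuess))
                          (Sub (Mul nE nE) (Num 1))))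
              (If (Sub (V vGuess) (Mul (Mul nE nE) (V vSum))) (Write vRun (Num 0) (Num 0)) Skip)
              (Write vRun (Num 0) (Num 0)))
            (Write vGuess (Num 0) (Add (V vGuess) (Div (V vGuess) (Mul nE nE))))))
       (\<lambda>r zl s. \<exists>l' < snd zl. search_inv r l' s)"
    proof (rule km.triple_pre, (rule km.triple_Seq km.triple_If km.triple_Write km.triple_Skip
          km.triple_call[OF triple_run_greedy])+, goal_cases)
      case (1 r zl s)
      define l where "l = snd zl"
      define N where "N = (num_customers r)\<^sup>2"
      from 1 obtain q where rdy: "ready r s" and out: "s 1 = (\<lambda>_. 0)" and run: "0 < s vRun 0"
        and g: "s vGuess 0 = guess N q" and l: "l = 12 * size_of r ^ 3 + 2 - q"
        and prev: "0 < q \<Longrightarrow> ereal (scaled_guess r (guess N (q - 1))) \<le> lp_opt (instance_of r)"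
          "0 < q \<Longrightarrow> guess N (q - 1) \<le> (int (num_customers r))\<^sup>2 * int_cost_sum r"
        by (auto simp: search_inv_def l_def N_def)
      have v: "valid r" using rdy by (simp add: ready_def has_input_def)
      note b = base_ge[OF v]
      have N: "0 < N" using size_of_bounds(2)[OF v] by (auto simp: N_def)
      have L: "0 < guess N q" using guess_ge[of N q] N by linarith
      have qb: "q \<le> 12 * size_of r ^ 3" "guess N q \<le> base r ^ 6"
        using guess_bounds[OF v, of q] prev(2) by (auto simp: N_def)
      have Nint: "int (num_customers r) * int (num_customers r) = int N" by (simp add: N_def power2_eq_square)
      have next_le: "\<bar>guess N q + guess N q div int N\<bar> \<le> capacity r"
      proof -
        have "guess N (Suc q) \<le> 2 * base r ^ 6" using guess_Suc_le_double[of N q] qb(2) by linarith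
        also have "\<dots> \<le> base r * base r ^ 6" using b by (intro mult_right_mono) auto
        finally have "guess N (Suc q) \<le> base r ^ 7" by (simp add: power_numeral_reduce)
        then show ?thesis using guess_ge[of N "Suc q"] le_capacity[OF v, of 7 "guess N (Suc q)"] by simp
      qed
      show ?case
      proof (intro conjI allI impI, goal_cases)
        case 1 show ?case by (rule rdy)
      next
        case 2 show ?case using g L by simp
      next
        case 3 show ?case using g qb by simp
      next
        case (4 s')
        then obtain t C where sx: "same_except greedy_vars s s'" and gs: "greedy_state r (guess N q) t C s'"
          and last: "last_step (num_customers r) (num_open r) t" using g by auto
        have rdy': "ready r s'" by (rule ready_cong[OF rdy]) (use sx in \<open>auto simp: same_except_def\<close>)
        have eq': "s' 1 = (\<lambda>_. 0)" "s' vGuess 0 = guess N q" "s' vRun = s vRun" "s' vSum 0 = int_cost_sum r"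
          using sx out g rdy' by (auto simp: same_except_def ready_def)
        have C: "C = {i. i < num_centers r \<and> 0 < s' vSel (int i)}" using gs by (simp add: greedy_state_def)
        define fail where "fail \<longleftrightarrow>
          \<not> rtotal (instance_of r) (scaled_guess r (guess N q)) C \<le> 1 - 1 / (real (num_customers r))\<^sup>2"
        have hdr: "aval nE (s'(x := y)) = int (num_customers r)" "aval nE s' = int (num_customers r)"
          "aval kE s' = int (num_open r)" if "x \<noteq> 0" for x y
          using rdy' that aval_header[of r "s'(x := y)"] aval_header[of r s']
          by (auto simp: ready_def has_input_def)
        note hdr' = hdr(1) hdr(2,3)[of 1, simplified]
        have test: "0 < aval (Sub (Mul (Mul nE nE) (V vTot))
                     (Mul (Mul (Mul (Add (Mul (Num 2) kE) (Num 1)) nE) (V vGuess))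
                          (Sub (Mul nE nE) (Num 1)))) s' \<longleftrightarrow> fail"
          using greedy_test_iff[OF v L gs] hdr' eq' by (simp add: fail_def)
        have test2: "0 < aval (Sub (V vGuess) (Mul (Mul nE nE) (V vSum))) s' \<longleftrightarrow>
            (int (num_customers r))\<^sup>2 * int_cost_sum r < guess N q"
          using hdr' eq' by (simp add: power2_eq_square)
        have sel: "solution (instance_of r) C" if "\<not> fail"
          by (rule successful_guess[OF v gs last, of q]) (use that prev(1) in \<open>auto simp: N_def fail_def\<close>)
        have opt: "ereal (scaled_guess r (guess N q)) \<le> lp_opt (instance_of r)" if fail
          using failed_guess[OF v L gs last] that by (simp add: fail_def)
        have sel2: "solution (instance_of r) C"
          if fail "(int (num_customers r))\<^sup>2 * int_cost_sum r < guess N q"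
          using exhausted_guesses[OF v gs last opt] that by blast
        let ?stop = "s'(vRun := (s' vRun)(0 := 0), vGuess := (s' vGuess)(0 := guess N q + guess N q div int N))"
        let ?go = "s'(vGuess := (s' vGuess)(0 := guess N q + guess N q div int N))"
        have stop: "\<exists>l' < l. search_inv r l' ?stop" if "solution (instance_of r) C"
        proof (intro exI[of _ 0] conjI)
          show "0 < l" using l qb by simp
          have "ready r ?stop" by (rule ready_cong[OF rdy']) auto
          then show "search_inv r 0 ?stop"
            using that C eq' unfolding search_inv_def by (auto simp: N_def intro!: exI[of _ "Suc q"])
        qed
        have go: "\<exists>l' < l. search_inv r l' ?go"
          if fail "\<not> (int (num_customers r))\<^sup>2 * int_cost_sum r < guess N q"
        proof (intro exI[of _ "12 * size_of r ^ 3 + 2 - Suc q"] conjI)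
          show "12 * size_of r ^ 3 + 2 - Suc q < l" using l qb by simp
          have "ready r ?go" by (rule ready_cong[OF rdy']) auto
          then show "search_inv r (12 * size_of r ^ 3 + 2 - Suc q) ?go"
            using that opt run eq' unfolding search_inv_def by (auto simp: N_def intro!: exI[of _ "Suc q"])
        qed
        have cap0: "0 \<le> capacity r" using header_le_capacity(4)[OF v] by simp
        have val: "aval (Add (V vGuess) (Div (V vGuess) (Mul nE nE))) (s'(vRun := f)) =
            guess N q + guess N q div int N"
          "aval (Add (V vGuess) (Div (V vGuess) (Mul nE nE))) s' = guess N q + guess N q div int N" for f
          using hdr' eq' Nint by simp_all
        show ?case
          unfolding test test2 aval.simps(1) val l_def[symmetric]
          using sel sel2 stop go next_le cap0 by simp
      qed
    qed
  qed
  then show ?thesis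
  proof (rule km.triple_conseq, goal_cases)
    case (1 r z s)
    then have "search_inv r (12 * size_of r ^ 3 + 2) s"
      unfolding search_inv_def by (auto intro!: exI[of _ "0::nat"])
    then show ?case by blast
  next
    case (2 r z s)
    then show ?case by (auto simp: search_inv_def ready_def)
  qed
qed

section \<open>Output and the complete program\<close>

lemma triple_write_output:
  "km.triple (\<lambda>r s0 s. s = s0 \<and> has_input r s \<and> s 1 = (\<lambda>_. 0))
    write_output
    (\<lambda>r s0 s. output_list s = map int (filter (\<lambda>i. 0 < s0 vSel (int i)) [0..<num_centers r]))"
proof -
  define sel where "sel s0 l = filter (\<lambda>i. 0 < s0 vSel (int i)) [0..<l]" for s0 :: memory and l
  define Inv where "Inv r s0 l s \<longleftrightarrow> has_input r s \<and> l \<le> num_centers r \<and> same_except {1, vI} s0 s \<and>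
      s 1 0 = int (length (sel s0 l)) \<and> output_list s = map int (sel s0 l)" for r s0 l s
  have "km.triple (\<lambda>r s0 s. Inv r s0 0 s) write_output (\<lambda>r s0 s. Inv r s0 (num_centers r) s)"
    unfolding write_output_def
  proof (rule km.triple_For)
    show "km.triple (\<lambda>r zl s. Inv r (fst zl) (snd zl) s \<and> s vI 0 = int (snd zl) \<and> snd zl < num_centers r)
      (If (Read vSel (V vI))
         (Seq (Write 1 (Num 0) (Add (V 1) (Num 1))) (Write 1 (V 1) (V vI)))
         Skip)
      (\<lambda>r zl s. Inv r (fst zl) (Suc (snd zl)) s \<and> s vI 0 = int (snd zl))"
    proof (rule km.triple_pre, (rule km.triple_If km.triple_Seq km.triple_Write km.triple_Skip)+, goal_cases)
      case (1 r zl s)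
      obtain s0 l where zl: "zl = (s0, l)" by (cases zl)
      define c where "c = length (sel s0 l)"
      have v: "valid r" using 1 by (auto simp: Inv_def has_input_def)
      have l: "l < num_centers r" "s vI 0 = int l" and c1: "s 1 0 = int c"
        and o: "output_list s = map int (sel s0 l)" and eq: "s vSel = s0 vSel"
        using 1 by (auto simp: zl Inv_def c_def same_except_def)
      have "c \<le> l" unfolding c_def sel_def using length_filter_le[of _ "[0..<l]"] by simp
      then have bnd: "int c + 1 \<le> capacity r" "int l \<le> capacity r"
        using l header_le_capacity(1)[OF v] by linarith+
      \<comment> \<open>Cell 0 holds the length of the output; once incremented, it is also the
        index of the new entry.\<close>
      let ?s = "s(1 := (s 1)(0 := int c + 1, int c + 1 := int l))"
      have "output_list ?s = map int (sel s0 (Suc l))" if "0 < s0 vSel (int l)"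
      proof -
        have new: "?s 1 0 = int c + 1" "?s 1 (int (Suc c)) = int l" by auto
        have "output_list ?s = map (\<lambda>i. ?s 1 (int i)) [1..<Suc (Suc c)]"
          unfolding output_list_def new(1) by (simp add: nat_add_distrib)
        also have "\<dots> = map (\<lambda>i. ?s 1 (int i)) [1..<Suc c] @ [int l]"
          using new(2) by simp
        also have "map (\<lambda>i. ?s 1 (int i)) [1..<Suc c] = map (\<lambda>i. s 1 (int i)) [1..<Suc c]"
          by (rule map_cong) auto
        also have "\<dots> = output_list s" unfolding output_list_def c1 by simp
        also have "\<dots> @ [int l] = map int (sel s0 (Suc l))" using that by (simp add: o sel_def)
        finally show ?thesis .
      qed
      then show ?case using 1 l bnd c1 eq o
        by (auto simp: zl Inv_def same_except_def has_input_def sel_def c_def)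
    qed
    show "aval pE s = int (num_centers r) \<and> int (num_centers r) \<le> capacity r \<and> num_centers r \<le> size_of r"
      if "Inv r z l s" for r z l s
      using that aval_header[of r s] header_le_capacity[of r] size_of_bounds[of r]
      by (auto simp: Inv_def has_input_def)
    show "Inv r z l (s(vI := f))" if "Inv r z l s" for r z l s f
      using that by (auto simp: Inv_def same_except_def has_input_def output_list_def)
  qed
  then show ?thesis
    by (rule km.triple_conseq) (auto simp: Inv_def same_except_def sel_def output_list_def)
qed

lemma triple_kmedian_program:
  "km.triple (\<lambda>r (z :: unit) s. valid r \<and> s = input_memory (encode_instance r)) kmedian_program
    (\<lambda>r z s. distinct (output_list s) \<and>
      (\<exists>C. solution (instance_of r) C \<and> set (output_list s) = int ` C))"
  unfolding kmedian_program_def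
proof (rule km.triple_pre, rule km.triple_Seq[OF km.triple_Seq[OF km.triple_call[OF triple_write_output]]],
    rule km.triple_conseq[OF triple_try_guesses], assumption)
  fix r z s
  assume *: "has_input r s \<and> s 1 = (\<lambda>_. 0) \<and>
      solution (instance_of r) {i. i < num_centers r \<and> 0 < s vSel (int i)}"
  let ?f = "filter (\<lambda>i. 0 < s vSel (int i)) [0..<num_centers r]"
  have "set (map int ?f) = int ` {i. i < num_centers r \<and> 0 < s vSel (int i)}" by auto
  moreover have "distinct (map int ?f)" by (simp add: distinct_map)
  ultimately show "(has_input r s \<and> s 1 = (\<lambda>_. 0)) \<and>
      (\<forall>s'. output_list s' = map int ?f \<longrightarrow>
        distinct (output_list s') \<and> (\<exists>C. solution (instance_of r) C \<and> set (output_list s') = int ` C))"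
    using * by auto
next
  show "km.triple (\<lambda>r z s. has_input r s \<and> (\<forall>b. b \<noteq> 0 \<longrightarrow> s b = (\<lambda>_. 0))) prepare
    (\<lambda>r z s. ready r s \<and> s 1 = (\<lambda>_. 0) \<and> s vGuess 0 = guess ((num_customers r)\<^sup>2) 0 \<and> s vRun 0 = 1)"
    by (rule triple_prepare)
next
  fix r z s
  assume "valid r \<and> s = input_memory (encode_instance r)"
  then show "has_input r s \<and> (\<forall>b. b \<noteq> 0 \<longrightarrow> s b = (\<lambda>_. 0))"
    by (auto simp: has_input_def input_memory_def)
qed

lemma bounded_input_memory:
  assumes "valid r"
  shows "bounded_memory (capacity r) (input_memory (encode_instance r))"
proof -
  have "\<bar>encode_instance r ! q\<bar> \<le> capacity r" if "q < length (encode_instance r)" for q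
    using abs_nth_le_power_input_size[OF that] by (intro le_capacity[OF assms, of 1]) (auto simp: base_def)
  then show ?thesis
    using header_le_capacity(4)[OF assms] by (auto simp: bounded_memory_def input_memory_def)
qed

text \<open>Inputs of the machine have rational costs, so existence for arbitrary real costs is a
  separate conjunct. Distinctness makes the output an enumeration of the set, without
  repetitions.\<close>

theorem theorem1:
  shows "(\<forall>I :: ('u, 'w) kmedian. admissible I \<longrightarrow> (\<exists>C. solution I C)) \<and>
    polytime_computable encode_instance
      {r. admissible (instance_of r)}
      (\<lambda>r ys. distinct ys \<and> (\<exists>C. solution (instance_of r) C \<and> set ys = int ` C))"
proof (intro conjI allI impI)
  fix I :: "('u, 'w) kmedian"
  assume "admissible I"
  then show "\<exists>C. solution I C" by (rule solution_exists)
next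
  have "km.triple (\<lambda>r (_ :: unit) s. r \<in> {r. valid r} \<and> s = input_memory (encode_instance r)) kmedian_program
    (\<lambda>r _ s. distinct (output_list s) \<and>
      (\<exists>C. solution (instance_of r) C \<and> set (output_list s) = int ` C))"
    by (rule km.triple_pre[OF triple_kmedian_program]) simp
  then show "polytime_computable encode_instance {r. admissible (instance_of r)}
      (\<lambda>r ys. distinct ys \<and> (\<exists>C. solution (instance_of r) C \<and> set ys = int ` C))"
    by (rule km.triple_polytime_computable) (auto intro: bounded_input_memory)
qed

end
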